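(* Let $\phi\in\mathfrak{SB}_0$ have potential density $u^\phi$ satisfying $\int_0^1|\log(t)|\,u^\phi(t)\,dt<\infty$. Let $M$ be an $E$-valued Feller process with Feller semigroup $(P_t)_{t\ge0}$ on $C_0(E)$ and generator $(G,\mathsf{Dom}(G))$. Let $S$ be a real-valued, strictly increasing càdlàg process with independent and stationary increments, independent of $M$, such that the subordinator $S_0(t)=S(t)-S(0)$ satisfies $\phi(\lambda)=-\log\mathbb E^{(x,0)}[e^{-\lambda S_0(1)}]$. Let $H$ be the undershooting of $S$ and $X(t)=M(H(t))$. Suppose that $S_0(t)$ admits a density $g_{S_0}(\cdot;t)$ under $\mathbb P^{(x,0)}$ (for each $t>0$). Then, for all $u\in\mathsf{Dom}(G)$, the function $$q(t,x)=\mathbb E^{(x,0)}[u(X(t))]$$ is the unique function $q:[0,\infty)\times E\to\mathbb R$ which is a solution of $$\begin{cases}\phi(\partial_t-G)q(t,x)=\overline\nu_\phi(t)\,q(0,x), & t>0,\ x\in E,\\ q(0,x)=u(x), & x\in E,\end{cases}$$ and satisfies $\lim_{x\to\infty}q(t,x)=0$ locally uniformly with respect to $t\ge0$.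
   Context: $E$ is a locally compact separable Hausdorff space; $C_0(E)$ is the space of continuous functions vanishing at infinity, with the sup norm. Bernstein functions: $\mathfrak B_0$ is the set of functions $\phi(\lambda)=\int_{(0,\infty)}(1-e^{-\lambda t})\,\nu_\phi(dt)$ with $\nu_\phi$ a Borel measure on $(0,\infty)$ such that $\int(1\wedge t)\nu_\phi(dt)<\infty$ and $\nu_\phi(0,\infty)=\infty$. $\mathfrak{SB}_0$ is the set of $\phi\in\mathfrak B_0$ that are special, i.e. $\lambda/\phi(\lambda)$ is also a Bernstein function. Put $\overline\nu_\phi(t)=\nu_\phi((t,\infty))$. Probability: under $\mathbb P^{(x,v)}$ one has $M(0)=x$ and $S(0)=v$ almost surely; $\mathbb E^{(x,v)}$ is the expectation. $L(t)=\inf\{r\ge0:S(r)>t\}$, and the undershooting of $S$ is $H(t)=S_0(L(t)-)$, with the convention $f(0-)=f(0)$. With $L_0(t)=\inf\{r\ge 0:S_0(r)>t\}$ set $U^\phi(t)=\mathbb E[L_0(t)]$; for $\phi\in\mathfrak{SB}_0$ one has $U^\phi(dt)=u^\phi(t)\,dt$ with $u^\phi:(0,\infty)\to(0,\infty)$ non-increasing, called the potential density. Operator: for a Borel $f:[0,\infty)\times E\to\mathbb R$ with $f(t,\cdot)\in C_0(E)$ for all $t\ge0$, $$-\phi(\partial_t-G)f(t,x)=\int_{(0,\infty)}\big(P_sf(t-s,\cdot)(x)\,\mathbf 1_{[0,t]}(s)-f(t,x)\big)\,\nu_\phi(ds),$$ which is said to be well-defined at $(t,x)$ if the integrand is $\nu_\phi$-integrable;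 $\phi(\partial_t-G)f$ is its negative. Solution: $q:[0,\infty)\times E\to\mathbb R$ is a solution if $q$ is continuous, $\phi(\partial_t-G)q(t,x)$ is well-defined for all $(t,x)\in(0,\infty)\times E$, and the displayed equalities hold everywhere. "$\lim_{x\to\infty}q(t,x)=0$ locally uniformly with respect to $t\ge0$" means: for all $T>0$ and $\varepsilon>0$ there is a compact $K\subset E$ with $\sup_{x\notin K}|q(t,x)|<\varepsilon$ for all $t\in[0,T]$. *)

theory Defs
  imports "HOL-Probability.Probability"
begin

section \<open>Special Bernstein functions\<close>

definition bernstein :: "(real \<Rightarrow> real) \<Rightarrow> bool" where
  "bernstein f \<longleftrightarrow>
     (\<forall>l>0. f l \<ge> 0) \<and>
     (\<forall>n. \<forall>l>0. (deriv ^^ n) f differentiable (at l)) \<and>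
     (\<forall>n\<ge>1. \<forall>l>0. (- 1) ^ (n - 1) * (deriv ^^ n) f l \<ge> 0)"

definition levy_measure_of :: "(real \<Rightarrow> real) \<Rightarrow> real measure \<Rightarrow> bool" where
  "levy_measure_of \<phi> \<nu> \<longleftrightarrow>
     sets \<nu> = sets (restrict_space borel {0<..}) \<and>
     (\<integral>\<^sup>+ t. ennreal (min 1 t) \<partial>\<nu>) < \<infinity> \<and>
     emeasure \<nu> {0<..} = \<infinity> \<and>
     (\<forall>l>0. \<phi> l = (\<integral> t. 1 - exp (- l * t) \<partial>\<nu>))"

definition B0 :: "(real \<Rightarrow> real) set" where
  "B0 = {\<phi>. \<exists>\<nu>. levy_measure_of \<phi> \<nu>}"

definition SB0 :: "(real \<Rightarrow> real) set" where
  "SB0 = {\<phi> \<in> B0. bernstein (\<lambda>l. l / \<phi> l)}"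

definition levy_tail :: "real measure \<Rightarrow> real \<Rightarrow> real" where
  "levy_tail \<nu> t = measure \<nu> {t<..}"


section \<open>Feller semigroups and Feller processes\<close>

definition C0 :: "('e::topological_space \<Rightarrow> real) set" where
  "C0 = {u. continuous_on UNIV u \<and>
            (\<forall>\<epsilon>>0. \<exists>K. compact K \<and> (\<forall>x. x \<notin> K \<longrightarrow> \<bar>u x\<bar> < \<epsilon>))}"

text \<open>Convergence in the sup norm is \<^const>\<open>uniform_limit\<close> on \<^const>\<open>UNIV\<close>. The values of
  the semigroup outside \<open>C0\<close> or at negative times are irrelevant.\<close>

definition feller_semigroup ::
  "(real \<Rightarrow> ('e::topological_space \<Rightarrow> real) \<Rightarrow> 'e \<Rightarrow> real) \<Rightarrow> bool" where
  "feller_semigroup P \<longleftrightarrow>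
     (\<forall>t\<ge>0. \<forall>u\<in>C0. P t u \<in> C0) \<and>
     (\<forall>t\<ge>0. \<forall>u\<in>C0. \<forall>w\<in>C0. \<forall>a b x. P t (\<lambda>y. a * u y + b * w y) x = a * P t u x + b * P t w x) \<and>
     (\<forall>t\<ge>0. \<forall>u\<in>C0. (\<forall>x. 0 \<le> u x \<and> u x \<le> 1) \<longrightarrow> (\<forall>x. 0 \<le> P t u x \<and> P t u x \<le> 1)) \<and>
     (\<forall>u\<in>C0. P 0 u = u) \<and>
     (\<forall>s\<ge>0. \<forall>t\<ge>0. \<forall>u\<in>C0. P (s + t) u = P s (P t u)) \<and>
     (\<forall>u\<in>C0. uniform_limit UNIV (\<lambda>t. P t u) u (at_right 0))"

definition generates ::
  "(real \<Rightarrow> ('e::topological_space \<Rightarrow> real) \<Rightarrow> 'e \<Rightarrow> real) \<Rightarrow> ('e \<Rightarrow> real) \<Rightarrow> ('e \<Rightarrow> real) \<Rightarrow> bool" where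
  "generates P u g \<longleftrightarrow> u \<in> C0 \<and> g \<in> C0 \<and>
     uniform_limit UNIV (\<lambda>t x. (P t u x - u x) / t) g (at_right 0)"

definition generator_dom ::
  "(real \<Rightarrow> ('e::topological_space \<Rightarrow> real) \<Rightarrow> 'e \<Rightarrow> real) \<Rightarrow> ('e \<Rightarrow> real) set" where
  "generator_dom P = {u. \<exists>g. generates P u g}"

definition cadlag :: "(real \<Rightarrow> 'e::topological_space) \<Rightarrow> bool" where
  "cadlag f \<longleftrightarrow> (\<forall>t\<ge>0. (f \<longlongrightarrow> f t) (at_right t)) \<and> (\<forall>t>0. \<exists>l. (f \<longlongrightarrow> l) (at_left t))"

definition path_algebra ::
  "'w measure \<Rightarrow> real set \<Rightarrow> (real \<Rightarrow> 'w \<Rightarrow> 'e::topological_space) \<Rightarrow> 'w measure" where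
  "path_algebra Q T X = sigma (space Q) {X r -` B \<inter> space Q | r B. r \<in> T \<and> B \<in> sets borel}"

text \<open>Time is \<open>{0..}\<close>. Paths are cadlag for every sample point, not only almost surely, so that
  evaluation of the process at a random time is measurable. The Markov property refers to the
  natural filtration.\<close>

definition feller_process_from ::
  "'w measure \<Rightarrow> (real \<Rightarrow> ('e::t2_space \<Rightarrow> real) \<Rightarrow> 'e \<Rightarrow> real) \<Rightarrow> (real \<Rightarrow> 'w \<Rightarrow> 'e) \<Rightarrow> 'e \<Rightarrow> bool" where
  "feller_process_from Q P M x \<longleftrightarrow>
     (\<forall>t\<ge>0. M t \<in> measurable Q borel) \<and>
     (\<forall>\<omega>\<in>space Q. cadlag (\<lambda>t. M t \<omega>)) \<and>
     (AE \<omega> in Q. M 0 \<omega> = x) \<and>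
     (\<forall>s\<ge>0. \<forall>t\<ge>0. \<forall>u\<in>C0.
        AE \<omega> in Q. real_cond_exp Q (path_algebra Q {0..s} M) (\<lambda>\<omega>. u (M (s + t) \<omega>)) \<omega>
                    = P t u (M s \<omega>))"


section \<open>Strictly increasing processes with stationary independent increments\<close>

definition increasing_levy_from :: "'w measure \<Rightarrow> (real \<Rightarrow> 'w \<Rightarrow> real) \<Rightarrow> real \<Rightarrow> bool" where
  "increasing_levy_from Q S v \<longleftrightarrow>
     (\<forall>t\<ge>0. S t \<in> borel_measurable Q) \<and>
     (\<forall>\<omega>\<in>space Q. cadlag (\<lambda>t. S t \<omega>) \<and> strict_mono_on {0..} (\<lambda>t. S t \<omega>)) \<and>
     (AE \<omega> in Q. S 0 \<omega> = v) \<and>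
     (\<forall>n. \<forall>t::nat \<Rightarrow> real. 0 \<le> t 0 \<and> mono t \<longrightarrow>
        prob_space.indep_vars Q (\<lambda>_. borel) (\<lambda>i \<omega>. S (t (Suc i)) \<omega> - S (t i) \<omega>) {..<n}) \<and>
     (\<forall>s\<ge>0. \<forall>h\<ge>0. distr Q borel (\<lambda>\<omega>. S (s + h) \<omega> - S s \<omega>) = distr Q borel (\<lambda>\<omega>. S h \<omega> - S 0 \<omega>))"

text \<open>Under the probability \<open>Q\<close>, the whole processes \<open>M\<close> and \<open>S\<close> are independent.\<close>

definition independent_processes ::
  "'w measure \<Rightarrow> (real \<Rightarrow> 'w \<Rightarrow> 'a::topological_space) \<Rightarrow> (real \<Rightarrow> 'w \<Rightarrow> 'b::topological_space) \<Rightarrow> bool" where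
  "independent_processes Q M S \<longleftrightarrow>
     prob_space.indep_set Q (sets (path_algebra Q {0..} M)) (sets (path_algebra Q {0..} S))"

definition from_zero :: "(real \<Rightarrow> 'w \<Rightarrow> real) \<Rightarrow> real \<Rightarrow> 'w \<Rightarrow> real" where
  "from_zero S t \<omega> = S t \<omega> - S 0 \<omega>"

text \<open>A path that never exceeds \<open>t\<close> would have first passage time \<open>\<infinity>\<close>. For the processes above
  the set of such sample points is null; the value \<open>0\<close> given there replaces the unspecified
  \<open>Inf {}\<close>.\<close>

definition first_passage :: "(real \<Rightarrow> 'w \<Rightarrow> real) \<Rightarrow> real \<Rightarrow> 'w \<Rightarrow> real" where
  "first_passage S t \<omega> =
     (if \<exists>r\<ge>0. S r \<omega> > t then Inf {r. r \<ge> 0 \<and> S r \<omega> > t} else 0)"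

definition left_limit :: "(real \<Rightarrow> real) \<Rightarrow> real \<Rightarrow> real" where
  "left_limit f r = (if r = 0 then f 0 else Lim (at_left r) f)"

definition undershooting :: "(real \<Rightarrow> 'w \<Rightarrow> real) \<Rightarrow> real \<Rightarrow> 'w \<Rightarrow> real" where
  "undershooting S t \<omega> = left_limit (\<lambda>r. from_zero S r \<omega>) (first_passage S t \<omega>)"

definition time_changed :: "(real \<Rightarrow> 'w \<Rightarrow> 'e) \<Rightarrow> (real \<Rightarrow> 'w \<Rightarrow> real) \<Rightarrow> real \<Rightarrow> 'w \<Rightarrow> 'e" where
  "time_changed M S t \<omega> = M (undershooting S t \<omega>) \<omega>"

text \<open>\<open>p\<close> is the non-increasing density of the measure with distribution function
  \<open>U(t) = E[L\<^sub>0(t)]\<close>, expectation under \<open>Q\<close>.\<close>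

definition potential_density :: "'w measure \<Rightarrow> (real \<Rightarrow> 'w \<Rightarrow> real) \<Rightarrow> (real \<Rightarrow> real) \<Rightarrow> bool" where
  "potential_density Q S p \<longleftrightarrow>
     (\<forall>t>0. p t > 0) \<and> antimono_on {0<..} p \<and>
     (\<forall>t\<ge>0. (\<integral>\<^sup>+ \<omega>. ennreal (first_passage (from_zero S) t \<omega>) \<partial>Q)
             = (\<integral>\<^sup>+ s\<in>{0<..t}. ennreal (p s) \<partial>lborel))"


section \<open>The non-local operator and its evolution problem\<close>

definition operand :: "(real \<Rightarrow> 'e::topological_space \<Rightarrow> real) \<Rightarrow> bool" where
  "operand f \<longleftrightarrow>
     (\<lambda>(t, x). f t x) \<in> borel_measurable (restrict_space borel ({0..} \<times> UNIV)) \<and>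
     (\<forall>t\<ge>0. f t \<in> C0)"

text \<open>The indicator cancels the terms in which \<open>f\<close> would be evaluated at a negative time.\<close>

definition phi_integrand ::
  "(real \<Rightarrow> ('e \<Rightarrow> real) \<Rightarrow> 'e \<Rightarrow> real) \<Rightarrow> (real \<Rightarrow> 'e \<Rightarrow> real) \<Rightarrow> real \<Rightarrow> 'e \<Rightarrow> real \<Rightarrow> real" where
  "phi_integrand P f t x s = P s (f (t - s)) x * indicator {0..t} s - f t x"

definition phi_well_defined ::
  "real measure \<Rightarrow> (real \<Rightarrow> ('e \<Rightarrow> real) \<Rightarrow> 'e \<Rightarrow> real) \<Rightarrow> (real \<Rightarrow> 'e \<Rightarrow> real) \<Rightarrow> real \<Rightarrow> 'e \<Rightarrow> bool" where
  "phi_well_defined \<nu> P f t x \<longleftrightarrow> integrable \<nu> (phi_integrand P f t x)"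

definition phi_op ::
  "real measure \<Rightarrow> (real \<Rightarrow> ('e \<Rightarrow> real) \<Rightarrow> 'e \<Rightarrow> real) \<Rightarrow> (real \<Rightarrow> 'e \<Rightarrow> real) \<Rightarrow> real \<Rightarrow> 'e \<Rightarrow> real" where
  "phi_op \<nu> P f t x = - (\<integral> s. phi_integrand P f t x s \<partial>\<nu>)"

definition is_solution ::
  "real measure \<Rightarrow> (real \<Rightarrow> ('e::topological_space \<Rightarrow> real) \<Rightarrow> 'e \<Rightarrow> real) \<Rightarrow> ('e \<Rightarrow> real)
     \<Rightarrow> (real \<Rightarrow> 'e \<Rightarrow> real) \<Rightarrow> bool" where
  "is_solution \<nu> P u q \<longleftrightarrow>
     operand q \<and>
     continuous_on ({0..} \<times> UNIV) (\<lambda>(t, x). q t x) \<and>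
     (\<forall>t>0. \<forall>x. phi_well_defined \<nu> P q t x \<and> phi_op \<nu> P q t x = levy_tail \<nu> t * q 0 x) \<and>
     (\<forall>x. q 0 x = u x)"

definition vanishes_locally_uniformly :: "(real \<Rightarrow> 'e::topological_space \<Rightarrow> real) \<Rightarrow> bool" where
  "vanishes_locally_uniformly q \<longleftrightarrow>
     (\<forall>T>0. \<forall>\<epsilon>>0. \<exists>K. compact K \<and> (\<forall>t\<in>{0..T}. \<forall>x. x \<notin> K \<longrightarrow> \<bar>q t x\<bar> < \<epsilon>))"

end

theory Submission
  imports Defs "HOL-Real_Asymp.Real_Asymp"
begin

text \<open>
  Write \<open>T(y) = \<nu> (y, \<infinity>)\<close> and \<open>F\<^sub>x(y) = P\<^sub>y u(x)\<close>. Conditioning on \<open>S\<close> gives \<open>q(t, x) = E[F\<^sub>x(H(t))]\<close>, and a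
  double Laplace transform shows that \<open>H(t)\<close> has the density \<open>p(y) T(t - y)\<close> on \<open>(0, t)\<close>; in particular
  \<open>p * T = 1\<close>. Because \<open>p\<close> is non-increasing, \<open>s + H(t - s)\<close> dominates \<open>H(t)\<close> stochastically. With
  \<open>D\<^sub>s(r) = P(s + H(t - s) > r) - P(H(t) > r) \<ge> 0\<close> one has
  \<open>P\<^sub>s q(t - s)(x) - q(t, x) = \<integral> F\<^sub>x'(r) D\<^sub>s(r) dr\<close> over \<open>(0, t)\<close>, and \<open>p * T = 1\<close> yields
  \<open>\<integral> D\<^sub>s(r) \<nu>(ds) = \<nu> [t, \<infinity>) P(H(t) > r)\<close>, where \<open>s\<close> ranges over \<open>(0, t)\<close>. Fubini's theorem then gives both the
  integrability and the equation, at every \<open>t\<close> since \<open>\<nu>\<close> has no atoms. Uniqueness is the maximum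
  principle, applied at the first time at which a positive maximum is attained.
\<close>

section \<open>Laplace transforms of finite measures\<close>

text \<open>The law of H(t) is obtained from increments of \<open>S\<close> along a time grid,
  without the jump measure of \<open>S\<close>: H(t) is approximated by the value at the last grid
  point before the first passage. For a fixed mesh the double Laplace transform is a geometric
  series in closed form; then the mesh tends to 0. Laplace inversion identifies functions of t only
  almost everywhere, while the problem is posed at every t > 0. The gap closes because
  E[exp(-a H(t))] is monotone in t and its candidate value is continuous in t. The obstacle in the
  equation is the infinite mass of \<nu> near 0, which forbids integrating the two laws in D
  separately. The monotonicity of p supplies a sign: the exchanges of integrals behind the identity
  for D concern nonnegative functions, and the cut-off in \<open>psi\<close> is designed for that.
  The domain of the generator enters through a bound C for Gu. It makes the orbit of u Lipschitz,
  hence q Lipschitz in t uniformly in x, which yields joint continuity and locally uniform decay at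
  infinity.\<close>

lemma integral_exp_power_eq:
  fixes M N :: "real measure" and G :: "real \<Rightarrow> real"
  assumes M: "finite_measure M" "sets M = sets borel" "AE x in M. 0 \<le> x"
    and N: "finite_measure N" "sets N = sets borel" "AE x in N. 0 \<le> x"
    and eq: "\<And>k::nat. (\<integral>x. exp (- (real k * x)) \<partial>M) = (\<integral>x. exp (- (real k * x)) \<partial>N)"
    and G: "continuous_on UNIV G"
  shows "(\<integral>x. G (exp (- x)) \<partial>M) = (\<integral>x. G (exp (- x)) \<partial>N)"
proof -
  note [measurable_cong] = M(2) N(2)
  have Gm [measurable]: "G \<in> borel_measurable borel"
    using G by (rule borel_measurable_continuous_onI)
  define c where "c = measure M (space M) + measure N (space N)"
  have int: "integrable K (\<lambda>x. h (exp (- x)))"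
    if K: "finite_measure K" "sets K = sets borel" "AE x in K. 0 \<le> x" and h: "continuous_on UNIV h"
    for K :: "real measure" and h :: "real \<Rightarrow> real"
  proof -
    interpret finite_measure K by fact
    have [measurable]: "h \<in> borel_measurable borel"
      using h by (rule borel_measurable_continuous_onI)
    have [measurable_cong]: "sets K = sets borel" by fact
    have "compact (h ` {0..1})"
      using h by (intro compact_continuous_image) (auto intro: continuous_on_subset)
    then obtain B where B: "\<And>y. y \<in> {0..1} \<Longrightarrow> norm (h y) \<le> B"
      by (metis compact_imp_bounded bounded_iff imageI)
    show ?thesis
      by (rule integrable_const_bound[where B = B]) (use K(3) B in \<open>auto elim!: eventually_mono\<close>)
  qed
  have poly: "(\<integral>x. g (exp (- x)) \<partial>M) = (\<integral>x. g (exp (- x)) \<partial>N)" if g: "real_polynomial_function g" for g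
  proof -
    obtain a n where g': "g = (\<lambda>x. \<Sum>i\<le>n. a i * x ^ i)"
      using g by (auto simp: real_polynomial_function_iff_sum)
    have pw: "exp (- x) ^ i = exp (- (real i * x))" for x :: real and i
      by (simp flip: exp_of_nat_mult)
    have "(\<integral>x. g (exp (- x)) \<partial>K) = (\<Sum>i\<le>n. a i * (\<integral>x. exp (- (real i * x)) \<partial>K))"
      if K: "finite_measure K" "sets K = sets borel" "AE x in K. 0 \<le> x" for K
    proof -
      have "integrable K (\<lambda>x. exp (- x) ^ i)" for i
        by (rule int[OF K]) (intro continuous_intros)
      then show ?thesis
        unfolding g' pw by (subst Bochner_Integration.integral_sum) auto
    qed
    with M N eq show ?thesis by simp
  qed
  have "\<bar>(\<integral>x. G (exp (- x)) \<partial>M) - (\<integral>x. G (exp (- x)) \<partial>N)\<bar> \<le> c * e" if e: "0 < e" for e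
  proof -
    \<comment> \<open>Weierstrass approximation in the variable y = exp(-x), which stays in [0, 1]
      for x \<ge> 0; polynomials in y are combinations of the known integrals.\<close>
    obtain g where g: "real_polynomial_function g" "\<And>x. x \<in> {0..1} \<Longrightarrow> \<bar>G x - g x\<bar> < e"
      using Stone_Weierstrass_real_polynomial_function[of "{0..1}" G e] G e
      by (auto intro: continuous_on_subset)
    have gc: "continuous_on UNIV g"
      using g(1) by (simp add: continuous_on_polymonial_function real_polynomial_function_eq)
    have *: "\<bar>(\<integral>x. G (exp (- x)) \<partial>K) - (\<integral>x. g (exp (- x)) \<partial>K)\<bar> \<le> measure K (space K) * e"
      if K: "finite_measure K" "sets K = sets borel" "AE x in K. 0 \<le> x" for K
    proof -
      interpret finite_measure K by fact
      have "\<bar>(\<integral>x. G (exp (- x)) \<partial>K) - (\<integral>x. g (exp (- x)) \<partial>K)\<bar>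
          = \<bar>\<integral>x. G (exp (- x)) - g (exp (- x)) \<partial>K\<bar>"
        by (subst Bochner_Integration.integral_diff) (auto intro!: int K G gc)
      also have "\<dots> \<le> (\<integral>x. \<bar>G (exp (- x)) - g (exp (- x))\<bar> \<partial>K)"
        by (rule integral_abs_bound)
      also have "\<dots> \<le> (\<integral>x. e \<partial>K)"
        by (intro integral_mono_AE integrable_abs Bochner_Integration.integrable_diff int K G gc integrable_const)
           (use K(3) g(2) in \<open>auto elim!: eventually_mono intro!: less_imp_le\<close>)
      finally show ?thesis by (simp add: mult.commute)
    qed
    from *[OF M] *[OF N] poly[OF g(1)] show ?thesis
      by (simp add: c_def algebra_simps)
  qed
  note bound = this
  have "c \<ge> 0" by (simp add: c_def)
  have "\<bar>(\<integral>x. G (exp (- x)) \<partial>M) - (\<integral>x. G (exp (- x)) \<partial>N)\<bar> \<le> e" if "0 < e" for e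
  proof -
    \<comment> \<open>The total mass c may be 0, hence the division by c + 1.\<close>
    have "\<bar>(\<integral>x. G (exp (- x)) \<partial>M) - (\<integral>x. G (exp (- x)) \<partial>N)\<bar> \<le> c * (e / (c + 1))"
      using that \<open>c \<ge> 0\<close> by (intro bound) simp
    also have "\<dots> \<le> e" using that \<open>c \<ge> 0\<close> by (simp add: field_simps)
    finally show ?thesis .
  qed
  then have "\<bar>(\<integral>x. G (exp (- x)) \<partial>M) - (\<integral>x. G (exp (- x)) \<partial>N)\<bar> \<le> 0"
    by (rule field_le_epsilon[where y = 0, simplified])
  then show ?thesis by simp
qed

text \<open>Laplace transforms at the natural numbers suffice: they fix the integral of every
  continuous function of exp(-x), and ramps in exp(-x) converge to indicators of open half-lines,
  which determine a finite measure.\<close>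

lemma finite_measure_eqI_exp:
  fixes M N :: "real measure"
  assumes M: "finite_measure M" "sets M = sets borel" "AE x in M. 0 \<le> x"
    and N: "finite_measure N" "sets N = sets borel" "AE x in N. 0 \<le> x"
    and eq: "\<And>k::nat. (\<integral>x. exp (- (real k * x)) \<partial>M) = (\<integral>x. exp (- (real k * x)) \<partial>N)"
  shows "M = N"
proof (rule measure_eqI_lessThan[OF M(2) N(2)])
  note [measurable_cong] = M(2) N(2)
  fix a :: real
  interpret M: finite_measure M by fact
  interpret N: finite_measure N by fact
  show "emeasure M {a<..} < \<infinity>"
    by (simp add: M.emeasure_eq_measure)
  \<comment> \<open>A ramp of slope -n that vanishes for y \<ge> exp(-a), that is, for x \<le> a;
    its limit is therefore the indicator of the open half-line.\<close>
  define G where "G n y = min 1 (max 0 (real n * (exp (- a) - y)))" for n and y :: real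
  have G_lim: "(\<lambda>n. G n (exp (- x))) \<longlonglongrightarrow> indicator {a<..} x" for x
  proof (cases "a < x")
    case True
    then have "exp (- a) - exp (- x) > 0" by simp
    then have "eventually (\<lambda>n. real n * (exp (- a) - exp (- x)) \<ge> 1) sequentially"
      by real_asymp
    then have "eventually (\<lambda>n. G n (exp (- x)) = 1) sequentially"
      by eventually_elim (simp add: G_def)
    with True show ?thesis by (simp add: tendsto_eventually)
  next
    case False
    then have "real n * (exp (- a) - exp (- x)) \<le> 0" for n
      by (intro mult_nonneg_nonpos) auto
    then have "G n (exp (- x)) = 0" for n
      by (simp add: G_def max_absorb1)
    with False show ?thesis by simp
  qed
  have lim: "(\<lambda>n. \<integral>x. G n (exp (- x)) \<partial>K) \<longlonglongrightarrow> measure K {a<..}"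
    if K: "finite_measure K" "sets K = sets borel" for K :: "real measure"
  proof -
    interpret finite_measure K by fact
    have [measurable_cong]: "sets K = sets borel" by fact
    have "(\<lambda>n. \<integral>x. G n (exp (- x)) \<partial>K) \<longlonglongrightarrow> (\<integral>x. indicator {a<..} x \<partial>K)"
      by (rule integral_dominated_convergence[where w = "\<lambda>_. 1"])
         (auto simp: G_lim, auto simp: G_def)
    then show ?thesis using K by (simp add: sets_eq_imp_space_eq)
  qed
  have "(\<integral>x. G n (exp (- x)) \<partial>M) = (\<integral>x. G n (exp (- x)) \<partial>N)" for n
    by (rule integral_exp_power_eq[OF M N eq]) (auto simp: G_def intro!: continuous_intros)
  with lim[OF M(1,2)] lim[OF N(1,2)] have "measure M {a<..} = measure N {a<..}"
    by (auto intro: LIMSEQ_unique)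
  then show "emeasure M {a<..} = emeasure N {a<..}"
    by (simp add: M.emeasure_eq_measure N.emeasure_eq_measure)
qed

section \<open>Undershooting of a path\<close>

lemma cadlag_right: "cadlag f \<Longrightarrow> 0 \<le> t \<Longrightarrow> (f \<longlongrightarrow> f t) (at_right t)"
  and cadlag_left: "cadlag f \<Longrightarrow> 0 < t \<Longrightarrow> \<exists>l. (f \<longlongrightarrow> l) (at_left t)"
  by (simp_all add: cadlag_def)

text \<open>The strict level set \<open>{r. f r < t}\<close> of a right-continuous strictly increasing path is a half-open
  interval even if the path attains the level \<open>t\<close>.\<close>

lemma level_set_eq:
  fixes f :: "real \<Rightarrow> real"
  assumes f: "cadlag f" "strict_mono_on {0..} f" and t: "f 0 < t" "\<exists>r\<ge>0. t < f r"
  defines "L \<equiv> Inf {r. 0 \<le> r \<and> t < f r}"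
  shows "0 < L" and "\<And>r. 0 \<le> r \<Longrightarrow> f r < t \<longleftrightarrow> r < L"
proof -
  define B where "B = {r. 0 \<le> r \<and> t < f r}"
  have B: "B \<noteq> {}" "bdd_below B" using t by (auto simp: B_def intro!: bdd_belowI[of _ 0])
  have L: "L = Inf B" by (simp add: L_def B_def)
  have L0: "0 \<le> L" unfolding L using B(1) by (intro cInf_greatest) (auto simp: B_def)
  have mono: "f a < f b" if "0 \<le> a" "a < b" for a b
    using f(2) that by (auto simp: strict_mono_on_def)
  have below: "f r < t" if "0 \<le> r" "r < L" for r
  proof -
    have "(r + L) / 2 \<notin> B" using cInf_lower[OF _ B(2), of "(r + L) / 2"] that by (auto simp: L[symmetric])
    then have "f ((r + L) / 2) \<le> t" using that by (auto simp: B_def)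
    with mono[of r "(r + L) / 2"] that show ?thesis by simp
  qed
  have above: "t < f r" if Lr: "L < r" for r
  proof -
    obtain b where "b \<in> B" "b < r" using cInf_less_iff[OF B, of r] Lr unfolding L by blast
    with mono[of b r] show ?thesis by (auto simp: B_def)
  qed
  have "\<forall>\<^sub>F r in at_right L. t \<le> f r"
    using above by (auto simp: eventually_at_right_field intro!: exI[of _ "L + 1"] less_imp_le)
  \<comment> \<open>Right-continuity carries the bound from times after L to L itself, which
    therefore lies outside the strict level set.\<close>
  then have at: "t \<le> f L"
    by (intro tendsto_lowerbound[OF cadlag_right[OF f(1) L0]]) auto
  show "0 < L" using L0 at t(1) by (cases "L = 0") auto
  show "f r < t \<longleftrightarrow> r < L" if "0 \<le> r" for r
    using below[OF that] above[of r] at by (cases r L rule: linorder_cases) auto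
qed

text \<open>\<open>Lim\<close> is a choice operator; the cadlag property supplies the limit that
  gives it meaning. Subtracting c covers the passage from \<open>S\<close> to
  \<open>from_zero S\<close>.\<close>

lemma left_limit_tendsto:
  assumes "cadlag f" "0 < L"
  shows "((\<lambda>r. f r - c) \<longlongrightarrow> left_limit (\<lambda>r. f r - c) L) (at_left L)"
proof -
  obtain l where "(f \<longlongrightarrow> l) (at_left L)" using cadlag_left[OF assms] by blast
  then have *: "((\<lambda>r. f r - c) \<longlongrightarrow> l - c) (at_left L)" by (intro tendsto_intros)
  with assms show ?thesis
    by (simp add: left_limit_def tendsto_Lim[OF _ *])
qed

section \<open>Grid approximation of first passage times\<close>

lemma from_zero_eq: "from_zero S r \<omega> = S r \<omega> - S 0 \<omega>"
  by (simp add: from_zero_def)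

text \<open>The levels passed during the k-th step of mesh 1/(n+1). Open below and closed above, so
  that membership of t reduces to strict comparisons S r < t and cells of different steps are
  disjoint.\<close>

definition grid_cell :: "(real \<Rightarrow> 'w \<Rightarrow> real) \<Rightarrow> nat \<Rightarrow> nat \<Rightarrow> 'w \<Rightarrow> real set" where
  "grid_cell S n k \<omega> = {S (real k / Suc n) \<omega><..S (real (Suc k) / Suc n) \<omega>}"

text \<open>The last grid point strictly below L. Since L may itself be a grid point, this is the
  ceiling minus one and not the floor.\<close>

definition grid_index :: "nat \<Rightarrow> real \<Rightarrow> nat" where
  "grid_index n L = nat (\<lceil>L * Suc n\<rceil> - 1)"

lemma grid_index:
  assumes "0 < L"
  shows "real k / Suc n < L \<and> L \<le> real (Suc k) / Suc n \<longleftrightarrow> k = grid_index n L"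
proof -
  have "0 < \<lceil>L * Suc n\<rceil>" using assms by simp
  then have "k = grid_index n L \<longleftrightarrow> int k + 1 = \<lceil>L * Suc n\<rceil>"
    unfolding grid_index_def by linarith
  also have "\<dots> \<longleftrightarrow> real k < L * Suc n \<and> L * Suc n \<le> real k + 1"
    using ceiling_eq_iff[of "L * Suc n" "int k + 1"] by (auto simp del: of_nat_Suc)
  also have "\<dots> \<longleftrightarrow> real k / Suc n < L \<and> L \<le> real (Suc k) / Suc n"
    by (simp add: pos_divide_less_eq pos_le_divide_eq add.commute del: of_nat_Suc) (simp add: add.commute)
  finally show ?thesis by simp
qed

lemma grid_index_bounds:
  assumes "0 < L"
  shows "real (grid_index n L) / Suc n < L" "L \<le> real (Suc (grid_index n L)) / Suc n"
  using grid_index[OF assms, of "grid_index n L" n] by simp_all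

lemma grid_index_tendsto:
  assumes "0 < L"
  shows "filterlim (\<lambda>n. real (grid_index n L) / Suc n) (at_left L) sequentially"
proof (rule tendsto_imp_filterlim_at_left)
  show "(\<lambda>n. real (grid_index n L) / Suc n) \<longlonglongrightarrow> L"
  proof (rule tendsto_sandwich)
    show "\<forall>\<^sub>F n in sequentially. L - 1 / Suc n \<le> real (grid_index n L) / Suc n"
      using grid_index_bounds(2)[OF assms] by (auto simp: add_divide_distrib intro!: always_eventually simp: algebra_simps)
    show "\<forall>\<^sub>F n in sequentially. real (grid_index n L) / Suc n \<le> L"
      using grid_index_bounds(1)[OF assms] by (intro always_eventually allI less_imp_le)
    show "(\<lambda>n. L - 1 / Suc n) \<longlonglongrightarrow> L" by real_asymp
  qed simp
  show "\<forall>\<^sub>F n in sequentially. real (grid_index n L) / Suc n < L"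
    using grid_index_bounds(1)[OF assms] by (intro always_eventually allI)
qed

section \<open>Undershooting along a single strictly increasing cadlag path\<close>

context
  fixes S :: "real \<Rightarrow> 'w \<Rightarrow> real" and \<omega> :: 'w
  assumes path: "cadlag (\<lambda>r. S r \<omega>)" "strict_mono_on {0..} (\<lambda>r. S r \<omega>)"
begin

lemma path_mono: "0 \<le> a \<Longrightarrow> a \<le> b \<Longrightarrow> S a \<omega> \<le> S b \<omega>"
  using path(2) by (cases "a = b") (auto simp: strict_mono_on_def less_le)

context
  fixes t assumes t: "S 0 \<omega> < t" "\<exists>r\<ge>0. t < S r \<omega>"
begin

lemma first_passage_pos: "0 < first_passage S t \<omega>"
  and path_less_iff: "0 \<le> r \<Longrightarrow> S r \<omega> < t \<longleftrightarrow> r < first_passage S t \<omega>"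
  using level_set_eq[OF path t] t(2) by (auto simp: first_passage_def)

lemma mem_grid_cell: "t \<in> grid_cell S n k \<omega> \<longleftrightarrow> k = grid_index n (first_passage S t \<omega>)"
proof -
  have "t \<in> grid_cell S n k \<omega> \<longleftrightarrow> real k / Suc n < first_passage S t \<omega> \<and> first_passage S t \<omega> \<le> real (Suc k) / Suc n"
  proof -
    have nonneg: "0 \<le> real j / Suc n" for j by simp
    show ?thesis
      unfolding grid_cell_def greaterThanAtMost_iff not_less[symmetric]
      by (simp only: path_less_iff[OF nonneg])
  qed
  then show ?thesis using grid_index[OF first_passage_pos] by simp
qed

lemma undershooting_tendsto:
  "(\<lambda>n. from_zero S (real (grid_index n (first_passage S t \<omega>)) / Suc n) \<omega>) \<longlonglongrightarrow> undershooting S t \<omega>"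
  using filterlim_compose[OF left_limit_tendsto[OF path(1) first_passage_pos] grid_index_tendsto[OF first_passage_pos]]
  by (simp add: undershooting_def from_zero_eq)

lemma undershooting_le: "undershooting S t \<omega> \<le> t - S 0 \<omega>"
  using undershooting_tendsto
proof (rule LIMSEQ_le_const2)
  show "\<exists>N. \<forall>n\<ge>N. from_zero S (real (grid_index n (first_passage S t \<omega>)) / Suc n) \<omega> \<le> t - S 0 \<omega>"
    using path_less_iff grid_index_bounds(1)[OF first_passage_pos]
    by (auto simp: from_zero_eq less_imp_le)
qed

lemma from_zero_le_undershooting:
  assumes r: "0 \<le> r" "r < first_passage S t \<omega>"
  shows "from_zero S r \<omega> \<le> undershooting S t \<omega>"
proof -
  have "\<forall>\<^sub>F r' in at_left (first_passage S t \<omega>). from_zero S r \<omega> \<le> S r' \<omega> - S 0 \<omega>"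
    using r by (auto simp: eventually_at_left_field from_zero_eq intro!: exI[of _ r] path_mono)
  then show ?thesis
    using left_limit_tendsto[OF path(1) first_passage_pos, of "S 0 \<omega>"]
    unfolding undershooting_def from_zero_eq by (intro tendsto_lowerbound[rotated]) (auto simp: from_zero_eq)
qed

end

text \<open>Covers levels not above the start and levels never exceeded. There the undershooting
  takes its default value 0 and every cell misses t, so the grid sums converge at every sample point
  and no null set has to be discarded.\<close>

lemma undershooting_degenerate:
  assumes "\<not> (S 0 \<omega> < t \<and> (\<exists>r\<ge>0. t < S r \<omega>))"
  shows "undershooting S t \<omega> = 0" and "t \<notin> grid_cell S n k \<omega>"
proof -
  have less: "S a \<omega> < S b \<omega>" if "0 \<le> a" "a < b" for a b
    using path(2) that by (auto simp: strict_mono_on_def)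
  have "first_passage S t \<omega> = 0 \<and> t \<notin> grid_cell S n k \<omega>"
  proof (cases "\<exists>r\<ge>0. t < S r \<omega>")
    case True
    with assms have t: "t \<le> S 0 \<omega>" by auto
    \<comment> \<open>With t \<le> S 0, strict increase makes every r > 0 an admissible
      time.\<close>
    have "Inf {r. 0 \<le> r \<and> t < S r \<omega>} = 0"
    proof (rule antisym)
      show "Inf {r. 0 \<le> r \<and> t < S r \<omega>} \<le> 0"
      proof (rule dense_ge)
        fix r :: real assume "0 < r"
        with less[of 0 r] t show "Inf {r. 0 \<le> r \<and> t < S r \<omega>} \<le> r"
          by (intro cInf_lower) (auto intro!: bdd_belowI[of _ 0])
      qed
      show "0 \<le> Inf {r. 0 \<le> r \<and> t < S r \<omega>}"
        using True by (intro cInf_greatest) auto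
    qed
    moreover have "t \<le> S (real k / Suc n) \<omega>"
      using t path_mono[of 0 "real k / Suc n"] by simp
    ultimately show ?thesis using True by (auto simp: first_passage_def grid_cell_def)
  next
    case False
    then have le: "S r \<omega> \<le> t" if "0 \<le> r" for r using that by force
    \<comment> \<open>The path never exceeds t; strict increase then keeps the right end of every
      cell strictly below t.\<close>
    have "S (real (Suc k) / Suc n) \<omega> < S (real (Suc k) / Suc n + 1) \<omega>"
      by (intro less) auto
    also have "\<dots> \<le> t" by (rule le) simp
    finally have "t \<notin> grid_cell S n k \<omega>" by (simp add: grid_cell_def)
    moreover have "first_passage S t \<omega> = 0"
      using False unfolding first_passage_def by (simp only: if_False)
    ultimately show ?thesis by simp
  qed
  then show "undershooting S t \<omega> = 0" "t \<notin> grid_cell S n k \<omega>"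
    by (simp_all add: undershooting_def left_limit_def from_zero_eq)
qed

text \<open>At most one cell contains t, so each series has at most one nonzero term. It involves
  \<open>S\<close> at countably many fixed times only, which is what measurability needs.\<close>

lemma grid_sum_tendsto:
  "(\<lambda>n. \<Sum>k. from_zero S (real k / Suc n) \<omega> * indicator (grid_cell S n k \<omega>) t) \<longlonglongrightarrow> undershooting S t \<omega>"
proof (cases "S 0 \<omega> < t \<and> (\<exists>r\<ge>0. t < S r \<omega>)")
  case True
  then have t: "S 0 \<omega> < t" "\<exists>r\<ge>0. t < S r \<omega>" by auto
  have "(\<Sum>k. from_zero S (real k / Suc n) \<omega> * indicator (grid_cell S n k \<omega>) t)
      = from_zero S (real (grid_index n (first_passage S t \<omega>)) / Suc n) \<omega>" for n
    by (subst suminf_finite[of "{grid_index n (first_passage S t \<omega>)}"])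
       (auto simp: mem_grid_cell[OF t] indicator_def)
  then show ?thesis using undershooting_tendsto[OF t] by simp
next
  case False
  then show ?thesis using undershooting_degenerate[OF False] by simp
qed

lemma undershooting_nonneg: "0 \<le> undershooting S t \<omega>"
proof (cases "S 0 \<omega> < t \<and> (\<exists>r\<ge>0. t < S r \<omega>)")
  case True
  then have t: "S 0 \<omega> < t" "\<exists>r\<ge>0. t < S r \<omega>" by auto
  have "from_zero S 0 \<omega> \<le> undershooting S t \<omega>"
    using first_passage_pos[OF t] by (intro from_zero_le_undershooting t) auto
  then show ?thesis by (simp add: from_zero_eq)
qed (simp add: undershooting_degenerate)

lemma undershooting_mono:
  assumes t: "S 0 \<omega> < t" "t \<le> t'" "\<exists>r\<ge>0. t' < S r \<omega>"
  shows "undershooting S t \<omega> \<le> undershooting S t' \<omega>"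
proof -
  have t1: "S 0 \<omega> < t" "\<exists>r\<ge>0. t < S r \<omega>" and t2: "S 0 \<omega> < t'" "\<exists>r\<ge>0. t' < S r \<omega>"
    using t by force+
  have "from_zero S r \<omega> \<le> undershooting S t' \<omega>" if "0 \<le> r" "r < first_passage S t \<omega>" for r
    using path_less_iff[OF t1, of r] path_less_iff[OF t2, of r] that t(2)
    by (intro from_zero_le_undershooting[OF t2]) auto
  then show ?thesis
    using grid_index_bounds(1)[OF first_passage_pos[OF t1]]
    by (intro LIMSEQ_le_const2[OF undershooting_tendsto[OF t1]]) auto
qed

end

text \<open>The measurable space is arbitrary because the lemma is applied to \<open>Q\<close> and
  also to the sigma-algebra generated by the path of \<open>S\<close>, in which null sets of
  \<open>Q\<close> need not be measurable.\<close>

lemma undershooting_measurable: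
  assumes S [measurable]: "\<And>r. 0 \<le> r \<Longrightarrow> S r \<in> borel_measurable R"
    and path: "\<And>\<omega>. \<omega> \<in> space R \<Longrightarrow> cadlag (\<lambda>r. S r \<omega>)" "\<And>\<omega>. \<omega> \<in> space R \<Longrightarrow> strict_mono_on {0..} (\<lambda>r. S r \<omega>)"
  shows "undershooting S t \<in> borel_measurable R"
proof (rule borel_measurable_LIMSEQ_real)
  fix \<omega> assume "\<omega> \<in> space R"
  then show "(\<lambda>n. \<Sum>k. from_zero S (real k / Suc n) \<omega> * indicator (grid_cell S n k \<omega>) t) \<longlonglongrightarrow> undershooting S t \<omega>"
    by (intro grid_sum_tendsto path)
next
  fix n
  have [measurable]: "Measurable.pred R (\<lambda>\<omega>. t \<in> grid_cell S n k \<omega>)" for k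
    unfolding grid_cell_def greaterThanAtMost_iff by measurable
  have [measurable]: "from_zero S r \<in> borel_measurable R" if "0 \<le> r" for r
    using that unfolding from_zero_def[abs_def] by measurable
  show "(\<lambda>\<omega>. \<Sum>k. from_zero S (real k / Suc n) \<omega> * indicator (grid_cell S n k \<omega>) t) \<in> borel_measurable R"
    unfolding indicator_def by measurable
qed

section \<open>Laplace transforms of the undershooting\<close>

abbreviation exp_weight :: "real \<Rightarrow> real \<Rightarrow> ennreal" where
  "exp_weight l t \<equiv> ennreal (exp (- (l * t))) * indicator {0<..} t"

abbreviation exp_law :: "real \<Rightarrow> real \<Rightarrow> ennreal" where
  "exp_law l t \<equiv> ennreal (l * exp (- (l * t))) * indicator {0<..} t"

lemma nn_integral_exp_interval:
  assumes l: "0 < l" and ab: "0 \<le> a" "a \<le> b"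
  shows "(\<integral>\<^sup>+t. exp_weight l t * indicator {a<..b} t \<partial>lborel)
    = ennreal ((exp (- (l * a)) - exp (- (l * b))) / l)"
proof -
  have "(\<integral>\<^sup>+t. exp_weight l t * indicator {a<..b} t \<partial>lborel)
      = (\<integral>\<^sup>+t. ennreal (exp (- (l * t))) * indicator {a..b} t \<partial>lborel)"
    using AE_lborel_singleton[of a] ab
    by (intro nn_integral_cong_AE) (auto elim!: eventually_mono simp: indicator_def)
  also have "\<dots> = ennreal (- exp (- (l * b)) / l - - exp (- (l * a)) / l)"
    using l ab by (intro nn_integral_FTC_Icc) (auto intro!: derivative_eq_intros)
  finally show ?thesis by (simp add: diff_divide_distrib)
qed

lemma nn_integral_exp_atLeast:
  assumes l: "0 < l" and y: "0 \<le> y"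
  shows "(\<integral>\<^sup>+t. exp_law l t * indicator {y<..} t \<partial>lborel) = ennreal (exp (- (l * y)))"
proof -
  have "(\<integral>\<^sup>+t. exp_law l t * indicator {y<..} t \<partial>lborel)
      = (\<integral>\<^sup>+t. ennreal (l * exp (- (l * t))) * indicator {y..} t \<partial>lborel)"
    using AE_lborel_singleton[of y] y
    by (intro nn_integral_cong_AE) (auto elim!: eventually_mono simp: indicator_def)
  also have "\<dots> = ennreal (0 - - exp (- (l * y)))"
  proof (rule nn_integral_FTC_atLeast)
    show "((\<lambda>t. - exp (- (l * t))) \<longlongrightarrow> 0) at_top"
      using l by real_asymp
  qed (use l in \<open>auto intro!: derivative_eq_intros\<close>)
  finally show ?thesis by simp
qed

section \<open>The subordinator sampled on a grid of times\<close>

locale subordinator = prob_space Q for Q :: "'w measure" +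
  fixes S :: "real \<Rightarrow> 'w \<Rightarrow> real" and \<phi> :: "real \<Rightarrow> real"
  assumes levy: "increasing_levy_from Q S 0"
    and exponent: "0 < l \<Longrightarrow> \<phi> l = - ln (\<integral>\<omega>. exp (- l * from_zero S 1 \<omega>) \<partial>Q)"
begin

lemma S_measurable [measurable]: "0 \<le> t \<Longrightarrow> S t \<in> borel_measurable Q"
  and S_cadlag: "\<omega> \<in> space Q \<Longrightarrow> cadlag (\<lambda>t. S t \<omega>)"
  and S_strict_mono: "\<omega> \<in> space Q \<Longrightarrow> strict_mono_on {0..} (\<lambda>t. S t \<omega>)"
  and S_0: "AE \<omega> in Q. S 0 \<omega> = 0"
  and S_indep: "0 \<le> t' 0 \<Longrightarrow> mono t' \<Longrightarrow> indep_vars (\<lambda>_. borel) (\<lambda>i \<omega>. S (t' (Suc i)) \<omega> - S (t' i) \<omega>) {..<n}"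
  and S_stationary: "0 \<le> s \<Longrightarrow> 0 \<le> h \<Longrightarrow>
    distr Q borel (\<lambda>\<omega>. S (s + h) \<omega> - S s \<omega>) = distr Q borel (\<lambda>\<omega>. S h \<omega> - S 0 \<omega>)"
  using levy by (simp_all add: increasing_levy_from_def)

abbreviation X :: "real \<Rightarrow> 'w \<Rightarrow> real" where
  "X \<equiv> from_zero S"

lemma X_measurable [measurable]: "0 \<le> t \<Longrightarrow> X t \<in> borel_measurable Q"
  unfolding from_zero_def[abs_def] by measurable

lemma X_mono: "\<omega> \<in> space Q \<Longrightarrow> 0 \<le> a \<Longrightarrow> a \<le> b \<Longrightarrow> X a \<omega> \<le> X b \<omega>"
  using path_mono[OF S_cadlag S_strict_mono] by (simp add: from_zero_eq)

lemma X_nonneg: "\<omega> \<in> space Q \<Longrightarrow> 0 \<le> t \<Longrightarrow> 0 \<le> X t \<omega>"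
  using X_mono[of \<omega> 0 t] by (simp add: from_zero_eq)

text \<open>Increments over steps of length d are independent and distributed like X d. The bound is
  required on the nonnegative half-line only, since increments of increasing paths are
  nonnegative.\<close>

lemma expectation_prod_increments:
  assumes d: "0 \<le> d" and g [measurable]: "\<And>i. g i \<in> borel_measurable borel" and B: "\<And>i y. 0 \<le> y \<Longrightarrow> \<bar>g i y\<bar> \<le> (B :: real)"
  shows "(\<integral>\<omega>. (\<Prod>i<k. g i (X (real (Suc i) * d) \<omega> - X (real i * d) \<omega>)) \<partial>Q)
    = (\<Prod>i<k. \<integral>\<omega>. g i (X d \<omega>) \<partial>Q)"
proof -
  have inc: "X (real (Suc i) * d) \<omega> - X (real i * d) \<omega> = S (real (Suc i) * d) \<omega> - S (real i * d) \<omega>" for i \<omega>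
    by (simp add: from_zero_eq)
  have ind: "indep_vars (\<lambda>_. borel) (\<lambda>i \<omega>. g i (S (real (Suc i) * d) \<omega> - S (real i * d) \<omega>)) {..<k}"
    by (rule indep_vars_compose2[OF S_indep]) (use d in \<open>auto intro!: monoI mult_right_mono\<close>)
  have "integrable Q (\<lambda>\<omega>. g i (S (real (Suc i) * d) \<omega> - S (real i * d) \<omega>))" for i
  proof (rule integrable_const_bound[where B = B])
    show "AE \<omega> in Q. norm (g i (S (real (Suc i) * d) \<omega> - S (real i * d) \<omega>)) \<le> B"
    proof (rule AE_I2)
      fix \<omega> assume "\<omega> \<in> space Q"
      then have "S (real i * d) \<omega> \<le> S (real (Suc i) * d) \<omega>"
        using d by (intro path_mono[OF S_cadlag S_strict_mono]) (auto intro!: mult_right_mono)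
      then show "norm (g i (S (real (Suc i) * d) \<omega> - S (real i * d) \<omega>)) \<le> B"
        using B by simp
    qed
  next
    have "random_variable borel (S (real j * d))" for j
      using d by (intro S_measurable) simp
    then show "random_variable borel (\<lambda>\<omega>. g i (S (real (Suc i) * d) \<omega> - S (real i * d) \<omega>))"
      by measurable
  qed
  then have prod: "(\<integral>\<omega>. (\<Prod>i<k. g i (S (real (Suc i) * d) \<omega> - S (real i * d) \<omega>)) \<partial>Q)
      = (\<Prod>i<k. \<integral>\<omega>. g i (S (real (Suc i) * d) \<omega> - S (real i * d) \<omega>) \<partial>Q)"
    by (intro indep_vars_lebesgue_integral ind) auto
  have "(\<integral>\<omega>. g i (S (real (Suc i) * d) \<omega> - S (real i * d) \<omega>) \<partial>Q) = (\<integral>\<omega>. g i (X d \<omega>) \<partial>Q)" for i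
  proof -
    have "(\<integral>\<omega>. g i (S (real (Suc i) * d) \<omega> - S (real i * d) \<omega>) \<partial>Q)
        = (\<integral>y. g i y \<partial>distr Q borel (\<lambda>\<omega>. S (real i * d + d) \<omega> - S (real i * d) \<omega>))"
      using d by (subst integral_distr) (auto simp: distrib_right add.commute)
    also have "\<dots> = (\<integral>\<omega>. g i (X d \<omega>) \<partial>Q)"
      using d by (subst S_stationary) (auto simp: integral_distr from_zero_eq)
    finally show ?thesis .
  qed
  then show ?thesis using prod by (simp only: inc)
qed

lemma X_eq_sum: "X (real k * d) \<omega> = (\<Sum>i<k. X (real (Suc i) * d) \<omega> - X (real i * d) \<omega>)"
  by (subst sum_lessThan_telescope) (simp add: from_zero_eq)

abbreviation X_grid :: "nat \<Rightarrow> nat \<Rightarrow> 'w \<Rightarrow> real" where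
  "X_grid n k \<equiv> X (real k / Suc n)"

lemma integrable_exp_X: "0 \<le> l \<Longrightarrow> 0 \<le> t \<Longrightarrow> integrable Q (\<lambda>\<omega>. exp (- (l * X t \<omega>)))"
  by (rule integrable_const_bound[where B = 1]) (auto intro!: AE_I2 X_nonneg mult_nonneg_nonneg)

lemma expectation_exp_X_multiple:
  assumes "0 < l" "0 \<le> d"
  shows "(\<integral>\<omega>. exp (- (l * X (real k * d) \<omega>)) \<partial>Q) = (\<integral>\<omega>. exp (- (l * X d \<omega>)) \<partial>Q) ^ k"
proof -
  have "(\<integral>\<omega>. exp (- (l * X (real k * d) \<omega>)) \<partial>Q)
      = (\<integral>\<omega>. (\<Prod>i<k. exp (- (l * (X (real (Suc i) * d) \<omega> - X (real i * d) \<omega>)))) \<partial>Q)"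
    by (subst X_eq_sum) (simp add: exp_sum[symmetric] sum_distrib_left sum_negf del: of_nat_Suc)
  also have "\<dots> = (\<Prod>i<k. \<integral>\<omega>. exp (- (l * X d \<omega>)) \<partial>Q)"
    using assms by (intro expectation_prod_increments[where B = 1 and g = "\<lambda>i y. exp (- (l * y))"]) auto
  finally show ?thesis by simp
qed

text \<open>Strict increase gives X 1 > 0, so the transform lies strictly between 0 and 1.
  Positivity of \<phi> is what makes the later quotients and geometric series meaningful.\<close>

lemma expectation_exp_X_1:
  assumes l: "0 < l"
  shows "(\<integral>\<omega>. exp (- (l * X 1 \<omega>)) \<partial>Q) = exp (- \<phi> l)" and "0 < \<phi> l"
proof -
  have pos: "0 < (\<integral>\<omega>. exp (- (l * X 1 \<omega>)) \<partial>Q)"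
    using l by (intro expectation_greater integrable_exp_X) auto
  then show eq: "(\<integral>\<omega>. exp (- (l * X 1 \<omega>)) \<partial>Q) = exp (- \<phi> l)"
    using exponent[OF l] by simp
  have "AE \<omega> in Q. exp (- (l * X 1 \<omega>)) < 1"
  proof (rule AE_I2)
    fix \<omega> assume "\<omega> \<in> space Q"
    then have "0 < X 1 \<omega>" using S_strict_mono[of \<omega>] by (auto simp: from_zero_eq strict_mono_on_def)
    with l show "exp (- (l * X 1 \<omega>)) < 1" by simp
  qed
  then have "(\<integral>\<omega>. exp (- (l * X 1 \<omega>)) \<partial>Q) < 1"
    using l by (intro expectation_less integrable_exp_X) auto
  with eq show "0 < \<phi> l" by simp
qed

text \<open>The transform at time 1/(n+1) is the nonnegative root of order n+1 of the transform at
  time 1.\<close>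

lemma expectation_exp_X_grid:
  assumes l: "0 < l"
  shows "(\<integral>\<omega>. exp (- (l * X_grid n k \<omega>)) \<partial>Q) = exp (- (\<phi> l / Suc n)) ^ k"
proof -
  define e where "e = (\<integral>\<omega>. exp (- (l * X (1 / Suc n) \<omega>)) \<partial>Q)"
  have e: "0 \<le> e" unfolding e_def by simp
  have "e ^ Suc n = exp (- \<phi> l)"
    unfolding e_def using expectation_exp_X_multiple[OF l, of "1 / Suc n" "Suc n"] expectation_exp_X_1[OF l]
    by (simp del: of_nat_Suc power_Suc)
  also have "\<dots> = exp (- (\<phi> l / Suc n)) ^ Suc n"
    by (simp add: exp_of_nat_mult[symmetric] del: of_nat_Suc power_Suc)
  finally have "e = exp (- (\<phi> l / Suc n))"
    using e by (metis power_eq_imp_eq_base exp_ge_zero zero_less_Suc)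
  then show ?thesis
    using expectation_exp_X_multiple[OF l, of "1 / Suc n" k] by (simp add: e_def)
qed

text \<open>The position at a grid point and the increment over the next step are independent. This
  is the discrete counterpart of the compensation formula for jumps.\<close>

lemma expectation_grid_jump:
  assumes b: "0 < b" and l: "0 < l"
  shows "(\<integral>\<omega>. exp (- (b * X_grid n k \<omega>)) * (1 - exp (- (l * (X_grid n (Suc k) \<omega> - X_grid n k \<omega>)))) \<partial>Q)
    = exp (- (\<phi> b / Suc n)) ^ k * (1 - exp (- (\<phi> l / Suc n)))"
proof -
  define d where "d = 1 / real (Suc n)"
  have d: "0 \<le> d" by (simp add: d_def)
  have kd: "real k / Suc n = real k * d" for k by (simp add: d_def)
  have e: "(\<integral>\<omega>. exp (- (c * X d \<omega>)) \<partial>Q) = exp (- (\<phi> c / Suc n))" if "0 < c" for c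
    using expectation_exp_X_grid[OF that, of 1 n] by (simp add: d_def)
  \<comment> \<open>The first k factors build the exponential of the position at grid point k; the
    last one is the increment that follows.\<close>
  define g where "g i y = (if i < k then exp (- (b * y)) else 1 - exp (- (l * y)))" for i and y :: real
  have "(\<integral>\<omega>. exp (- (b * X (real k * d) \<omega>)) * (1 - exp (- (l * (X (real (Suc k) * d) \<omega> - X (real k * d) \<omega>)))) \<partial>Q)
      = (\<integral>\<omega>. (\<Prod>i<Suc k. g i (X (real (Suc i) * d) \<omega> - X (real i * d) \<omega>)) \<partial>Q)"
    by (subst X_eq_sum) (simp add: g_def exp_sum[symmetric] sum_distrib_left sum_negf del: of_nat_Suc)
  also have "\<dots> = (\<Prod>i<Suc k. \<integral>\<omega>. g i (X d \<omega>) \<partial>Q)"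
    by (rule expectation_prod_increments[where B = 1]) (use b l d in \<open>auto simp: g_def\<close>)
  also have "\<dots> = (\<integral>\<omega>. exp (- (b * X d \<omega>)) \<partial>Q) ^ k * (\<integral>\<omega>. 1 - exp (- (l * X d \<omega>)) \<partial>Q)"
    by (simp add: g_def)
  also have "(\<integral>\<omega>. 1 - exp (- (l * X d \<omega>)) \<partial>Q) = 1 - (\<integral>\<omega>. exp (- (l * X d \<omega>)) \<partial>Q)"
    using l d by (subst Bochner_Integration.integral_diff) (auto simp: integrable_exp_X prob_space)
  finally show ?thesis using b l by (simp only: kd e)
qed

lemma nn_expectation_exp_X_grid:
  "0 < l \<Longrightarrow> (\<integral>\<^sup>+\<omega>. ennreal (exp (- (l * X_grid n k \<omega>))) \<partial>Q) = ennreal (exp (- (\<phi> l / Suc n)) ^ k)"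
  by (subst nn_integral_eq_integral) (auto simp: integrable_exp_X expectation_exp_X_grid simp del: of_nat_Suc)

lemma suminf_exp_grid:
  assumes "0 < l"
  shows "(\<Sum>k. ennreal (exp (- (\<phi> l / Suc n)) ^ k)) = ennreal (1 / (1 - exp (- (\<phi> l / Suc n))))"
  using expectation_exp_X_1(2)[OF assms] by (intro suminf_ennreal_eq geometric_sums) auto

text \<open>The expected sum of exp(-X k) over integers k is a finite geometric series, so almost
  surely the terms tend to 0 and the path is unbounded. First passage times are then genuine
  infima.\<close>

lemma AE_unbounded: "AE \<omega> in Q. S 0 \<omega> = 0 \<and> (\<forall>t. \<exists>r\<ge>0. t < S r \<omega>)"
proof -
  have "(\<integral>\<^sup>+\<omega>. (\<Sum>k. ennreal (exp (- (1 * X (real k / Suc 0) \<omega>)))) \<partial>Q) = (\<Sum>k. ennreal (exp (- (\<phi> 1 / Suc 0)) ^ k))"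
    using nn_expectation_exp_X_grid[of 1 _ 0] by (subst nn_integral_suminf) simp_all
  also have "\<dots> \<noteq> \<infinity>" by (subst suminf_exp_grid) auto
  finally have "AE \<omega> in Q. (\<Sum>k. ennreal (exp (- (1 * X (real k / Suc 0) \<omega>)))) \<noteq> \<infinity>"
    by (intro nn_integral_PInf_AE) auto
  then show ?thesis
    using S_0
  proof eventually_elim
    case (elim \<omega>)
    then have "summable (\<lambda>k. exp (- X (real k) \<omega>))"
      by (intro summable_suminf_not_top) auto
    then have lim: "(\<lambda>k. exp (- X (real k) \<omega>)) \<longlonglongrightarrow> 0"
      by (rule summable_LIMSEQ_zero)
    have "\<exists>r\<ge>0. t < S r \<omega>" for t
    proof -
      have "\<forall>\<^sub>F k in sequentially. exp (- X (real k) \<omega>) < exp (- t)"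
        by (rule order_tendstoD(2)[OF lim]) simp
      then obtain k where "exp (- X (real k) \<omega>) < exp (- t)"
        by (auto simp: eventually_sequentially)
      then have "t < S (real k) \<omega>" using elim by (simp add: from_zero_eq)
      then show ?thesis by (intro exI[of _ "real k"]) simp
    qed
    with elim show ?case by simp
  qed
qed

section \<open>Double Laplace transform of the undershooting\<close>

definition H :: "real \<Rightarrow> 'w \<Rightarrow> real" where
  "H = undershooting S"

lemma H_measurable [measurable]: "H t \<in> borel_measurable Q"
  unfolding H_def by (rule undershooting_measurable) (auto intro: S_measurable S_cadlag S_strict_mono)

lemma H_nonneg: "\<omega> \<in> space Q \<Longrightarrow> 0 \<le> H t \<omega>"
  unfolding H_def by (intro undershooting_nonneg S_cadlag S_strict_mono)

text \<open>One null set serves all pairs of times, since the quantifiers stand inside the almost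
  sure statement. Time 0 is separate: the level 0 is not above the start S 0 = 0.\<close>

lemma AE_H: "AE \<omega> in Q. \<forall>t>0. 0 \<le> H t \<omega> \<and> H t \<omega> \<le> t \<and> (\<forall>t'\<ge>t. H t \<omega> \<le> H t' \<omega>)"
  using AE_unbounded AE_space
proof eventually_elim
  case (elim \<omega>)
  then show ?case
    using undershooting_le[where S = S and \<omega> = \<omega>, OF S_cadlag S_strict_mono]
      undershooting_mono[where S = S and \<omega> = \<omega>, OF S_cadlag S_strict_mono]
    unfolding H_def[symmetric] by (force simp: H_nonneg)
qed

lemma AE_H_0: "AE \<omega> in Q. H 0 \<omega> = 0"
  using AE_unbounded AE_space
proof eventually_elim
  case (elim \<omega>)
  then show ?case
    unfolding H_def by (intro undershooting_degenerate(1)[OF S_cadlag S_strict_mono]) auto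
qed

text \<open>Discretisation of exp(-a H(t)). Writing it as a sum over cells, rather than through the
  passage time, makes it jointly measurable in t and \<omega> and lets the integral over t be
  computed cell by cell.\<close>

definition exp_grid :: "real \<Rightarrow> nat \<Rightarrow> real \<Rightarrow> 'w \<Rightarrow> ennreal" where
  "exp_grid a n t \<omega> = (\<Sum>k. ennreal (exp (- (a * X_grid n k \<omega>))) * indicator (grid_cell S n k \<omega>) t)"

lemma exp_grid_measurable [measurable]: "(\<lambda>(t, \<omega>). exp_grid a n t \<omega>) \<in> borel_measurable (lborel \<Otimes>\<^sub>M Q)"
proof -
  have [measurable]: "Measurable.pred (lborel \<Otimes>\<^sub>M Q) (\<lambda>x. fst x \<in> grid_cell S n k (snd x))" for k
    unfolding grid_cell_def greaterThanAtMost_iff by measurable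
  show ?thesis
    unfolding exp_grid_def indicator_def split_beta' by measurable
qed

lemma exp_grid_measurable' [measurable]: "exp_grid a n t \<in> borel_measurable Q"
  using measurable_compose[OF measurable_Pair1' exp_grid_measurable, of t a n] by simp

lemma exp_grid_eq:
  assumes "\<omega> \<in> space Q" "S 0 \<omega> < t" "\<exists>r\<ge>0. t < S r \<omega>"
  shows "exp_grid a n t \<omega> = ennreal (exp (- (a * X (real (grid_index n (first_passage S t \<omega>)) / Suc n) \<omega>)))"
proof -
  have cell: "t \<in> grid_cell S n k \<omega> \<longleftrightarrow> k = grid_index n (first_passage S t \<omega>)" for k
    using assms by (intro mem_grid_cell S_cadlag S_strict_mono)
  show ?thesis
    unfolding exp_grid_def
    by (subst suminf_finite[of "{grid_index n (first_passage S t \<omega>)}"]) (auto simp: cell)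
qed

definition laplace_H :: "real \<Rightarrow> real \<Rightarrow> ennreal" where
  "laplace_H a t = (\<integral>\<^sup>+\<omega>. ennreal (exp (- (a * H t \<omega>))) \<partial>Q)"

lemma exp_grid_tendsto:
  assumes t: "0 < t" and a: "0 \<le> a"
  shows "(\<lambda>n. \<integral>\<^sup>+\<omega>. exp_grid a n t \<omega> \<partial>Q) \<longlonglongrightarrow> laplace_H a t"
    and "(\<integral>\<^sup>+\<omega>. exp_grid a n t \<omega> \<partial>Q) \<le> 1"
proof -
  have le: "AE \<omega> in Q. exp_grid a n t \<omega> \<le> 1" for n
    using AE_unbounded AE_space
  proof eventually_elim
    case (elim \<omega>)
    then show ?case using t a by (simp add: exp_grid_eq X_nonneg)
  qed
  show "(\<lambda>n. \<integral>\<^sup>+\<omega>. exp_grid a n t \<omega> \<partial>Q) \<longlonglongrightarrow> laplace_H a t"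
    unfolding laplace_H_def
  proof (rule nn_integral_dominated_convergence[where w = "\<lambda>_. 1"])
    show "AE \<omega> in Q. (\<lambda>n. exp_grid a n t \<omega>) \<longlonglongrightarrow> ennreal (exp (- (a * H t \<omega>)))"
      using AE_unbounded AE_space
    proof eventually_elim
      case (elim \<omega>)
      then have good: "S 0 \<omega> < t" "\<exists>r\<ge>0. t < S r \<omega>" using t by auto
      have "(\<lambda>n. X (real (grid_index n (first_passage S t \<omega>)) / Suc n) \<omega>) \<longlonglongrightarrow> H t \<omega>"
        unfolding H_def using elim good by (intro undershooting_tendsto S_cadlag S_strict_mono) auto
      then have "(\<lambda>n. ennreal (exp (- (a * X (real (grid_index n (first_passage S t \<omega>)) / Suc n) \<omega>))))
          \<longlonglongrightarrow> ennreal (exp (- (a * H t \<omega>)))"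
        by (intro tendsto_intros)
      then show ?case using elim good by (simp add: exp_grid_eq del: of_nat_Suc)
    qed
  qed (use le in \<open>auto simp: emeasure_space_1\<close>)
  show "(\<integral>\<^sup>+\<omega>. exp_grid a n t \<omega> \<partial>Q) \<le> 1"
    using nn_integral_mono_AE[OF le] by (simp add: emeasure_space_1)
qed

sublocale lborel_pair: pair_sigma_finite lborel Q ..

text \<open>For a fixed mesh all is explicit: the weight integrated over a cell is a difference of
  exponentials, independence of grid increments factorises its expectation, and the sum over the
  cells is geometric.\<close>

lemma nn_integral_exp_grid:
  assumes a: "0 \<le> a" and l: "0 < l"
  shows "(\<integral>\<^sup>+t. exp_weight l t * (\<integral>\<^sup>+\<omega>. exp_grid a n t \<omega> \<partial>Q) \<partial>lborel)
    = ennreal ((1 - exp (- (\<phi> l / Suc n))) / (l * (1 - exp (- (\<phi> (l + a) / Suc n)))))"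
proof -
  \<comment> \<open>l times the contribution of cell k, with the exponential at the lower end of the
    cell factored out and merged with exp(-a X).\<close>
  define f where "f k \<omega> = exp (- ((l + a) * X_grid n k \<omega>)) *
      (1 - exp (- (l * (X_grid n (Suc k) \<omega> - X_grid n k \<omega>))))" for k \<omega>
  have f_meas [measurable]: "f k \<in> borel_measurable Q" for k
    unfolding f_def by measurable
  have X_Suc: "X_grid n k \<omega> \<le> X_grid n (Suc k) \<omega>" if "\<omega> \<in> space Q" for k \<omega>
    using that by (intro X_mono divide_right_mono) auto
  have f_bounds: "0 \<le> f k \<omega>" "f k \<omega> \<le> 1" if "\<omega> \<in> space Q" for k \<omega>
  proof -
    have 1: "0 \<le> 1 - exp (- (l * (X_grid n (Suc k) \<omega> - X_grid n k \<omega>)))"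
      using X_Suc[OF that, of k] l by simp
    then show "0 \<le> f k \<omega>" by (simp add: f_def)
    have "exp (- ((l + a) * X_grid n k \<omega>)) \<le> 1"
      using X_nonneg[OF that, of "real k / Suc n"] a l by (simp add: mult_nonneg_nonneg)
    with 1 show "f k \<omega> \<le> 1" unfolding f_def by (intro mult_le_one) auto
  qed
  have "(\<integral>\<^sup>+t. exp_weight l t * (\<integral>\<^sup>+\<omega>. exp_grid a n t \<omega> \<partial>Q) \<partial>lborel)
      = (\<integral>\<^sup>+t. (\<integral>\<^sup>+\<omega>. exp_weight l t * exp_grid a n t \<omega> \<partial>Q) \<partial>lborel)"
    by (simp add: nn_integral_cmult)
  also have "\<dots> = (\<integral>\<^sup>+\<omega>. (\<integral>\<^sup>+t. exp_weight l t * exp_grid a n t \<omega> \<partial>lborel) \<partial>Q)"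
    by (rule lborel_pair.Fubini'[symmetric]) measurable
  also have "\<dots> = (\<integral>\<^sup>+\<omega>. (\<Sum>k. ennreal (f k \<omega> / l)) \<partial>Q)"
  proof (rule nn_integral_cong_AE)
    show "AE \<omega> in Q. (\<integral>\<^sup>+t. exp_weight l t * exp_grid a n t \<omega> \<partial>lborel)
        = (\<Sum>k. ennreal (f k \<omega> / l))"
      using S_0 AE_space
    proof eventually_elim
      case (elim \<omega>)
      have S_X: "S r \<omega> = X r \<omega>" for r using elim by (simp add: from_zero_eq)
      have "(\<integral>\<^sup>+t. exp_weight l t * exp_grid a n t \<omega> \<partial>lborel)
          = (\<integral>\<^sup>+t. (\<Sum>k. ennreal (exp (- (a * X_grid n k \<omega>))) *
              (exp_weight l t * indicator {X_grid n k \<omega><..X_grid n (Suc k) \<omega>} t)) \<partial>lborel)"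
        unfolding exp_grid_def grid_cell_def S_X ennreal_suminf_cmult[symmetric]
        by (intro nn_integral_cong suminf_cong) (simp only: ac_simps)
      also have "\<dots> = (\<Sum>k. ennreal (exp (- (a * X_grid n k \<omega>))) *
          (\<integral>\<^sup>+t. exp_weight l t * indicator {X_grid n k \<omega><..X_grid n (Suc k) \<omega>} t \<partial>lborel))"
        by (subst nn_integral_suminf) (auto simp: nn_integral_cmult)
      also have "\<dots> = (\<Sum>k. ennreal (f k \<omega> / l))"
      proof (rule suminf_cong)
        fix k
        have "ennreal (exp (- (a * X_grid n k \<omega>))) *
          (\<integral>\<^sup>+t. exp_weight l t * indicator {X_grid n k \<omega><..X_grid n (Suc k) \<omega>} t \<partial>lborel)
          = ennreal (exp (- (a * X_grid n k \<omega>)) * ((exp (- (l * X_grid n k \<omega>)) - exp (- (l * X_grid n (Suc k) \<omega>))) / l))"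
          using elim l X_Suc X_nonneg by (subst nn_integral_exp_interval) (auto simp: ennreal_mult'[symmetric] simp del: of_nat_Suc)
        also have "exp (- (a * X_grid n k \<omega>)) * ((exp (- (l * X_grid n k \<omega>)) - exp (- (l * X_grid n (Suc k) \<omega>))) / l) = f k \<omega> / l"
          unfolding f_def by (simp add: right_diff_distrib exp_add[symmetric] algebra_simps del: of_nat_Suc)
        finally show "ennreal (exp (- (a * X_grid n k \<omega>))) *
          (\<integral>\<^sup>+t. exp_weight l t * indicator {X_grid n k \<omega><..X_grid n (Suc k) \<omega>} t \<partial>lborel)
          = ennreal (f k \<omega> / l)" .
      qed
      finally show ?case .
    qed
  qed
  also have "\<dots> = (\<Sum>k. \<integral>\<^sup>+\<omega>. ennreal (f k \<omega> / l) \<partial>Q)"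
    by (rule nn_integral_suminf) measurable
  also have "\<dots> = (\<Sum>k. ennreal (exp (- (\<phi> (l + a) / Suc n)) ^ k) * ennreal ((1 - exp (- (\<phi> l / Suc n))) / l))"
  proof (rule suminf_cong)
    fix k
    have int: "integrable Q (f k)"
      by (rule integrable_const_bound[where B = 1]) (auto intro!: AE_I2 simp: f_bounds)
    have "(\<integral>\<^sup>+\<omega>. ennreal (f k \<omega> / l) \<partial>Q) = ennreal (\<integral>\<omega>. f k \<omega> / l \<partial>Q)"
      using int l f_bounds by (intro nn_integral_eq_integral) (auto intro!: AE_I2)
    also have "(\<integral>\<omega>. f k \<omega> / l \<partial>Q) = exp (- (\<phi> (l + a) / Suc n)) ^ k * ((1 - exp (- (\<phi> l / Suc n))) / l)"
      unfolding f_def using expectation_grid_jump[of "l + a" l k n] a l by (simp del: of_nat_Suc)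
    finally show "(\<integral>\<^sup>+\<omega>. ennreal (f k \<omega> / l) \<partial>Q)
        = ennreal (exp (- (\<phi> (l + a) / Suc n)) ^ k) * ennreal ((1 - exp (- (\<phi> l / Suc n))) / l)"
      by (simp only: ennreal_mult' zero_le_power exp_ge_zero)
  qed
  also have "\<dots> = ennreal (1 / (1 - exp (- (\<phi> (l + a) / Suc n)))) * ennreal ((1 - exp (- (\<phi> l / Suc n))) / l)"
    using suminf_exp_grid[of "l + a" n] a l by (simp only: ennreal_suminf_multc add_pos_nonneg)
  also have "\<dots> = ennreal ((1 - exp (- (\<phi> l / Suc n))) / (l * (1 - exp (- (\<phi> (l + a) / Suc n)))))"
    using expectation_exp_X_1(2)[of "l + a"] a l by (subst ennreal_mult'[symmetric]) (auto simp: mult.commute)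
  finally show ?thesis .
qed

lemma laplace_H_measurable:
  assumes a: "0 \<le> a"
  shows "(\<lambda>t. exp_weight l t * laplace_H a t) \<in> borel_measurable lborel"
proof (rule borel_measurable_LIMSEQ_order)
  fix t
  show "(\<lambda>n. exp_weight l t * (\<integral>\<^sup>+\<omega>. exp_grid a n t \<omega> \<partial>Q))
      \<longlonglongrightarrow> exp_weight l t * laplace_H a t"
  proof (cases "0 < t")
    case True
    then show ?thesis using exp_grid_tendsto(1)[OF True a] by (intro tendsto_intros) auto
  qed simp
qed measurable

text \<open>As the mesh tends to 0, the ratio of 1 - exp(-\<phi>(l)/(n+1)) to the same term at l + a
  tends to the ratio of the exponents. \<open>exp_weight\<close> dominates because the discretised
  expectations are at most 1.\<close>

lemma nn_integral_laplace_H: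
  assumes a: "0 \<le> a" and l: "0 < l"
  shows "(\<integral>\<^sup>+t. exp_weight l t * laplace_H a t \<partial>lborel) = ennreal (\<phi> l / (l * \<phi> (l + a)))"
proof -
  have "(\<lambda>n. \<integral>\<^sup>+t. exp_weight l t * (\<integral>\<^sup>+\<omega>. exp_grid a n t \<omega> \<partial>Q) \<partial>lborel)
      \<longlonglongrightarrow> (\<integral>\<^sup>+t. exp_weight l t * laplace_H a t \<partial>lborel)"
  proof (rule nn_integral_dominated_convergence[where w = "\<lambda>t. exp_weight l t"])
    show "AE t in lborel. (\<lambda>n. exp_weight l t * (\<integral>\<^sup>+\<omega>. exp_grid a n t \<omega> \<partial>Q))
      \<longlonglongrightarrow> exp_weight l t * laplace_H a t"
    proof (rule AE_I2)
      fix t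
      show "(\<lambda>n. exp_weight l t * (\<integral>\<^sup>+\<omega>. exp_grid a n t \<omega> \<partial>Q))
          \<longlonglongrightarrow> exp_weight l t * laplace_H a t"
      proof (cases "0 < t")
        case True
        then show ?thesis using exp_grid_tendsto(1)[OF True a] by (intro tendsto_intros) auto
      qed simp
    qed
    show "AE t in lborel. exp_weight l t * (\<integral>\<^sup>+\<omega>. exp_grid a n t \<omega> \<partial>Q)
        \<le> exp_weight l t" for n
    proof (rule AE_I2)
      fix t
      show "exp_weight l t * (\<integral>\<^sup>+\<omega>. exp_grid a n t \<omega> \<partial>Q)
        \<le> exp_weight l t"
        using exp_grid_tendsto(2)[OF _ a, of t n] mult_left_mono[of "\<integral>\<^sup>+\<omega>. exp_grid a n t \<omega> \<partial>Q" 1 "ennreal (exp (- (l * t)))"]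
        by (cases "0 < t") auto
    qed
    have "(\<integral>\<^sup>+t. exp_weight l t \<partial>lborel)
        = (\<integral>\<^sup>+t. ennreal (1 / l) * (exp_law l t * indicator {0<..} t) \<partial>lborel)"
      using l by (intro nn_integral_cong) (auto simp: indicator_def ennreal_mult'[symmetric])
    also have "\<dots> = ennreal (1 / l) * ennreal (exp (- (l * 0)))"
      using nn_integral_exp_atLeast[OF l, of 0] by (subst nn_integral_cmult) auto
    finally show "(\<integral>\<^sup>+t. exp_weight l t \<partial>lborel) < \<infinity>"
      by simp
  qed (use laplace_H_measurable[OF a] in measurable)
  moreover have "(\<lambda>n. ennreal ((1 - exp (- (\<phi> l / Suc n))) / (l * (1 - exp (- (\<phi> (l + a) / Suc n)))))) \<longlonglongrightarrow> ennreal (\<phi> l / (l * \<phi> (l + a)))"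
  proof -
    have pos: "0 < \<phi> l" "0 < \<phi> (l + a)" using a l by (auto intro!: expectation_exp_X_1(2))
    have "(\<lambda>n. (1 - exp (- (c / Suc n))) / (l * (1 - exp (- (b / Suc n))))) \<longlonglongrightarrow> c * (inverse l * inverse b)"
      if "0 < c" "0 < b" for b c :: real
      using that l by real_asymp
    from tendsto_ennrealI[OF this[OF pos]] show ?thesis
      by (simp add: divide_inverse[of "\<phi> l" "l * \<phi> (l + a)"] inverse_mult_distrib del: of_nat_Suc)
  qed
  ultimately show ?thesis
    unfolding nn_integral_exp_grid[OF a l] by (rule LIMSEQ_unique)
qed

text \<open>H is nondecreasing in t. The monotonicity serves to extend an identity from almost every
  t to every t.\<close>

lemma laplace_H_antimono:
  assumes "0 \<le> a" "0 < t" "t \<le> t'"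
  shows "laplace_H a t' \<le> laplace_H a t"
  unfolding laplace_H_def
proof (rule nn_integral_mono_AE)
  show "AE \<omega> in Q. ennreal (exp (- (a * H t' \<omega>))) \<le> ennreal (exp (- (a * H t \<omega>)))"
    using AE_H by eventually_elim (use assms in \<open>auto intro!: ennreal_leI mult_left_mono\<close>)
qed

end

section \<open>The renewal equation\<close>

text \<open>A Levy measure carried to the Borel sets of the whole line: tails are finite, the mass
  near 0 may be infinite.\<close>

locale tail_measure =
  fixes N :: "real measure"
  assumes sets_N [measurable_cong]: "sets N = sets borel"
    and N_nonpos: "emeasure N {..0} = 0"
    and N_tail: "0 < t \<Longrightarrow> emeasure N {t<..} < \<infinity>"
begin

lemma space_N [simp]: "space N = UNIV"
  using sets_eq_imp_space_eq[OF sets_N] by simp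

lemma sigma_finite_N: "sigma_finite_measure N"
proof
  define A where "A = insert {..0} (range (\<lambda>n::nat. {1 / Suc n<..}))"
  have "\<exists>n::nat. 1 / Suc n < x" if "0 < x" for x :: real
    using reals_Archimedean[OF that] by (simp add: inverse_eq_divide)
  then have "x \<in> \<Union> A" for x
    unfolding A_def by (cases "0 < x") (auto simp del: of_nat_Suc)
  then have "\<Union> A = space N" by auto
  moreover have "emeasure N a \<noteq> \<infinity>" if "a \<in> A" for a
    using that N_nonpos N_tail[of "1 / Suc n" for n] unfolding A_def by (auto simp: less_top[symmetric] simp del: of_nat_Suc)
  moreover have "countable A" "A \<subseteq> sets N"
    by (auto simp: A_def sets_N)
  ultimately show "\<exists>A. countable A \<and> A \<subseteq> sets N \<and> \<Union> A = space N \<and> (\<forall>a\<in>A. emeasure N a \<noteq> \<infinity>)"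
    by blast
qed

sublocale sigma_finite_measure N
  by (rule sigma_finite_N)

sublocale pair: pair_sigma_finite lborel N ..

lemma AE_N_pos: "AE s in N. 0 < s"
  by (rule AE_I[where N = "{..0}"]) (auto simp: N_nonpos sets_N)

lemma N_Ici: "0 < t \<Longrightarrow> emeasure N {t..} < \<infinity>"
  by (rule le_less_trans[OF emeasure_mono N_tail[of "t / 2"]]) (auto simp: sets_N)

lemma tail_eq_nn_integral: "emeasure N {z<..} = (\<integral>\<^sup>+s. indicator {z<..} s \<partial>N)"
  by (simp add: sets_N)

lemma tail_measurable [measurable]: "(\<lambda>z. emeasure N {z<..}) \<in> borel_measurable borel"
proof -
  have "(\<lambda>z. \<integral>\<^sup>+s. indicator {x. fst x < snd x} (z, s) \<partial>N) \<in> borel_measurable borel"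
    by measurable
  moreover have "emeasure N {z<..} = (\<integral>\<^sup>+s. indicator {x. fst x < snd x} (z, s) \<partial>N)" for z :: real
    unfolding tail_eq_nn_integral by (rule nn_integral_cong) (simp add: indicator_def)
  ultimately show ?thesis by simp
qed

lemma tail_measurable' [measurable (raw)]:
  "f \<in> borel_measurable M \<Longrightarrow> (\<lambda>x. emeasure N {f x<..}) \<in> borel_measurable M"
  using measurable_compose[OF _ tail_measurable] by blast

end

text \<open>p is 0 on the left half-line, so that shifted arguments such as w - s need no case
  distinction. The assumption \<open>convolution\<close> is p * T = 1 at every positive
  time.\<close>

locale renewal_pair = tail_measure +
  fixes p :: "real \<Rightarrow> real"
  assumes p_measurable [measurable]: "p \<in> borel_measurable borel"
    and p_nonpos: "y \<le> 0 \<Longrightarrow> p y = 0"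
    and p_pos: "0 < y \<Longrightarrow> 0 < p y"
    and p_antimono: "0 < x \<Longrightarrow> x \<le> y \<Longrightarrow> p y \<le> p x"
    and p_integrable: "(\<integral>\<^sup>+y. ennreal (p y) * indicator {..<t} y \<partial>lborel) < \<infinity>"
    and convolution: "0 < t \<Longrightarrow>
      (\<integral>\<^sup>+y. ennreal (p y) * emeasure N {t - y<..} * indicator {..<t} y \<partial>lborel) = 1"
begin

lemma p_nonneg: "0 \<le> p y"
  using p_nonpos[of y] p_pos[of y] by (cases "y \<le> 0") auto

text \<open>This is p * T = 1 with the tail written as an integral and the order exchanged. For a
  primitive U of p it says that U(t) - U(t - s) integrates to 1 over N, whatever t > 0 is.\<close>

lemma nn_integral_increment:
  assumes "0 < t"
  shows "(\<integral>\<^sup>+s. (\<integral>\<^sup>+y. ennreal (p y) * indicator {t - s<..<t} y \<partial>lborel) \<partial>N) = 1"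
proof -
  have eq: "ennreal (p y) * indicator {t - s<..<t} y
      = ennreal (p y) * indicator {..<t} y * indicator {x. t < fst x + snd x} (y, s)" for y s
    by (auto simp: indicator_def)
  have "(\<integral>\<^sup>+s. (\<integral>\<^sup>+y. ennreal (p y) * indicator {t - s<..<t} y \<partial>lborel) \<partial>N)
      = (\<integral>\<^sup>+y. (\<integral>\<^sup>+s. ennreal (p y) * indicator {..<t} y * indicator {x. t < fst x + snd x} (y, s) \<partial>N) \<partial>lborel)"
    unfolding eq by (subst pair.Fubini') simp_all
  also have "\<dots> = (\<integral>\<^sup>+y. ennreal (p y) * emeasure N {t - y<..} * indicator {..<t} y \<partial>lborel)"
  proof (rule nn_integral_cong)
    fix y
    have "(\<integral>\<^sup>+s. ennreal (p y) * indicator {..<t} y * indicator {x. t < fst x + snd x} (y, s) \<partial>N)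
        = ennreal (p y) * indicator {..<t} y * (\<integral>\<^sup>+s. indicator {t - y<..} s \<partial>N)"
      by (subst nn_integral_cmult[symmetric])
         (auto simp: sets_N intro!: nn_integral_cong split: split_indicator)
    then show "(\<integral>\<^sup>+s. ennreal (p y) * indicator {..<t} y * indicator {x. t < fst x + snd x} (y, s) \<partial>N)
        = ennreal (p y) * emeasure N {t - y<..} * indicator {..<t} y"
      by (simp add: sets_N ac_simps)
  qed
  finally show ?thesis
    using convolution[OF assms] by simp
qed

text \<open>Formally the integral of p(w - s) - p(w) over N(ds) is minus the derivative of p * T,
  hence 0. Dropping p(w) for s \<ge> r changes this value to N[r, \<infinity>) p(w) and makes the
  function nonnegative for w > r, so that Tonelli applies although N is infinite near 0.\<close>

definition psi :: "real \<Rightarrow> real \<Rightarrow> real \<Rightarrow> real" where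
  "psi r s w = (if s < r then p (w - s) - p w else p (w - s))"

lemma psi_measurable [measurable]: "(\<lambda>x. psi r (f x) (g x)) \<in> borel_measurable M"
  if [measurable]: "f \<in> borel_measurable M" "g \<in> borel_measurable M"
  unfolding psi_def by measurable

lemma nn_integral_p_finite: "(\<integral>\<^sup>+y. ennreal (p y) * indicator {a<..<t} y \<partial>lborel) < \<infinity>"
  by (rule le_less_trans[OF _ p_integrable[of t]])
     (auto intro!: nn_integral_mono simp: indicator_def)

lemma nn_integral_shift:
  fixes f :: "real \<Rightarrow> ennreal"
  assumes [measurable]: "f \<in> borel_measurable borel"
  shows "(\<integral>\<^sup>+w. f (w - s) \<partial>lborel) = (\<integral>\<^sup>+y. f y \<partial>lborel)"
  using nn_integral_real_affine[of f 1 "- s"] by simp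

text \<open>Two ways of writing U(t) - U(a - s) for a primitive U of p, one cut at t - s and one at
  a; for s < r the finite term U(t) - U(a) is cancelled. Sums replace differences because the values
  are extended nonnegative reals.\<close>

lemma psi_increment:
  assumes "0 < r" "r \<le> a" "a < t" "0 < s"
  shows "(\<integral>\<^sup>+w. ennreal (psi r s w) * indicator {a<..<t} w \<partial>lborel)
      + (\<integral>\<^sup>+y. ennreal (p y) * indicator {t - s<..<t} y \<partial>lborel)
    = (\<integral>\<^sup>+y. ennreal (p y) * indicator {a - s<..<a} y \<partial>lborel)
      + (\<integral>\<^sup>+y. ennreal (p y) * indicator {a<..<t} y \<partial>lborel) * indicator {r..} s"
    (is "?Psi + ?Ct = ?Ca + ?V * _")
proof -
  let ?Sh = "\<integral>\<^sup>+w. ennreal (p (w - s)) * indicator {a<..<t} w \<partial>lborel"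
  have "?Sh = (\<integral>\<^sup>+y. ennreal (p y) * indicator {a - s<..<t - s} y \<partial>lborel)"
    by (subst nn_integral_shift[symmetric, where s = s])
       (auto intro!: nn_integral_cong simp: indicator_def)
  then have "?Sh + ?Ct = (\<integral>\<^sup>+y. ennreal (p y) * (indicator {a - s<..<t - s} y + indicator {t - s<..<t} y) \<partial>lborel)"
    by (simp add: nn_integral_add[symmetric] distrib_left)
  also have "\<dots> = (\<integral>\<^sup>+y. ennreal (p y) * (indicator {a - s<..<a} y + indicator {a<..<t} y) \<partial>lborel)"
    using AE_lborel_singleton[of a] AE_lborel_singleton[of "t - s"] assms
    by (intro nn_integral_cong_AE) (auto elim!: eventually_elim2 simp: indicator_def)
  also have "\<dots> = ?Ca + ?V"
    by (simp add: nn_integral_add[symmetric] distrib_left)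
  finally have *: "?Sh + ?Ct = ?Ca + ?V" .
  show ?thesis
  proof (cases "s < r")
    case True
    have "?Sh = (\<integral>\<^sup>+w. ennreal (psi r s w) * indicator {a<..<t} w + ennreal (p w) * indicator {a<..<t} w \<partial>lborel)"
      using True assms
      by (auto intro!: nn_integral_cong simp: indicator_def psi_def ennreal_plus[symmetric] p_antimono p_nonneg
            simp del: ennreal_plus)
    also have "\<dots> = ?Psi + ?V"
      by (rule nn_integral_add) auto
    finally have "?V + (?Psi + ?Ct) = ?V + ?Ca"
      using * by (simp add: ac_simps)
    then have "?Psi + ?Ct = ?Ca"
      using nn_integral_p_finite[of a t] unfolding ennreal_add_left_cancel by auto
    with True show ?thesis by simp
  next
    case False
    then have "?Psi = ?Sh" by (simp add: psi_def)
    with * False show ?thesis by simp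
  qed
qed

text \<open>When \<open>psi_increment\<close> is integrated over N, the increments at t and at a
  both contribute 1 and cancel. This is the formal identity for \<open>psi\<close>, tested on
  intervals in w, which avoids differentiating p * T.\<close>

lemma nn_integral_psi:
  assumes "0 < r" "r \<le> a" "a < t"
  shows "(\<integral>\<^sup>+s. (\<integral>\<^sup>+w. ennreal (psi r s w) * indicator {a<..<t} w \<partial>lborel) \<partial>N)
    = emeasure N {r..} * (\<integral>\<^sup>+y. ennreal (p y) * indicator {a<..<t} y \<partial>lborel)"
    (is "?Psi = _ * ?V")
proof -
  have meas: "(\<lambda>s. \<integral>\<^sup>+y. ennreal (p y) * indicator {b - s<..<b} y \<partial>lborel) \<in> borel_measurable N" for b
  proof -
    have "(\<lambda>s. \<integral>\<^sup>+y. ennreal (p y) * indicator {x. b < fst x + snd x \<and> snd x < b} (s, y) \<partial>lborel) \<in> borel_measurable N"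
      by measurable
    then show ?thesis by (simp add: indicator_def diff_less_eq add.commute)
  qed
  have "1 + ?Psi = (\<integral>\<^sup>+s. (\<integral>\<^sup>+w. ennreal (psi r s w) * indicator {a<..<t} w \<partial>lborel)
      + (\<integral>\<^sup>+y. ennreal (p y) * indicator {t - s<..<t} y \<partial>lborel) \<partial>N)"
    using assms by (subst nn_integral_add) (auto simp: nn_integral_increment add.commute meas)
  also have "\<dots> = (\<integral>\<^sup>+s. (\<integral>\<^sup>+y. ennreal (p y) * indicator {a - s<..<a} y \<partial>lborel) + ?V * indicator {r..} s \<partial>N)"
    using AE_N_pos by (intro nn_integral_cong_AE) (auto elim!: eventually_mono intro!: psi_increment assms)
  also have "\<dots> = 1 + ?V * emeasure N {r..}"
    using assms by (subst nn_integral_add) (auto simp: nn_integral_increment meas sets_N nn_integral_cmult_indicator)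
  finally show ?thesis
    by (simp add: ennreal_add_left_cancel mult.commute)
qed

text \<open>On (t, 2t) the density is at least p(2t) > 0, so the convolution identity at 2t bounds
  the integral by 1 / p(2t).\<close>

lemma tail_integral_finite:
  assumes "0 < t"
  shows "(\<integral>\<^sup>+z. emeasure N {z<..} * indicator {0<..<t} z \<partial>lborel) < \<infinity>"
proof -
  have "(\<integral>\<^sup>+z. emeasure N {z<..} * indicator {0<..<t} z \<partial>lborel)
      = (\<integral>\<^sup>+y. emeasure N {2 * t - y<..} * indicator {t<..<2 * t} y \<partial>lborel)"
    by (subst nn_integral_real_affine[where c = "-1" and t = "2 * t"])
       (auto intro!: nn_integral_cong simp: indicator_def)
  then have "ennreal (p (2 * t)) * (\<integral>\<^sup>+z. emeasure N {z<..} * indicator {0<..<t} z \<partial>lborel)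
      = (\<integral>\<^sup>+y. ennreal (p (2 * t)) * (emeasure N {2 * t - y<..} * indicator {t<..<2 * t} y) \<partial>lborel)"
    by (simp add: nn_integral_cmult)
  also have "\<dots> \<le> (\<integral>\<^sup>+y. ennreal (p y) * emeasure N {2 * t - y<..} * indicator {..<2 * t} y \<partial>lborel)"
    using assms by (intro nn_integral_mono)
      (auto simp: indicator_def intro!: mult_right_mono ennreal_leI p_antimono)
  also have "\<dots> = 1"
    using assms by (intro convolution) simp
  finally show ?thesis
    using p_pos[of "2 * t"] assms
    by (auto simp: less_top[symmetric] ennreal_mult_eq_top_iff top_unique)
qed

text \<open>If p \<le> B, then 1 = (p * T)(t) is at most B times the integral of T over (0, t),
  which tends to 0 with t.\<close>

lemma p_unbounded: "\<exists>d>0. B < p d"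
proof (rule ccontr)
  assume "\<not> ?thesis"
  then have B: "p d \<le> B" if "0 < d" for d using that by force
  have "(\<lambda>n. \<integral>\<^sup>+z. emeasure N {z<..} * indicator {0<..<1 / Suc n} z \<partial>lborel) \<longlonglongrightarrow> (\<integral>\<^sup>+(z::real). 0 \<partial>lborel)"
  proof (rule nn_integral_dominated_convergence[where w = "\<lambda>z. emeasure N {z<..} * indicator {0<..<1} z"])
    show "AE z in lborel. (\<lambda>n. emeasure N {z<..} * indicator {0<..<1 / Suc n} z) \<longlonglongrightarrow> 0"
    proof (rule AE_I2)
      fix z :: real
      have "eventually (\<lambda>n. z \<notin> {0<..<1 / Suc n}) sequentially"
      proof (cases "0 < z")
        case True
        have "(\<lambda>n. 1 / real (Suc n)) \<longlonglongrightarrow> 0" by real_asymp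
        from order_tendstoD(2)[OF this True] show ?thesis
          by eventually_elim auto
      qed simp
      then show "(\<lambda>n. emeasure N {z<..} * indicator {0<..<1 / Suc n} z) \<longlonglongrightarrow> 0"
        by (intro tendsto_eventually, elim eventually_mono) (simp add: indicator_def)
    qed
    show "(\<integral>\<^sup>+z. emeasure N {z<..} * indicator {0<..<1} z \<partial>lborel) < \<infinity>"
      by (rule tail_integral_finite) simp
    show "AE z in lborel. emeasure N {z<..} * indicator {0<..<1 / Suc n} z \<le> emeasure N {z<..} * indicator {0<..<1} z" for n
    proof (rule AE_I2)
      fix z :: real
      have "1 / Suc n \<le> (1 :: real)" by simp
      then have "z < 1 / Suc n \<Longrightarrow> z < 1" by linarith
      then show "emeasure N {z<..} * indicator {0<..<1 / Suc n} z \<le> emeasure N {z<..} * indicator {0<..<1} z"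
        by (intro mult_left_mono) (auto simp: indicator_def simp del: of_nat_Suc)
    qed
  qed auto
  then have "(\<lambda>n. ennreal B * (\<integral>\<^sup>+z. emeasure N {z<..} * indicator {0<..<1 / Suc n} z \<partial>lborel)) \<longlonglongrightarrow> ennreal B * 0"
    by (intro tendsto_intros) auto
  moreover have "1 \<le> ennreal B * (\<integral>\<^sup>+z. emeasure N {z<..} * indicator {0<..<1 / Suc n} z \<partial>lborel)" for n
  proof -
    define t where "t = 1 / real (Suc n)"
    have t: "0 < t" by (simp add: t_def)
    have "1 = (\<integral>\<^sup>+y. ennreal (p y) * emeasure N {t - y<..} * indicator {..<t} y \<partial>lborel)"
      using convolution[OF t] by simp
    also have "\<dots> \<le> (\<integral>\<^sup>+y. ennreal B * (emeasure N {t - y<..} * indicator {0<..<t} y) \<partial>lborel)"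
      using B p_nonpos by (intro nn_integral_mono)
        (auto simp: indicator_def mult.assoc not_less intro!: mult_right_mono ennreal_leI)
    also have "\<dots> = ennreal B * (\<integral>\<^sup>+y. emeasure N {t - y<..} * indicator {0<..<t} y \<partial>lborel)"
      by (rule nn_integral_cmult) measurable
    also have "(\<integral>\<^sup>+y. emeasure N {t - y<..} * indicator {0<..<t} y \<partial>lborel)
        = (\<integral>\<^sup>+z. emeasure N {z<..} * indicator {0<..<t} z \<partial>lborel)"
      by (subst (2) nn_integral_real_affine[where c = "-1" and t = t])
         (auto intro!: nn_integral_cong simp: indicator_def)
    finally show ?thesis by (simp add: t_def)
  qed
  ultimately have "1 \<le> ennreal B * 0"
    by (intro LIMSEQ_le_const) auto
  then show False by simp
qed

text \<open>An atom of \<open>N\<close> at \<open>t\<close> would make the renewal density jump upwards at \<open>t\<close> by an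
  infinite amount, because \<open>p\<close> is unbounded at \<open>0\<close>.\<close>

lemma no_atom:
  assumes t: "0 < t"
  shows "emeasure N {t} = 0"
proof (rule ccontr)
  assume "emeasure N {t} \<noteq> 0"
  moreover have fin: "emeasure N {t} < \<infinity>" "emeasure N {t..} < \<infinity>"
    using N_Ici[OF t] emeasure_mono[of "{t}" "{t..}" N] by (auto simp: sets_N le_less_trans)
  ultimately obtain m where m: "emeasure N {t} = ennreal m" "0 < m"
    by (cases "emeasure N {t}") (auto simp: ennreal_eq_0_iff not_le)
  obtain k where k: "emeasure N {t..} = ennreal k" "0 \<le> k"
    using fin by (cases "emeasure N {t..}") auto
  \<comment> \<open>With r = t, the shift s = t alone contributes at least m p(d) d over the window
    (t, t + d), while the total is at most k p(t) d. The choice of d makes this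
    contradictory.\<close>
  obtain d where d: "0 < d" "k * p t / m < p d"
    using p_unbounded by blast
  have shift: "(\<integral>\<^sup>+w. ennreal (p (w - t)) * indicator {t<..<t + d} w \<partial>lborel) = (\<integral>\<^sup>+y. ennreal (p y) * indicator {0<..<d} y \<partial>lborel)"
    by (subst nn_integral_shift[symmetric, where s = t])
       (auto intro!: nn_integral_cong simp: indicator_def)
  have "ennreal (m * p d * d) = ennreal m * (\<integral>\<^sup>+y. ennreal (p d) * indicator {0<..<d} y \<partial>lborel)"
    using d p_nonneg m by (simp add: nn_integral_cmult_indicator ennreal_mult mult.assoc)
  also have "\<dots> \<le> ennreal m * (\<integral>\<^sup>+w. ennreal (p (w - t)) * indicator {t<..<t + d} w \<partial>lborel)"
    unfolding shift
    by (intro mult_left_mono nn_integral_mono) (auto simp: indicator_def p_antimono intro!: ennreal_leI)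
  also have "\<dots> = (\<integral>\<^sup>+s. (\<integral>\<^sup>+w. ennreal (psi t t w) * indicator {t<..<t + d} w \<partial>lborel) * indicator {t} s \<partial>N)"
    by (subst nn_integral_cmult_indicator) (auto simp: sets_N m psi_def mult.commute)
  also have "\<dots> \<le> (\<integral>\<^sup>+s. (\<integral>\<^sup>+w. ennreal (psi t s w) * indicator {t<..<t + d} w \<partial>lborel) \<partial>N)"
    by (intro nn_integral_mono) (auto simp: indicator_def)
  also have "\<dots> = ennreal k * (\<integral>\<^sup>+y. ennreal (p y) * indicator {t<..<t + d} y \<partial>lborel)"
    using nn_integral_psi[of t t "t + d"] t d k by simp
  also have "\<dots> \<le> ennreal k * (\<integral>\<^sup>+y. ennreal (p t) * indicator {t<..<t + d} y \<partial>lborel)"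
    using t by (intro mult_left_mono nn_integral_mono) (auto simp: indicator_def p_antimono intro!: ennreal_leI)
  also have "\<dots> = ennreal (k * p t * d)"
    using d p_nonneg k by (simp add: nn_integral_cmult_indicator ennreal_mult mult.assoc)
  finally have "m * p d * d \<le> k * p t * d"
    using d k p_nonneg[of t] by (simp add: ennreal_le_iff)
  with d m show False
    by (simp add: field_simps)
qed

end

text \<open>F(y) - F(0) is the integral of the derivative over (0, y), and Fubini brings in the
  probability of exceeding r. K is general because the formula is needed both for the law of H(t)
  and for that of s + H(t - s).\<close>

lemma layer_cake_derivative:
  fixes F F' :: "real \<Rightarrow> real"
  assumes K: "prob_space K" "sets K = sets borel" "AE y in K. 0 \<le> y \<and> y \<le> t"
    and F: "continuous_on UNIV F" "continuous_on UNIV F'"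
    and deriv: "\<And>y. 0 \<le> y \<Longrightarrow> (F has_real_derivative F' y) (at y within {0..})"
    and bound: "\<And>y. \<bar>F' y\<bar> \<le> C"
  shows "integrable lborel (\<lambda>r. F' r * measure K {r<..} * indicator {0..t} r)"
    and "(\<integral>y. F y \<partial>K) = F 0 + (\<integral>r. F' r * measure K {r<..} * indicator {0..t} r \<partial>lborel)"
proof -
  interpret K: prob_space K by fact
  note [measurable_cong] = K(2)
  have [measurable]: "F \<in> borel_measurable borel" "F' \<in> borel_measurable borel"
    using F by (auto intro: borel_measurable_continuous_onI)
  interpret P: pair_sigma_finite K lborel ..
  define f where "f y r = F' r * indicator {0..t} r * indicator {x. fst x < snd x} (r, y)" for y r :: real
  have f_meas [measurable]: "case_prod f \<in> borel_measurable (K \<Otimes>\<^sub>M lborel)"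
    unfolding f_def by measurable
  have f_int: "integrable (K \<Otimes>\<^sub>M lborel) (case_prod f)"
  proof (rule integrableI_bounded)
    have "(\<integral>\<^sup>+x. ennreal (norm (case x of (y, r) \<Rightarrow> f y r)) \<partial>(K \<Otimes>\<^sub>M lborel))
        = (\<integral>\<^sup>+y. (\<integral>\<^sup>+r. ennreal (norm (f y r)) \<partial>lborel) \<partial>K)"
      by (subst lborel.nn_integral_fst[symmetric]) auto
    also have "\<dots> \<le> (\<integral>\<^sup>+y. (\<integral>\<^sup>+r. ennreal C * indicator {0..t} r \<partial>lborel) \<partial>K)"
      using bound by (intro nn_integral_mono) (auto simp: f_def indicator_def intro!: ennreal_leI)
    also have "\<dots> = ennreal C * ennreal (max 0 t)"
      by (subst nn_integral_cmult_indicator) (auto simp: K.emeasure_space_1 emeasure_lborel_Icc_eq max_def)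
    also have "\<dots> < \<infinity>" by (simp add: ennreal_mult_less_top)
    finally show "(\<integral>\<^sup>+x. ennreal (norm (case x of (y, r) \<Rightarrow> f y r)) \<partial>(K \<Otimes>\<^sub>M lborel)) < \<infinity>" .
  qed measurable
  have inner: "(\<integral>y. f y r \<partial>K) = F' r * measure K {r<..} * indicator {0..t} r" for r
  proof -
    have "(\<integral>y. f y r \<partial>K) = (\<integral>y. (F' r * indicator {0..t} r) * indicator {r<..} y \<partial>K)"
      by (rule Bochner_Integration.integral_cong) (auto simp: f_def indicator_def)
    then show ?thesis using K by (simp add: sets_eq_imp_space_eq)
  qed
  show "integrable lborel (\<lambda>r. F' r * measure K {r<..} * indicator {0..t} r)"
    using P.integrable_snd[OF f_int] by (simp add: inner)
  have outer: "(\<integral>r. f y r \<partial>lborel) = F y - F 0" if y: "0 \<le> y" "y \<le> t" for y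
  proof -
    have "has_bochner_integral lborel (\<lambda>r. indicator {0..y} r *\<^sub>R F' r) (F y - F 0)"
    proof (rule has_bochner_integral_FTC_Icc)
      fix x assume "0 \<le> x" "x \<le> y"
      then show "(F has_vector_derivative F' x) (at x within {0..y})"
        using DERIV_subset[OF deriv[of x], of "{0..y}"] by (auto simp: has_real_derivative_iff_has_vector_derivative)
    qed (use y F in \<open>auto intro: continuous_on_subset\<close>)
    then have "(\<integral>r. indicator {0..y} r *\<^sub>R F' r \<partial>lborel) = F y - F 0"
      by (simp add: has_bochner_integral_iff)
    also have "(\<integral>r. indicator {0..y} r *\<^sub>R F' r \<partial>lborel) = (\<integral>r. f y r \<partial>lborel)"
    proof (rule integral_cong_AE)
      show "AE r in lborel. indicator {0..y} r *\<^sub>R F' r = f y r"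
        using AE_lborel_singleton[of y] y by (auto elim!: eventually_mono simp: f_def indicator_def)
    qed (auto simp: f_def)
    finally show ?thesis .
  qed
  have "(\<integral>y. F y - F 0 \<partial>K) = (\<integral>y. (\<integral>r. f y r \<partial>lborel) \<partial>K)"
  proof (rule integral_cong_AE)
    show "AE y in K. F y - F 0 = (\<integral>r. f y r \<partial>lborel)"
      using K(3) by eventually_elim (simp add: outer)
  qed measurable
  also have "\<dots> = (\<integral>r. F' r * measure K {r<..} * indicator {0..t} r \<partial>lborel)"
    by (subst P.Fubini_integral[OF f_int, symmetric]) (simp add: inner)
  finally have *: "(\<integral>y. F y - F 0 \<partial>K) = (\<integral>r. F' r * measure K {r<..} * indicator {0..t} r \<partial>lborel)" .
  have "bounded (F ` {0..t})"
    using F by (intro compact_imp_bounded compact_continuous_image) (auto intro: continuous_on_subset)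
  then obtain B where "\<forall>y\<in>{0..t}. norm (F y) \<le> B"
    by (auto simp: bounded_iff)
  then have "AE y in K. norm (F y) \<le> B"
    using K(3) by (elim eventually_mono) auto
  then have "integrable K F"
    by (intro K.integrable_const_bound[where B = B]) auto
  with * show "(\<integral>y. F y \<partial>K) = F 0 + (\<integral>r. F' r * measure K {r<..} * indicator {0..t} r \<partial>lborel)"
    by (simp add: K.prob_space)
qed

section \<open>The law with density p(w) T(t - w) on (0, t) and its shifts\<close>

context renewal_pair
begin

definition undershoot :: "real \<Rightarrow> real measure" where
  "undershoot t = density lborel (\<lambda>w. ennreal (p w) * emeasure N {t - w<..} * indicator {..<t} w)"

lemma sets_undershoot [measurable_cong, simp]: "sets (undershoot t) = sets borel"
  and space_undershoot [simp]: "space (undershoot t) = UNIV"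
  by (simp_all add: undershoot_def)

lemma prob_space_undershoot: "0 < t \<Longrightarrow> prob_space (undershoot t)"
  by (rule prob_spaceI) (simp add: undershoot_def emeasure_density convolution)

lemma AE_undershoot: "AE y in undershoot t. 0 < y \<and> y < t"
  unfolding undershoot_def
  by (subst AE_density)
     (auto simp: indicator_def intro!: AE_I2, metis ennreal_0 less_irrefl mult_zero_left not_le p_nonpos)

lemma AE_undershootI: "(\<And>y. 0 < y \<Longrightarrow> y < t \<Longrightarrow> Q y) \<Longrightarrow> AE y in undershoot t. Q y"
  by (rule eventually_mono[OF AE_undershoot]) auto

lemma emeasure_undershoot:
  "emeasure (undershoot t) {r<..} = (\<integral>\<^sup>+w. ennreal (p w) * emeasure N {t - w<..} * indicator {r<..<t} w \<partial>lborel)"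
  unfolding undershoot_def
  by (subst emeasure_density) (auto intro!: nn_integral_cong simp: indicator_def)

lemma measure_undershoot_measurable [measurable (raw)]:
  assumes [measurable]: "f \<in> borel_measurable M" "g \<in> borel_measurable M"
  shows "(\<lambda>x. measure (undershoot (f x)) {g x<..}) \<in> borel_measurable M"
proof -
  have "(\<lambda>x. \<integral>\<^sup>+w. ennreal (p w) * emeasure N {f x - w<..} * indicator {z. fst (fst z) < snd z \<and> snd z < snd (fst z)} ((g x, f x), w) \<partial>lborel)
      \<in> borel_measurable M"
    by measurable
  then have "(\<lambda>x. emeasure (undershoot (f x)) {g x<..}) \<in> borel_measurable M"
    unfolding emeasure_undershoot by (simp add: indicator_def)
  then show ?thesis unfolding measure_def by measurable
qed

definition shift_gap :: "real \<Rightarrow> real \<Rightarrow> real \<Rightarrow> real" where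
  "shift_gap t s r = measure (undershoot (t - s)) {r - s<..} - measure (undershoot t) {r<..}"

lemma shift_gap_measurable [measurable (raw)]:
  assumes [measurable]: "f \<in> borel_measurable M" "g \<in> borel_measurable M"
  shows "(\<lambda>x. shift_gap t (f x) (g x)) \<in> borel_measurable M"
  unfolding shift_gap_def by measurable

lemma measure_undershoot_nonpos: "0 < t \<Longrightarrow> r \<le> 0 \<Longrightarrow> measure (undershoot t) {r<..} = 1"
  using prob_space_undershoot[of t] AE_undershoot[of t]
  by (subst prob_space.prob_eq_1) (auto elim!: eventually_mono)

lemma emeasure_undershoot_shift:
  assumes "0 < s" "s < t"
  shows "emeasure (undershoot (t - s)) {r - s<..}
    = (\<integral>\<^sup>+w. ennreal (p (w - s)) * emeasure N {t - w<..} * indicator {r<..<t} w \<partial>lborel)"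
  unfolding emeasure_undershoot
  by (subst nn_integral_shift[symmetric, where s = s])
     (auto intro!: nn_integral_cong simp: indicator_def)

text \<open>Beyond r the two laws have densities p(w - s) T(t - w) and p(w) T(t - w) with the same
  factor T. Their difference is \<open>psi\<close> times T, nonnegative because p is
  non-increasing.\<close>

lemma nn_integral_psi_tail:
  assumes s: "0 < s" "s < t" "s < r"
  shows "(\<integral>\<^sup>+w. ennreal (psi r s w) * emeasure N {t - w<..} * indicator {r<..<t} w \<partial>lborel) = ennreal (shift_gap t s r)"
    and "0 \<le> shift_gap t s r"
proof -
  interpret A: prob_space "undershoot (t - s)" using s by (intro prob_space_undershoot) simp
  interpret B: prob_space "undershoot t" using s by (intro prob_space_undershoot) simp
  let ?psi = "\<integral>\<^sup>+w. ennreal (psi r s w) * emeasure N {t - w<..} * indicator {r<..<t} w \<partial>lborel"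
  have "ennreal (measure (undershoot (t - s)) {r - s<..})
      = (\<integral>\<^sup>+w. ennreal (psi r s w) * emeasure N {t - w<..} * indicator {r<..<t} w
          + ennreal (p w) * emeasure N {t - w<..} * indicator {r<..<t} w \<partial>lborel)"
    unfolding A.emeasure_eq_measure[symmetric] emeasure_undershoot_shift[OF s(1,2)] using s
    by (auto intro!: nn_integral_cong simp: indicator_def psi_def ennreal_plus[symmetric]
        distrib_right[symmetric] p_antimono p_nonneg simp del: ennreal_plus)
  also have "\<dots> = ?psi + ennreal (measure (undershoot t) {r<..})"
    unfolding B.emeasure_eq_measure[symmetric] emeasure_undershoot
    by (rule nn_integral_add) measurable
  finally have *: "ennreal (measure (undershoot (t - s)) {r - s<..}) = ?psi + ennreal (measure (undershoot t) {r<..})" .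
  have "ennreal (measure (undershoot t) {r<..}) \<le> ennreal (measure (undershoot (t - s)) {r - s<..})"
    unfolding * by simp
  then show "0 \<le> shift_gap t s r"
    by (simp add: shift_gap_def)
  show "?psi = ennreal (shift_gap t s r)"
    unfolding shift_gap_def by (subst ennreal_minus[symmetric]) (simp_all add: *)
qed

text \<open>For s \<ge> r the variable shifted by s exceeds r with probability one; for s < r the
  sign comes from the monotonicity of p.\<close>

lemma shift_gap_nonneg:
  assumes "0 < s" "s < t"
  shows "0 \<le> shift_gap t s r"
proof (cases "s < r")
  case True
  with nn_integral_psi_tail(2) assms show ?thesis by blast
next
  case False
  interpret B: prob_space "undershoot t" using assms by (intro prob_space_undershoot) simp
  from False show ?thesis
    using assms by (simp add: shift_gap_def measure_undershoot_nonpos)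
qed

text \<open>The weight T(t - w) is a mixture over z of indicators of (t - z, t), so an identity
  known on intervals ending at t extends to this weight.\<close>

lemma nn_integral_mixture:
  assumes [measurable]: "g \<in> borel_measurable borel"
  shows "(\<integral>\<^sup>+z. (\<integral>\<^sup>+w. g w * indicator {max r (t - z)<..<t} w \<partial>lborel) \<partial>N)
    = (\<integral>\<^sup>+w. g w * emeasure N {t - w<..} * indicator {r<..<t} w \<partial>lborel)"
proof -
  have eq: "g w * indicator {max r (t - z)<..<t} w
      = g w * indicator {r<..<t} w * indicator {x. t < fst x + snd x} (w, z)" for w z
    by (auto simp: indicator_def)
  have "(\<integral>\<^sup>+z. (\<integral>\<^sup>+w. g w * indicator {max r (t - z)<..<t} w \<partial>lborel) \<partial>N)
      = (\<integral>\<^sup>+w. (\<integral>\<^sup>+z. g w * indicator {r<..<t} w * indicator {x. t < fst x + snd x} (w, z) \<partial>N) \<partial>lborel)"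
    unfolding eq by (subst pair.Fubini') simp_all
  also have "\<dots> = (\<integral>\<^sup>+w. g w * emeasure N {t - w<..} * indicator {r<..<t} w \<partial>lborel)"
  proof (rule nn_integral_cong)
    fix w
    have "(\<integral>\<^sup>+z. g w * indicator {r<..<t} w * indicator {x. t < fst x + snd x} (w, z) \<partial>N)
        = g w * indicator {r<..<t} w * (\<integral>\<^sup>+z. indicator {t - w<..} z \<partial>N)"
      by (subst nn_integral_cmult[symmetric])
         (auto simp: sets_N intro!: nn_integral_cong split: split_indicator)
    then show "(\<integral>\<^sup>+z. g w * indicator {r<..<t} w * indicator {x. t < fst x + snd x} (w, z) \<partial>N)
        = g w * emeasure N {t - w<..} * indicator {r<..<t} w"
      by (simp add: sets_N ac_simps)
  qed
  finally show ?thesis .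
qed

lemma nn_integral_psi_mixture:
  assumes r: "0 < r" "r < t"
  shows "(\<integral>\<^sup>+s. (\<integral>\<^sup>+w. ennreal (psi r s w) * emeasure N {t - w<..} * indicator {r<..<t} w \<partial>lborel) \<partial>N)
    = emeasure N {r..} * emeasure (undershoot t) {r<..}"
proof -
  define G where "G w = (\<integral>\<^sup>+s. ennreal (psi r s w) \<partial>N)" for w
  have [measurable]: "G \<in> borel_measurable borel"
    unfolding G_def by measurable
  have "(\<integral>\<^sup>+s. (\<integral>\<^sup>+w. ennreal (psi r s w) * emeasure N {t - w<..} * indicator {r<..<t} w \<partial>lborel) \<partial>N)
      = (\<integral>\<^sup>+w. G w * emeasure N {t - w<..} * indicator {r<..<t} w \<partial>lborel)"
    unfolding G_def by (subst pair.Fubini') (simp_all add: nn_integral_multc)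
  \<comment> \<open>The inner integral now runs over an interval ending at t whose left end is at
    least r, as \<open>nn_integral_psi\<close> demands.\<close>
  also have "\<dots> = (\<integral>\<^sup>+z. (\<integral>\<^sup>+w. G w * indicator {max r (t - z)<..<t} w \<partial>lborel) \<partial>N)"
    by (rule nn_integral_mixture[symmetric]) measurable
  also have "\<dots> = (\<integral>\<^sup>+z. emeasure N {r..} * (\<integral>\<^sup>+w. ennreal (p w) * indicator {max r (t - z)<..<t} w \<partial>lborel) \<partial>N)"
  proof (rule nn_integral_cong_AE)
    show "AE z in N. (\<integral>\<^sup>+w. G w * indicator {max r (t - z)<..<t} w \<partial>lborel)
        = emeasure N {r..} * (\<integral>\<^sup>+w. ennreal (p w) * indicator {max r (t - z)<..<t} w \<partial>lborel)"
      using AE_N_pos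
    proof eventually_elim
      case (elim z)
      have "(\<integral>\<^sup>+w. G w * indicator {max r (t - z)<..<t} w \<partial>lborel)
          = (\<integral>\<^sup>+s. (\<integral>\<^sup>+w. ennreal (psi r s w) * indicator {max r (t - z)<..<t} w \<partial>lborel) \<partial>N)"
        unfolding G_def by (subst pair.Fubini') (simp_all add: nn_integral_multc)
      then show ?case
        using r elim by (simp add: nn_integral_psi)
    qed
  qed
  also have "\<dots> = emeasure N {r..} * (\<integral>\<^sup>+z. (\<integral>\<^sup>+w. ennreal (p w) * indicator {max r (t - z)<..<t} w \<partial>lborel) \<partial>N)"
  proof (rule nn_integral_cmult)
    have "(\<lambda>z. \<integral>\<^sup>+w. ennreal (p w) * indicator {x. r < snd x \<and> t < fst x + snd x \<and> snd x < t} (z, w) \<partial>lborel) \<in> borel_measurable N"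
      by measurable
    then show "(\<lambda>z. \<integral>\<^sup>+w. ennreal (p w) * indicator {max r (t - z)<..<t} w \<partial>lborel) \<in> borel_measurable N"
      by (simp add: indicator_def diff_less_eq add.commute)
  qed
  also have "(\<integral>\<^sup>+z. (\<integral>\<^sup>+w. ennreal (p w) * indicator {max r (t - z)<..<t} w \<partial>lborel) \<partial>N)
      = emeasure (undershoot t) {r<..}"
    by (subst nn_integral_mixture) (simp_all add: emeasure_undershoot)
  finally show ?thesis .
qed

text \<open>For s < r the gap is the integral of \<open>psi\<close> against T; for r \<le> s < t
  that integral is 1 but the gap is 1 - k, where k is the probability of exceeding r. With X the
  part s < r and m = N[r, t), the identity X + m = (m + N[t, \<infinity>)) k is rearranged to X + m
  (1 - k) = N[t, \<infinity>) k.\<close>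

lemma nn_integral_shift_gap:
  assumes r: "0 < r" "r < t"
  shows "(\<integral>\<^sup>+s. ennreal (shift_gap t s r) * indicator {0<..<t} s \<partial>N)
    = emeasure N {t..} * emeasure (undershoot t) {r<..}"
proof -
  interpret A: prob_space "undershoot t" using r by (intro prob_space_undershoot) simp
  define k where "k = measure (undershoot t) {r<..}"
  have k: "0 \<le> k" "k \<le> 1" "emeasure (undershoot t) {r<..} = ennreal k"
    by (simp_all add: k_def A.emeasure_eq_measure)
  define X where "X = (\<integral>\<^sup>+s. ennreal (shift_gap t s r) * indicator {0<..<r} s \<partial>N)"
  have fin: "emeasure N {r..<t} < \<infinity>"
    using N_Ici[OF r(1)] by (rule le_less_trans[rotated]) (auto intro!: emeasure_mono simp: sets_N)
  obtain m where m: "emeasure N {r..<t} = ennreal m" "0 \<le> m"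
    using fin by (cases "emeasure N {r..<t}") auto
  have split: "emeasure N {r..} = ennreal m + emeasure N {t..}"
    using r by (subst m(1)[symmetric], subst plus_emeasure) (auto simp: sets_N intro!: arg_cong[where f = "emeasure N"])
  have "(\<integral>\<^sup>+s. (\<integral>\<^sup>+w. ennreal (psi r s w) * emeasure N {t - w<..} * indicator {r<..<t} w \<partial>lborel) \<partial>N)
      = (\<integral>\<^sup>+s. ennreal (shift_gap t s r) * indicator {0<..<r} s + indicator {r..<t} s \<partial>N)"
  proof (rule nn_integral_cong_AE)
    show "AE s in N. (\<integral>\<^sup>+w. ennreal (psi r s w) * emeasure N {t - w<..} * indicator {r<..<t} w \<partial>lborel)
        = ennreal (shift_gap t s r) * indicator {0<..<r} s + indicator {r..<t} s"
      using AE_N_pos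
    proof eventually_elim
      case (elim s)
      consider "s < r" | "r \<le> s" "s < t" | "t \<le> s" by linarith
      then show ?case
      proof cases
        case 1
        then show ?thesis using elim r by (simp add: nn_integral_psi_tail)
      next
        case 2
        interpret B: prob_space "undershoot (t - s)" using 2 by (intro prob_space_undershoot) simp
        have "(\<integral>\<^sup>+w. ennreal (psi r s w) * emeasure N {t - w<..} * indicator {r<..<t} w \<partial>lborel)
            = emeasure (undershoot (t - s)) {r - s<..}"
          using 2 elim by (simp add: emeasure_undershoot_shift psi_def)
        also have "\<dots> = 1"
          using 2 by (simp add: B.emeasure_eq_measure measure_undershoot_nonpos)
        finally show ?thesis using 2 by simp
      next
        case 3
        have "ennreal (psi r s w) * emeasure N {t - w<..} * indicator {r<..<t} w = 0" for w
          using 3 r by (auto simp: indicator_def psi_def p_nonpos)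
        then have "(\<integral>\<^sup>+w. ennreal (psi r s w) * emeasure N {t - w<..} * indicator {r<..<t} w \<partial>lborel)
            = (\<integral>\<^sup>+(w::real). 0 \<partial>lborel)"
          by (intro nn_integral_cong)
        then show ?thesis using 3 r by simp
      qed
    qed
  qed
  also have "\<dots> = X + ennreal m"
    unfolding X_def by (subst nn_integral_add) (auto simp: sets_N m)
  finally have "X + ennreal m = (ennreal m + emeasure N {t..}) * ennreal k"
    using nn_integral_psi_mixture[OF r] split k by simp
  also have "\<dots> = ennreal (m * k) + emeasure N {t..} * ennreal k"
    using m k by (simp add: distrib_right ennreal_mult)
  also have "ennreal m = ennreal (m * k) + ennreal (m * (1 - k))"
    using m k by (subst ennreal_plus[symmetric]) (auto simp: algebra_simps mult_left_le_one_le)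
  finally have X: "X + ennreal (m * (1 - k)) = emeasure N {t..} * ennreal k"
    by (simp add: ac_simps ennreal_add_left_cancel)
  have "(\<integral>\<^sup>+s. ennreal (shift_gap t s r) * indicator {0<..<t} s \<partial>N)
      = (\<integral>\<^sup>+s. ennreal (shift_gap t s r) * indicator {0<..<r} s + ennreal (1 - k) * indicator {r..<t} s \<partial>N)"
    using r by (intro nn_integral_cong) (auto simp: indicator_def shift_gap_def measure_undershoot_nonpos k_def)
  also have "\<dots> = X + ennreal (1 - k) * ennreal m"
    unfolding X_def m(1)[symmetric] by (subst nn_integral_add) (auto simp: sets_N nn_integral_cmult_indicator)
  also have "\<dots> = emeasure N {t..} * ennreal k"
    using X m k by (simp add: ennreal_mult mult.commute)
  finally show ?thesis by (simp add: k)
qed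

lemma integral_undershoot_shift:
  fixes F F' :: "real \<Rightarrow> real"
  assumes s: "0 < s" "s < t"
    and F: "continuous_on UNIV F" "continuous_on UNIV F'"
    and deriv: "\<And>y. 0 \<le> y \<Longrightarrow> (F has_real_derivative F' y) (at y within {0..})"
    and bound: "\<And>y. \<bar>F' y\<bar> \<le> C"
  shows "(\<integral>y. F (s + y) \<partial>undershoot (t - s)) - (\<integral>y. F y \<partial>undershoot t)
    = (\<integral>r. F' r * shift_gap t s r * indicator {0..t} r \<partial>lborel)"
proof -
  have [measurable]: "F \<in> borel_measurable borel"
    using F by (auto intro: borel_measurable_continuous_onI)
  define K where "K = distr (undershoot (t - s)) borel ((+) s)"
  interpret A: prob_space "undershoot (t - s)" using s by (intro prob_space_undershoot) simp
  have K: "prob_space K" "sets K = sets borel" "AE y in K. 0 \<le> y \<and> y \<le> t"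
    unfolding K_def using s
    by (auto intro!: A.prob_space_distr AE_undershootI simp: AE_distr_iff simp del: AE_conj_iff)
  have U: "prob_space (undershoot t)" "sets (undershoot t) = sets borel" "AE y in undershoot t. 0 \<le> y \<and> y \<le> t"
    using s by (auto intro!: prob_space_undershoot AE_undershootI simp del: AE_conj_iff)
  have "measure K {r<..} = measure (undershoot (t - s)) {r - s<..}" for r
    unfolding K_def by (subst measure_distr) (auto intro!: arg_cong[where f = "measure _"])
  then have gap: "measure K {r<..} - measure (undershoot t) {r<..} = shift_gap t s r" for r
    by (simp add: shift_gap_def)
  have "(\<integral>y. F (s + y) \<partial>undershoot (t - s)) = (\<integral>y. F y \<partial>K)"
    unfolding K_def by (subst integral_distr) simp_all
  then have "(\<integral>y. F (s + y) \<partial>undershoot (t - s)) - (\<integral>y. F y \<partial>undershoot t)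
      = (\<integral>r. F' r * measure K {r<..} * indicator {0..t} r \<partial>lborel)
        - (\<integral>r. F' r * measure (undershoot t) {r<..} * indicator {0..t} r \<partial>lborel)"
    using layer_cake_derivative(2)[OF K F deriv bound] layer_cake_derivative(2)[OF U F deriv bound]
    by simp
  also have "\<dots> = (\<integral>r. F' r * measure K {r<..} * indicator {0..t} r
        - F' r * measure (undershoot t) {r<..} * indicator {0..t} r \<partial>lborel)"
    using layer_cake_derivative(1)[OF K F deriv bound] layer_cake_derivative(1)[OF U F deriv bound]
    by (rule Bochner_Integration.integral_diff[symmetric])
  also have "\<dots> = (\<integral>r. F' r * shift_gap t s r * indicator {0..t} r \<partial>lborel)"
    by (rule Bochner_Integration.integral_cong) (simp_all only: gap[symmetric] algebra_simps)
  finally show ?thesis .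
qed

text \<open>Stochastic dominance of s + H(t - s) over H(t), tested on the identity function. It is
  the source of the Lipschitz bound for q in t.\<close>

lemma mean_undershoot_diff:
  assumes s: "0 < s" "s < t"
  shows "(\<integral>y. y \<partial>undershoot t) - (\<integral>y. y \<partial>undershoot (t - s)) \<le> s"
proof -
  interpret A: prob_space "undershoot (t - s)" using s by (intro prob_space_undershoot) simp
  have "integrable (undershoot (t - s)) (\<lambda>y. y)"
    by (intro A.integrable_const_bound[where B = t] AE_undershootI) (use s in auto)
  then have "(\<integral>y. s + y \<partial>undershoot (t - s)) = s + (\<integral>y. y \<partial>undershoot (t - s))"
    using A.prob_space by simp
  moreover have "(\<integral>y. s + y \<partial>undershoot (t - s)) - (\<integral>y. y \<partial>undershoot t)
    = (\<integral>r. 1 * shift_gap t s r * indicator {0..t} r \<partial>lborel)"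
    by (rule integral_undershoot_shift[where C = 1]) (use s in \<open>auto intro!: derivative_eq_intros\<close>)
  moreover have "0 \<le> (\<integral>r. 1 * shift_gap t s r * indicator {0..t} r \<partial>lborel)"
    using s by (intro Bochner_Integration.integral_nonneg) (simp add: shift_gap_nonneg)
  ultimately show ?thesis by simp
qed

text \<open>Fubini for a signed integrand. As the gap is nonnegative, its integral over N controls
  absolute values: at most C times the tail at t for each r in (0, t). No pointwise estimate of D
  near s = 0, where N may be infinite, is required.\<close>

lemma undershoot_generator:
  fixes F F' :: "real \<Rightarrow> real"
  assumes t: "0 < t"
    and F: "continuous_on UNIV F" "continuous_on UNIV F'"
    and deriv: "\<And>y. 0 \<le> y \<Longrightarrow> (F has_real_derivative F' y) (at y within {0..})"
    and bound: "\<And>y. \<bar>F' y\<bar> \<le> C"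
  defines "D \<equiv> \<lambda>s. ((\<integral>y. F (s + y) \<partial>undershoot (t - s)) - (\<integral>y. F y \<partial>undershoot t)) * indicator {0<..<t} s"
  shows "integrable N D"
    and "(\<integral>s. D s \<partial>N) = measure N {t<..} * ((\<integral>y. F y \<partial>undershoot t) - F 0)"
proof -
  have [measurable]: "F' \<in> borel_measurable borel"
    using F by (auto intro: borel_measurable_continuous_onI)
  interpret U: prob_space "undershoot t" by (rule prob_space_undershoot[OF t])
  have U: "prob_space (undershoot t)" "sets (undershoot t) = sets borel" "AE y in undershoot t. 0 \<le> y \<and> y \<le> t"
    using t by (auto intro!: prob_space_undershoot AE_undershootI simp del: AE_conj_iff)
  define m where "m = measure N {t<..}"
  \<comment> \<open>The gap identity involves the closed half-line and the equation the open one;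
    the absence of atoms reconciles them.\<close>
  have m: "emeasure N {t..} = ennreal m" "0 \<le> m"
  proof -
    have "emeasure N {t..} = emeasure N {t} + emeasure N {t<..}"
      by (subst plus_emeasure) (auto simp: sets_N intro!: arg_cong[where f = "emeasure N"])
    then show "emeasure N {t..} = ennreal m" "0 \<le> m"
      using N_tail[OF t] by (auto simp: no_atom[OF t] m_def emeasure_eq_ennreal_measure)
  qed
  define f where "f r s = F' r * indicator {0..t} r * (shift_gap t s r * indicator {0<..<t} s)" for r s
  have f_meas [measurable]: "case_prod f \<in> borel_measurable (lborel \<Otimes>\<^sub>M N)"
    unfolding f_def by measurable
  have gap: "(\<integral>\<^sup>+s. ennreal (shift_gap t s r * indicator {0<..<t} s) \<partial>N) = ennreal (m * measure (undershoot t) {r<..})"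
    if "0 < r" "r < t" for r
  proof -
    have "(\<integral>\<^sup>+s. ennreal (shift_gap t s r * indicator {0<..<t} s) \<partial>N)
        = (\<integral>\<^sup>+s. ennreal (shift_gap t s r) * indicator {0<..<t} s \<partial>N)"
      by (intro nn_integral_cong) (auto simp: indicator_def)
    also have "\<dots> = ennreal (m * measure (undershoot t) {r<..})"
      using m that by (simp add: nn_integral_shift_gap U.emeasure_eq_measure ennreal_mult)
    finally show ?thesis .
  qed
  have gap_nonneg: "0 \<le> shift_gap t s r * indicator {0<..<t} s" for s r
    by (auto simp: indicator_def shift_gap_nonneg)
  have f_int: "integrable (lborel \<Otimes>\<^sub>M N) (case_prod f)"
  proof (rule integrableI_bounded)
    have "(\<integral>\<^sup>+x. ennreal (norm (case x of (r, s) \<Rightarrow> f r s)) \<partial>(lborel \<Otimes>\<^sub>M N))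
        = (\<integral>\<^sup>+r. (\<integral>\<^sup>+s. ennreal (norm (f r s)) \<partial>N) \<partial>lborel)"
      by (subst nn_integral_fst[symmetric]) auto
    also have "\<dots> \<le> (\<integral>\<^sup>+r. ennreal C * ennreal m * indicator {0..t} r \<partial>lborel)"
    proof (rule nn_integral_mono_AE)
      show "AE r in lborel. (\<integral>\<^sup>+s. ennreal (norm (f r s)) \<partial>N) \<le> ennreal C * ennreal m * indicator {0..t} r"
        using AE_lborel_singleton[of 0] AE_lborel_singleton[of t]
      proof eventually_elim
        case (elim r)
        show ?case
        proof (cases "0 < r \<and> r < t")
          case True
          have "(\<integral>\<^sup>+s. ennreal (norm (f r s)) \<partial>N)
              \<le> (\<integral>\<^sup>+s. ennreal C * ennreal (shift_gap t s r * indicator {0<..<t} s) \<partial>N)"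
          proof (rule nn_integral_mono)
            fix s
            have "norm (f r s) \<le> C * (shift_gap t s r * indicator {0<..<t} s)"
              using True mult_right_mono[OF bound[of r] gap_nonneg[of s r]] abs_of_nonneg[OF gap_nonneg[of s r]]
              by (auto simp: f_def abs_mult)
            moreover have "0 \<le> C" using bound[of r] by linarith
            ultimately show "ennreal (norm (f r s)) \<le> ennreal C * ennreal (shift_gap t s r * indicator {0<..<t} s)"
              by (metis ennreal_leI ennreal_mult' )
          qed
          also have "\<dots> = ennreal C * ennreal (m * measure (undershoot t) {r<..})"
            using True by (subst nn_integral_cmult) (auto simp: gap)
          also have "\<dots> \<le> ennreal C * ennreal m"
            using m by (intro mult_left_mono ennreal_leI mult_left_le) auto
          finally show ?thesis using True by simp
        next
          case False
          with elim show ?thesis by (auto simp: f_def indicator_def)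
        qed
      qed
    qed
    also have "\<dots> < \<infinity>"
      using t by (subst nn_integral_cmult_indicator) (auto simp: ennreal_mult_less_top)
    finally show "(\<integral>\<^sup>+x. ennreal (norm (case x of (r, s) \<Rightarrow> f r s)) \<partial>(lborel \<Otimes>\<^sub>M N)) < \<infinity>" .
  qed measurable
  have D: "(\<integral>r. f r s \<partial>lborel) = D s" for s
  proof (cases "0 < s \<and> s < t")
    case True
    then show ?thesis
      unfolding D_def using integral_undershoot_shift[OF _ _ F deriv bound, of s t]
      by (simp add: f_def mult_ac)
  qed (auto simp: f_def D_def indicator_def)
  show "integrable N D"
    using pair.integrable_snd[OF f_int] by (simp add: D)
  have "(\<integral>s. D s \<partial>N) = (\<integral>r. (\<integral>s. f r s \<partial>N) \<partial>lborel)"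
    using pair.Fubini_integral[OF f_int] by (simp add: D)
  also have "\<dots> = (\<integral>r. m * (F' r * measure (undershoot t) {r<..} * indicator {0..t} r) \<partial>lborel)"
  proof (rule integral_cong_AE)
    show "AE r in lborel. (\<integral>s. f r s \<partial>N) = m * (F' r * measure (undershoot t) {r<..} * indicator {0..t} r)"
      using AE_lborel_singleton[of 0] AE_lborel_singleton[of t]
    proof eventually_elim
      case (elim r)
      show ?case
      proof (cases "0 < r \<and> r < t")
        case True
        then have "(\<integral>s. shift_gap t s r * indicator {0<..<t} s \<partial>N) = m * measure (undershoot t) {r<..}"
          using gap m by (intro integral_eq_nn_integral[THEN trans]) (auto simp: gap_nonneg)
        then show ?thesis by (simp add: f_def)
      next
        case False
        with elim show ?thesis by (auto simp: f_def indicator_def)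
      qed
    qed
  qed measurable
  also have "\<dots> = m * ((\<integral>y. F y \<partial>undershoot t) - F 0)"
    using layer_cake_derivative[OF U F deriv bound] by simp
  finally show "(\<integral>s. D s \<partial>N) = measure N {t<..} * ((\<integral>y. F y \<partial>undershoot t) - F 0)"
    by (simp add: m_def)
qed

end

section \<open>The law of the undershooting\<close>

lemma AE_lborel_dense:
  fixes a b :: real
  assumes "AE x in lborel. R x" "a < b"
  shows "\<exists>x\<in>{a<..<b}. R x"
proof (rule ccontr)
  assume "\<not> ?thesis"
  then have "AE x in lborel. x \<notin> {a<..<b}"
    using assms(1) by (auto elim!: eventually_mono)
  then have "emeasure lborel {a<..<b} = 0"
    by (subst (asm) AE_iff_measurable[of "{a<..<b}"]) auto
  with assms(2) show False by simp
qed

text \<open>A monotone function has countably many discontinuities, and a nonconstant affine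
  substitution keeps them countable. The sign change makes f nondecreasing.\<close>

lemma AE_isCont_antimono:
  fixes f :: "real \<Rightarrow> real"
  assumes mono: "\<And>x y. 0 < x \<Longrightarrow> x \<le> y \<Longrightarrow> f y \<le> f x" and c: "c \<noteq> 0"
  shows "AE z in lborel. 0 < b + c * z \<longrightarrow> isCont f (b + c * z)"
proof -
  define D where "D = {y \<in> {0<..}. \<not> isCont (\<lambda>y. - f y) y}"
  have "countable D"
    unfolding D_def by (rule mono_on_ctble_discont_open) (auto intro!: mono_onI mono)
  then have "countable ((\<lambda>y. (y - b) / c) ` D)" by simp
  then have "(\<lambda>y. (y - b) / c) ` D \<in> null_sets lborel"
    by (rule countable_imp_null_set_lborel)
  then have "AE z in lborel. z \<notin> (\<lambda>y. (y - b) / c) ` D"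
    by (rule AE_not_in)
  then show ?thesis
  proof eventually_elim
    case (elim z)
    have "b + c * z \<notin> D"
      using elim c by (auto simp: image_iff)
    then have "isCont (\<lambda>y. - f y) (b + c * z)" if "0 < b + c * z"
      using that by (auto simp: D_def)
    from continuous_minus[OF this] show ?case by simp
  qed
qed

section \<open>The potential density and its Laplace transform\<close>

locale special_subordinator = subordinator Q S \<phi>
  for Q :: "'w measure" and S :: "real \<Rightarrow> 'w \<Rightarrow> real" and \<phi> :: "real \<Rightarrow> real" +
  fixes \<nu> :: "real measure" and p :: "real \<Rightarrow> real"
  assumes levy_measure: "levy_measure_of \<phi> \<nu>"
    and potential: "potential_density Q S p"
begin

text \<open>The given density is unspecified outside (0, \<infinity>); the value 0 there lets
  convolutions range over the whole line.\<close>

definition potential_fun :: "real \<Rightarrow> real" where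
  "potential_fun y = (if 0 < y then p y else 0)"

lemma potential_fun_pos: "0 < y \<Longrightarrow> 0 < potential_fun y"
  and potential_fun_antimono: "0 < x \<Longrightarrow> x \<le> y \<Longrightarrow> potential_fun y \<le> potential_fun x"
  using potential by (auto simp: potential_fun_def potential_density_def monotone_on_def)

lemma potential_fun_nonneg: "0 \<le> potential_fun y"
  using potential_fun_pos[of y] by (cases "0 < y") (auto simp: potential_fun_def)

lemma potential_fun_measurable [measurable]: "potential_fun \<in> borel_measurable borel"
proof -
  have "(\<lambda>y. - p y) \<in> borel_measurable (restrict_space borel {0<..})"
    using potential by (intro borel_measurable_mono_on_fnc) (auto simp: potential_density_def monotone_on_def)
  then have "(\<lambda>y. - (- p y)) \<in> borel_measurable (restrict_space borel {0<..})"
    by (rule borel_measurable_uminus)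
  then have "(\<lambda>y. if y \<in> {0<..} then - (- p y) else 0) \<in> borel_measurable borel"
    by (intro measurable_restrict_space_iff[THEN iffD1]) auto
  moreover have "potential_fun = (\<lambda>y. if y \<in> {0<..} then - (- p y) else 0)"
    by (auto simp: fun_eq_iff potential_fun_def)
  ultimately show ?thesis by (simp only:)
qed

lemma nn_expectation_first_passage:
  assumes "0 \<le> t"
  shows "(\<integral>\<^sup>+\<omega>. ennreal (first_passage X t \<omega>) \<partial>Q) = (\<integral>\<^sup>+y. ennreal (potential_fun y) * indicator {..<t} y \<partial>lborel)"
proof -
  have "(\<integral>\<^sup>+\<omega>. ennreal (first_passage X t \<omega>) \<partial>Q) = (\<integral>\<^sup>+y. ennreal (p y) * indicator {0<..t} y \<partial>lborel)"
    using potential assms by (simp add: potential_density_def)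
  also have "\<dots> = (\<integral>\<^sup>+y. ennreal (potential_fun y) * indicator {..<t} y \<partial>lborel)"
    using AE_lborel_singleton[of t]
    by (intro nn_integral_cong_AE) (auto elim!: eventually_mono simp: indicator_def potential_fun_def)
  finally show ?thesis .
qed

text \<open>Mesh width times the number of grid points, from index j on, at which the path is still
  below t. The choices j = 0 and j = 1 bracket the first passage time within one mesh width, and
  both have explicit Laplace transforms.\<close>

definition grid_count :: "nat \<Rightarrow> nat \<Rightarrow> real \<Rightarrow> 'w \<Rightarrow> ennreal" where
  "grid_count j n t \<omega> = (\<Sum>k. ennreal (1 / Suc n) * indicator {X_grid n (k + j) \<omega><..} t)"

lemma grid_count_measurable [measurable]: "(\<lambda>(t, \<omega>). grid_count j n t \<omega>) \<in> borel_measurable (lborel \<Otimes>\<^sub>M Q)"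
  unfolding grid_count_def indicator_def split_beta' greaterThan_iff by measurable

lemma grid_count_eq:
  assumes \<omega>: "\<omega> \<in> space Q" and t: "0 < t" and good: "S 0 \<omega> = 0" "\<exists>r\<ge>0. t < S r \<omega>"
  shows "grid_count j n t \<omega> = ennreal (real (Suc (grid_index n (first_passage X t \<omega>)) - j) / Suc n)"
    and "0 < first_passage X t \<omega>"
proof -
  have eq: "first_passage X t \<omega> = first_passage S t \<omega>"
    unfolding first_passage_def from_zero_eq good(1) diff_zero ..
  have t': "S 0 \<omega> < t" using good t by simp
  show pos: "0 < first_passage X t \<omega>"
    unfolding eq using \<omega> by (intro first_passage_pos S_cadlag S_strict_mono t' good)
  define m where "m = grid_index n (first_passage X t \<omega>)"
  have iff: "X_grid n (k + j) \<omega> < t \<longleftrightarrow> k < Suc m - j" for k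
  proof -
    have "X_grid n (k + j) \<omega> < t \<longleftrightarrow> real (k + j) / Suc n < first_passage X t \<omega>"
      unfolding eq using path_less_iff[where S = S and \<omega> = \<omega>, OF S_cadlag[OF \<omega>] S_strict_mono[OF \<omega>] t' good(2), of "real (k + j) / Suc n"] good
      by (simp add: from_zero_eq)
    also have "\<dots> \<longleftrightarrow> k + j \<le> m"
    proof
      assume "real (k + j) / Suc n < first_passage X t \<omega>"
      also have "\<dots> \<le> real (Suc m) / Suc n" using grid_index_bounds(2)[OF pos] by (simp add: m_def)
      finally show "k + j \<le> m" by (simp add: divide_less_cancel del: of_nat_add of_nat_Suc)
    next
      assume "k + j \<le> m"
      then have "real (k + j) / Suc n \<le> real m / Suc n" by (simp add: divide_right_mono)
      also have "\<dots> < first_passage X t \<omega>" using grid_index_bounds(1)[OF pos] by (simp add: m_def)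
      finally show "real (k + j) / Suc n < first_passage X t \<omega>" .
    qed
    also have "\<dots> \<longleftrightarrow> k < Suc m - j" by auto
    finally show ?thesis .
  qed
  have "grid_count j n t \<omega> = (\<Sum>k<Suc m - j. ennreal (1 / Suc n))"
    unfolding grid_count_def
    by (subst suminf_finite[of "{..<Suc m - j}"]) (auto simp: iff simp del: of_nat_add of_nat_Suc intro!: sum.cong)
  also have "\<dots> = ennreal (real (Suc m - j) / Suc n)"
    by (simp add: ennreal_of_nat_eq_real_of_nat ennreal_mult'[symmetric])
  finally show "grid_count j n t \<omega> = ennreal (real (Suc (grid_index n (first_passage X t \<omega>)) - j) / Suc n)"
    by (simp add: m_def)
qed

lemma first_passage_grid_count:
  assumes "\<omega> \<in> space Q" "0 < t" "S 0 \<omega> = 0" "\<exists>r\<ge>0. t < S r \<omega>"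
  shows "grid_count 1 n t \<omega> \<le> ennreal (first_passage X t \<omega>)" "ennreal (first_passage X t \<omega>) \<le> grid_count 0 n t \<omega>"
  using grid_index_bounds[OF grid_count_eq(2)[OF assms], of n]
  by (auto simp: grid_count_eq[OF assms] intro!: ennreal_leI)

lemma nn_integral_grid_count:
  assumes l: "0 < l"
  shows "(\<integral>\<^sup>+t. exp_law l t * (\<integral>\<^sup>+\<omega>. grid_count j n t \<omega> \<partial>Q) \<partial>lborel)
    = ennreal (exp (- (\<phi> l / Suc n)) ^ j * (1 / Suc n) / (1 - exp (- (\<phi> l / Suc n))))"
proof -
  define e where "e = exp (- (\<phi> l / Suc n))"
  have e: "0 < e" "e < 1" using expectation_exp_X_1(2)[OF l] by (auto simp: e_def)
  have meas [measurable]: "grid_count j n t \<in> borel_measurable Q" for t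
    using measurable_compose[OF measurable_Pair1' grid_count_measurable, of t j n] by simp
  have "(\<integral>\<^sup>+t. exp_law l t * (\<integral>\<^sup>+\<omega>. grid_count j n t \<omega> \<partial>Q) \<partial>lborel)
      = (\<integral>\<^sup>+t. (\<integral>\<^sup>+\<omega>. exp_law l t * grid_count j n t \<omega> \<partial>Q) \<partial>lborel)"
    by (simp add: nn_integral_cmult)
  also have "\<dots> = (\<integral>\<^sup>+\<omega>. (\<integral>\<^sup>+t. exp_law l t * grid_count j n t \<omega> \<partial>lborel) \<partial>Q)"
    by (rule lborel_pair.Fubini'[symmetric]) measurable
  also have "\<dots> = (\<integral>\<^sup>+\<omega>. (\<Sum>k. ennreal (1 / Suc n) * ennreal (exp (- (l * X_grid n (k + j) \<omega>)))) \<partial>Q)"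
  proof (rule nn_integral_cong)
    fix \<omega> assume \<omega>: "\<omega> \<in> space Q"
    have "(\<integral>\<^sup>+t. exp_law l t * grid_count j n t \<omega> \<partial>lborel)
        = (\<integral>\<^sup>+t. (\<Sum>k. ennreal (1 / Suc n) *
            (exp_law l t * indicator {X_grid n (k + j) \<omega><..} t)) \<partial>lborel)"
      unfolding grid_count_def ennreal_suminf_cmult[symmetric]
      by (intro nn_integral_cong suminf_cong) (simp only: ac_simps)
    also have "\<dots> = (\<Sum>k. ennreal (1 / Suc n) *
        (\<integral>\<^sup>+t. exp_law l t * indicator {X_grid n (k + j) \<omega><..} t \<partial>lborel))"
      by (subst nn_integral_suminf) (auto simp: nn_integral_cmult)
    also have "\<dots> = (\<Sum>k. ennreal (1 / Suc n) * ennreal (exp (- (l * X_grid n (k + j) \<omega>))))"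
      using l X_nonneg[OF \<omega>] by (subst nn_integral_exp_atLeast) auto
    finally show "(\<integral>\<^sup>+t. exp_law l t * grid_count j n t \<omega> \<partial>lborel) = \<dots>" .
  qed
  also have "\<dots> = (\<Sum>k. ennreal (1 / Suc n) * (\<integral>\<^sup>+\<omega>. ennreal (exp (- (l * X_grid n (k + j) \<omega>))) \<partial>Q))"
    by (subst nn_integral_suminf) (auto simp: nn_integral_cmult)
  also have "\<dots> = (\<Sum>k. ennreal (1 / Suc n * e ^ j * e ^ k))"
    unfolding nn_expectation_exp_X_grid[OF l] e_def[symmetric]
    using e by (intro suminf_cong) (simp add: ennreal_mult'[symmetric] power_add mult_ac)
  also have "\<dots> = ennreal (1 / Suc n * e ^ j * (1 / (1 - e)))"
    using e by (intro suminf_ennreal_eq sums_mult geometric_sums) auto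
  finally show ?thesis by (simp add: e_def mult_ac)
qed

text \<open>By Tonelli the left side is the mean of the first passage time averaged over an
  exponential level of rate l. The two grid counts bracket it by quantities that tend to 1 /
  \<phi>(l).\<close>

lemma laplace_potential:
  assumes l: "0 < l"
  shows "(\<integral>\<^sup>+y. ennreal (exp (- (l * y))) * ennreal (potential_fun y) \<partial>lborel) = ennreal (1 / \<phi> l)"
proof -
  define V where "V t = (\<integral>\<^sup>+y. ennreal (potential_fun y) * indicator {..<t} y \<partial>lborel)" for t
  define w where "w t = exp_law l t" for t
  have w_meas [measurable]: "w \<in> borel_measurable borel" unfolding w_def by measurable
  have V_ind: "V t = (\<integral>\<^sup>+y. ennreal (potential_fun y) * indicator {z. fst z < snd z} (y, t) \<partial>lborel)" for t
    unfolding V_def by (intro nn_integral_cong) (simp add: indicator_def)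
  have pair: "pair_sigma_finite (lborel :: real measure) (lborel :: real measure)" ..
  have "(\<integral>\<^sup>+t. w t * V t \<partial>lborel)
      = (\<integral>\<^sup>+t. (\<integral>\<^sup>+y. w t * (ennreal (potential_fun y) * indicator {z. fst z < snd z} (y, t)) \<partial>lborel) \<partial>lborel)"
    unfolding V_ind by (simp add: nn_integral_cmult)
  also have "\<dots> = (\<integral>\<^sup>+y. (\<integral>\<^sup>+t. w t * (ennreal (potential_fun y) * indicator {z. fst z < snd z} (y, t)) \<partial>lborel) \<partial>lborel)"
    by (rule pair_sigma_finite.Fubini'[OF pair]) measurable
  also have "\<dots> = (\<integral>\<^sup>+y. ennreal (exp (- (l * y))) * ennreal (potential_fun y) \<partial>lborel)"
  proof (rule nn_integral_cong)
    fix y :: real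
    show "(\<integral>\<^sup>+t. w t * (ennreal (potential_fun y) * indicator {z. fst z < snd z} (y, t)) \<partial>lborel)
        = ennreal (exp (- (l * y))) * ennreal (potential_fun y)"
    proof (cases "0 \<le> y")
      case True
      have "(\<integral>\<^sup>+t. w t * (ennreal (potential_fun y) * indicator {z. fst z < snd z} (y, t)) \<partial>lborel)
          = (\<integral>\<^sup>+t. ennreal (potential_fun y) * (exp_law l t * indicator {y<..} t) \<partial>lborel)"
        by (intro nn_integral_cong) (auto simp: w_def indicator_def mult_ac)
      also have "\<dots> = ennreal (potential_fun y) * ennreal (exp (- (l * y)))"
        using nn_integral_exp_atLeast[OF l True] by (subst nn_integral_cmult) auto
      finally show ?thesis by (simp add: mult.commute)
    qed (simp add: potential_fun_def)
  qed
  finally have I: "(\<integral>\<^sup>+y. ennreal (exp (- (l * y))) * ennreal (potential_fun y) \<partial>lborel) = (\<integral>\<^sup>+t. w t * V t \<partial>lborel)"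
    by simp
  have V: "V t = (\<integral>\<^sup>+\<omega>. ennreal (first_passage X t \<omega>) \<partial>Q)" if "0 < t" for t
    using that by (simp add: V_def nn_expectation_first_passage)
  have low: "ennreal (exp (- (\<phi> l / Suc n)) ^ 1 * (1 / Suc n) / (1 - exp (- (\<phi> l / Suc n)))) \<le> (\<integral>\<^sup>+t. w t * V t \<partial>lborel)" for n
    unfolding nn_integral_grid_count[OF l, symmetric]
  proof (rule nn_integral_mono)
    fix t
    have "(\<integral>\<^sup>+\<omega>. grid_count 1 n t \<omega> \<partial>Q) \<le> V t" if t: "0 < t"
      unfolding V[OF t]
    proof (rule nn_integral_mono_AE)
      show "AE \<omega> in Q. grid_count 1 n t \<omega> \<le> ennreal (first_passage X t \<omega>)"
        using AE_unbounded AE_space by eventually_elim (use t first_passage_grid_count in blast)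
    qed
    then show "exp_law l t * (\<integral>\<^sup>+\<omega>. grid_count 1 n t \<omega> \<partial>Q) \<le> w t * V t"
      by (cases "0 < t") (auto simp: w_def intro!: mult_left_mono)
  qed
  have up: "(\<integral>\<^sup>+t. w t * V t \<partial>lborel) \<le> ennreal (exp (- (\<phi> l / Suc n)) ^ 0 * (1 / Suc n) / (1 - exp (- (\<phi> l / Suc n))))" for n
    unfolding nn_integral_grid_count[OF l, symmetric]
  proof (rule nn_integral_mono)
    fix t
    have "V t \<le> (\<integral>\<^sup>+\<omega>. grid_count 0 n t \<omega> \<partial>Q)" if t: "0 < t"
      unfolding V[OF t]
    proof (rule nn_integral_mono_AE)
      show "AE \<omega> in Q. ennreal (first_passage X t \<omega>) \<le> grid_count 0 n t \<omega>"
        using AE_unbounded AE_space by eventually_elim (use t first_passage_grid_count in blast)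
    qed
    then show "w t * V t \<le> exp_law l t * (\<integral>\<^sup>+\<omega>. grid_count 0 n t \<omega> \<partial>Q)"
      by (cases "0 < t") (auto simp: w_def intro!: mult_left_mono)
  qed
  have lim: "(\<lambda>n. exp (- (c / Suc n)) ^ j * (1 / Suc n) / (1 - exp (- (c / Suc n)))) \<longlonglongrightarrow> 1 / c" if "0 < c" "j = 0 \<or> j = 1" for c :: real and j :: nat
  proof -
    have 0: "(\<lambda>n. (1 / Suc n) / (1 - exp (- (c / Suc n)))) \<longlonglongrightarrow> 1 * inverse c"
      using that by real_asymp
    have 1: "(\<lambda>n. exp (- (c / Suc n))) \<longlonglongrightarrow> 1"
      by real_asymp
    from tendsto_mult[OF tendsto_power[OF 1, of j] 0] show ?thesis
      by (simp add: divide_inverse mult.assoc)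
  qed
  have "(\<integral>\<^sup>+t. w t * V t \<partial>lborel) = ennreal (1 / \<phi> l)"
  proof (rule antisym)
    show "(\<integral>\<^sup>+t. w t * V t \<partial>lborel) \<le> ennreal (1 / \<phi> l)"
      using up lim[OF expectation_exp_X_1(2)[OF l], of 0]
      by (intro LIMSEQ_le_const[OF tendsto_ennrealI]) auto
    show "ennreal (1 / \<phi> l) \<le> (\<integral>\<^sup>+t. w t * V t \<partial>lborel)"
      using low lim[OF expectation_exp_X_1(2)[OF l], of 1]
      by (intro LIMSEQ_le_const2[OF tendsto_ennrealI]) auto
  qed
  with I show ?thesis by simp
qed

text \<open>\<open>\<nu>\<close> lives on the Borel sets of (0, \<infinity>); its image under
  inclusion is a Borel measure on the line, which combines directly with
  \<open>lborel\<close>.\<close>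

definition N :: "real measure" where
  "N = distr \<nu> borel (\<lambda>x. x)"

lemma sets_levy: "sets \<nu> = sets (restrict_space borel {0<..})"
  and levy_min: "(\<integral>\<^sup>+t. ennreal (min 1 t) \<partial>\<nu>) < \<infinity>"
  and levy_infinite: "emeasure \<nu> {0<..} = \<infinity>"
  and exponent_levy: "0 < l \<Longrightarrow> \<phi> l = (\<integral>t. 1 - exp (- l * t) \<partial>\<nu>)"
  using levy_measure by (simp_all add: levy_measure_of_def)

lemma space_levy: "space \<nu> = {0<..}"
  using sets_eq_imp_space_eq[OF sets_levy] by (simp add: space_restrict_space)

lemma measurable_levy: "(\<lambda>x. x) \<in> measurable \<nu> borel"
  by (subst measurable_cong_sets[OF sets_levy refl]) (rule measurable_restrict_space1, simp)

lemma measurable_levy': "f \<in> measurable borel K \<Longrightarrow> f \<in> measurable \<nu> K"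
  by (rule measurable_compose[OF measurable_levy])

lemma emeasure_N: "A \<in> sets borel \<Longrightarrow> A \<subseteq> {0<..} \<Longrightarrow> emeasure N A = emeasure \<nu> A"
  unfolding N_def by (subst emeasure_distr) (auto simp: space_levy intro: measurable_levy intro!: arg_cong[where f = "emeasure \<nu>"])

sublocale tail_measure N
proof
  show "sets N = sets borel" by (simp add: N_def)
  have "{..0} \<inter> {0<..} = ({} :: real set)" by auto
  then show "emeasure N {..0} = 0"
    unfolding N_def by (subst emeasure_distr) (auto simp: space_levy intro: measurable_levy)
  fix t :: real assume t: "0 < t"
  have "ennreal (min 1 t) * emeasure \<nu> {t<..} = (\<integral>\<^sup>+s. ennreal (min 1 t) * indicator {t<..} s \<partial>\<nu>)"
  proof (subst nn_integral_cmult_indicator)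
    show "{t<..} \<in> sets \<nu>" using t by (auto simp: sets_levy sets_restrict_space image_iff intro!: bexI[of _ "{t<..}"])
  qed simp
  also have "\<dots> \<le> (\<integral>\<^sup>+s. ennreal (min 1 s) \<partial>\<nu>)"
    by (intro nn_integral_mono) (auto simp: indicator_def intro!: ennreal_leI)
  also have "\<dots> < \<infinity>" by (rule levy_min)
  finally have "emeasure \<nu> {t<..} < \<infinity>"
    using t by (auto simp: ennreal_mult_eq_top_iff less_top[symmetric] min_def split: if_splits)
  then show "emeasure N {t<..} < \<infinity>"
    using t by (simp add: emeasure_N subset_eq)
qed

lemma tail_eq_ennreal: "0 < t \<Longrightarrow> emeasure N {t<..} = ennreal (measure N {t<..})"
  using N_tail by (intro emeasure_eq_ennreal_measure) (simp add: less_top)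

text \<open>1 - exp(-l s) is l times the integral of exp(-l z) over (0, s); exchanging the integrals
  turns the exponent into the transform of the tail.\<close>

lemma laplace_tail:
  assumes l: "0 < l"
  shows "(\<integral>\<^sup>+z. exp_weight l z * emeasure N {z<..} \<partial>lborel) = ennreal (\<phi> l / l)"
proof -
  have int: "integrable \<nu> (\<lambda>t. 1 - exp (- l * t))"
  proof (rule integrableI_bounded)
    have "(\<integral>\<^sup>+t. ennreal (norm (1 - exp (- l * t))) \<partial>\<nu>) \<le> (\<integral>\<^sup>+t. ennreal (max 1 l) * ennreal (min 1 t) \<partial>\<nu>)"
    proof (rule nn_integral_mono)
      fix t assume "t \<in> space \<nu>"
      then have t: "0 < t" by (simp add: space_levy)
      \<comment> \<open>The constant max 1 l covers both regimes of min 1 t: 1 - exp(-l t) is at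
        most l t, used for t \<le> 1, and at most 1.\<close>
      define M where "M = max 1 l"
      have M: "1 \<le> M" "l \<le> M" by (auto simp: M_def)
      have "1 - exp (- l * t) \<le> l * t" using exp_ge_add_one_self[of "- l * t"] by simp
      moreover have "l * t \<le> M * t" using t M by (intro mult_right_mono) auto
      moreover have "1 - exp (- l * t) \<le> M" using M(1) exp_gt_zero[of "- l * t"] by linarith
      ultimately have "1 - exp (- l * t) \<le> max 1 l * min 1 t"
        unfolding M_def[symmetric] by (cases "t \<le> 1") simp_all
      moreover have "0 \<le> 1 - exp (- l * t)" using l t by simp
      ultimately show "ennreal (norm (1 - exp (- l * t))) \<le> ennreal (max 1 l) * ennreal (min 1 t)"
        using t by (subst ennreal_mult[symmetric]) (auto intro!: ennreal_leI)
    qed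
    also have "\<dots> = ennreal (max 1 l) * (\<integral>\<^sup>+t. ennreal (min 1 t) \<partial>\<nu>)"
      by (rule nn_integral_cmult) (rule measurable_levy', measurable)
    also have "\<dots> < \<infinity>" using levy_min by (auto simp: ennreal_mult_less_top)
    finally show "(\<integral>\<^sup>+t. ennreal (norm (1 - exp (- l * t))) \<partial>\<nu>) < \<infinity>" .
  qed (rule measurable_levy', measurable)
  have eq: "exp_weight l z * indicator {z<..} s
      = exp_weight l z * indicator {x. fst x < snd x} (z, s)" for z s
    by (simp add: indicator_def)
  have "(\<integral>\<^sup>+z. exp_weight l z * emeasure N {z<..} \<partial>lborel)
      = (\<integral>\<^sup>+z. (\<integral>\<^sup>+s. exp_weight l z * indicator {x. fst x < snd x} (z, s) \<partial>N) \<partial>lborel)"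
  proof (rule nn_integral_cong)
    fix z :: real
    have "(\<integral>\<^sup>+s. indicator {x. fst x < snd x} (z, s) \<partial>N) = emeasure N {z<..}"
      unfolding tail_eq_nn_integral by (intro nn_integral_cong) (simp add: indicator_def)
    then show "exp_weight l z * emeasure N {z<..}
        = (\<integral>\<^sup>+s. exp_weight l z * indicator {x. fst x < snd x} (z, s) \<partial>N)"
      by (subst nn_integral_cmult) auto
  qed
  also have "\<dots> = (\<integral>\<^sup>+s. (\<integral>\<^sup>+z. exp_weight l z * indicator {x. fst x < snd x} (z, s) \<partial>lborel) \<partial>N)"
    by (rule pair.Fubini'[symmetric]) measurable
  also have "\<dots> = (\<integral>\<^sup>+s. ennreal ((1 - exp (- l * s)) / l) \<partial>N)"
  proof (rule nn_integral_cong_AE)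
    show "AE s in N. (\<integral>\<^sup>+z. exp_weight l z * indicator {x. fst x < snd x} (z, s) \<partial>lborel)
        = ennreal ((1 - exp (- l * s)) / l)"
      using AE_N_pos
    proof eventually_elim
      case (elim s)
      have "(\<integral>\<^sup>+z. exp_weight l z * indicator {x. fst x < snd x} (z, s) \<partial>lborel)
          = (\<integral>\<^sup>+z. exp_weight l z * indicator {0<..s} z \<partial>lborel)"
        using AE_lborel_singleton[of s]
        by (intro nn_integral_cong_AE) (auto elim!: eventually_mono simp: indicator_def)
      then show ?case using nn_integral_exp_interval[OF l, of 0 s] elim by simp
    qed
  qed
  also have "\<dots> = (\<integral>\<^sup>+s. ennreal ((1 - exp (- l * s)) / l) \<partial>\<nu>)"
    unfolding N_def by (subst nn_integral_distr) (auto intro: measurable_levy)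
  also have "\<dots> = ennreal (\<integral>s. (1 - exp (- l * s)) / l \<partial>\<nu>)"
    using int l by (intro nn_integral_eq_integral) (auto simp: space_levy intro!: AE_I2)
  also have "\<dots> = ennreal (\<phi> l / l)"
    using l by (simp add: exponent_levy)
  finally show ?thesis .
qed

section \<open>Identification of the law of H(t)\<close>

definition renewal_conv :: "real \<Rightarrow> real \<Rightarrow> ennreal" where
  "renewal_conv a t = (\<integral>\<^sup>+y. ennreal (exp (- (a * y))) * ennreal (potential_fun y) * emeasure N {t - y<..} * indicator {..<t} y \<partial>lborel)"

lemma renewal_conv_measurable [measurable]: "renewal_conv a \<in> borel_measurable borel"
proof -
  have "(\<lambda>t. \<integral>\<^sup>+y. ennreal (exp (- (a * y))) * ennreal (potential_fun y) * emeasure N {t - y<..} * indicator {z. snd z < fst z} (t, y) \<partial>lborel) \<in> borel_measurable borel"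
    by measurable
  then show ?thesis by (simp add: renewal_conv_def[abs_def] indicator_def)
qed

text \<open>Convolution theorem: exp(-a y) p(y) has transform 1 / \<phi>(l + a) and the tail has
  transform \<phi>(l) / l. The product is the double transform already found for H.\<close>

lemma laplace_renewal_conv:
  assumes l: "0 < l" and a: "0 \<le> a"
  shows "(\<integral>\<^sup>+t. exp_weight l t * renewal_conv a t \<partial>lborel) = ennreal (\<phi> l / (l * \<phi> (l + a)))"
proof -
  define f where "f t y = ennreal (exp (- (l * t))) * (ennreal (exp (- (a * y))) * ennreal (potential_fun y) * emeasure N {t - y<..}
      * indicator {z. snd z < fst z} (t, y))" for t y
  have f_meas: "(\<lambda>(t, y). f t y) \<in> borel_measurable (lborel \<Otimes>\<^sub>M lborel)"
    unfolding f_def by measurable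
  have pair: "pair_sigma_finite (lborel :: real measure) (lborel :: real measure)" ..
  have "(\<integral>\<^sup>+t. exp_weight l t * renewal_conv a t \<partial>lborel) = (\<integral>\<^sup>+t. (\<integral>\<^sup>+y. f t y \<partial>lborel) \<partial>lborel)"
  proof (rule nn_integral_cong)
    fix t :: real
    have "ennreal (exp (- (l * t))) * renewal_conv a t = (\<integral>\<^sup>+y. f t y \<partial>lborel)"
      unfolding renewal_conv_def f_def by (subst nn_integral_cmult) (auto simp: indicator_def)
    moreover have "renewal_conv a t = 0" if "t \<le> 0"
    proof -
      have "renewal_conv a t = (\<integral>\<^sup>+(y::real). 0 \<partial>lborel)"
        unfolding renewal_conv_def using that
        by (intro nn_integral_cong) (auto simp: potential_fun_def indicator_def)
      then show ?thesis by simp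
    qed
    ultimately show "exp_weight l t * renewal_conv a t = (\<integral>\<^sup>+y. f t y \<partial>lborel)"
      by (cases "0 < t") (auto simp: indicator_def)
  qed
  also have "\<dots> = (\<integral>\<^sup>+y. (\<integral>\<^sup>+t. f t y \<partial>lborel) \<partial>lborel)"
    by (rule pair_sigma_finite.Fubini'[OF pair, symmetric]) (use f_meas in measurable)
  also have "\<dots> = (\<integral>\<^sup>+y. (ennreal (exp (- ((l + a) * y))) * ennreal (potential_fun y)) * ennreal (\<phi> l / l) \<partial>lborel)"
  proof (rule nn_integral_cong)
    fix y :: real
    have "(\<integral>\<^sup>+t. f t y \<partial>lborel) = (\<integral>\<^sup>+z. f (y + z) y \<partial>lborel)"
      using nn_integral_real_affine[of "\<lambda>t. f t y" 1 y] measurable_compose[OF _ f_meas, of "\<lambda>t. (t, y)" borel]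
      by simp
    also have "\<dots> = (\<integral>\<^sup>+z. ennreal (exp (- ((l + a) * y))) * ennreal (potential_fun y) *
        (exp_weight l z * emeasure N {z<..}) \<partial>lborel)"
    proof (rule nn_integral_cong)
      fix z :: real
      have "ennreal (exp (- (l * (y + z)))) * ennreal (exp (- (a * y))) = ennreal (exp (- ((l + a) * y))) * ennreal (exp (- (l * z)))"
        by (simp add: ennreal_mult'[symmetric] exp_add[symmetric] algebra_simps)
      then show "f (y + z) y = ennreal (exp (- ((l + a) * y))) * ennreal (potential_fun y) *
        (exp_weight l z * emeasure N {z<..})"
        unfolding f_def by (simp add: mult.assoc[symmetric] indicator_def) (simp add: mult_ac)
    qed
    also have "\<dots> = ennreal (exp (- ((l + a) * y))) * ennreal (potential_fun y) * ennreal (\<phi> l / l)"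
      by (subst nn_integral_cmult) (auto simp: laplace_tail[OF l])
    finally show "(\<integral>\<^sup>+t. f t y \<partial>lborel) = ennreal (exp (- ((l + a) * y))) * ennreal (potential_fun y) * ennreal (\<phi> l / l)" .
  qed
  also have "\<dots> = ennreal (1 / \<phi> (l + a)) * ennreal (\<phi> l / l)"
    using a l by (subst nn_integral_multc) (auto simp: laplace_potential)
  also have "\<dots> = ennreal (\<phi> l / (l * \<phi> (l + a)))"
    using expectation_exp_X_1(2)[of "l + a"] a l by (subst ennreal_mult'[symmetric]) (auto simp: mult.commute)
  finally show ?thesis .
qed

lemma potential_integrable: "(\<integral>\<^sup>+y. ennreal (potential_fun y) * indicator {..<t} y \<partial>lborel) < \<infinity>"
proof -
  have "ennreal (exp (- (1 * t))) * (\<integral>\<^sup>+y. ennreal (potential_fun y) * indicator {..<t} y \<partial>lborel)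
      = (\<integral>\<^sup>+y. ennreal (exp (- (1 * t))) * (ennreal (potential_fun y) * indicator {..<t} y) \<partial>lborel)"
    by (rule nn_integral_cmult[symmetric]) measurable
  also have "\<dots> \<le> (\<integral>\<^sup>+y. ennreal (exp (- (1 * y))) * ennreal (potential_fun y) \<partial>lborel)"
    by (intro nn_integral_mono) (auto simp: indicator_def intro!: mult_right_mono ennreal_leI)
  also have "\<dots> < \<infinity>" by (simp only: laplace_potential zero_less_one) simp
  finally show ?thesis
    by (auto simp: ennreal_mult_eq_top_iff less_top[symmetric])
qed

lemma tail_integrable: "(\<integral>\<^sup>+z. emeasure N {z<..} * indicator {0<..<t} z \<partial>lborel) < \<infinity>"
proof -
  have "ennreal (exp (- (1 * t))) * (\<integral>\<^sup>+z. emeasure N {z<..} * indicator {0<..<t} z \<partial>lborel)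
      = (\<integral>\<^sup>+z. ennreal (exp (- (1 * t))) * (emeasure N {z<..} * indicator {0<..<t} z) \<partial>lborel)"
    by (rule nn_integral_cmult[symmetric]) measurable
  also have "\<dots> \<le> (\<integral>\<^sup>+z. exp_weight 1 z * emeasure N {z<..} \<partial>lborel)"
    by (intro nn_integral_mono) (auto simp: indicator_def intro!: mult_right_mono ennreal_leI)
  also have "\<dots> < \<infinity>" by (simp only: laplace_tail zero_less_one) simp
  finally show ?thesis
    by (auto simp: ennreal_mult_eq_top_iff less_top[symmetric])
qed

text \<open>The transform gives finiteness for almost every t only. Splitting at t/2 gives it for
  every t: on each half one factor is bounded by its value at t/2 and the other is
  integrable.\<close>

lemma renewal_conv_0_finite:
  assumes t: "0 < t"
  shows "renewal_conv 0 t < \<infinity>"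
proof -
  have "renewal_conv 0 t \<le> (\<integral>\<^sup>+y. emeasure N {t / 2<..} * (ennreal (potential_fun y) * indicator {..<t} y)
      + ennreal (potential_fun (t / 2)) * (emeasure N {t - y<..} * indicator {0<..<t} (t - y)) \<partial>lborel)"
    unfolding renewal_conv_def
  proof (rule nn_integral_mono)
    fix y :: real
    show "ennreal (exp (- (0 * y))) * ennreal (potential_fun y) * emeasure N {t - y<..} * indicator {..<t} y
      \<le> emeasure N {t / 2<..} * (ennreal (potential_fun y) * indicator {..<t} y)
        + ennreal (potential_fun (t / 2)) * (emeasure N {t - y<..} * indicator {0<..<t} (t - y))"
    proof (cases "0 < y \<and> y < t")
      case True
      show ?thesis
      proof (cases "y \<le> t / 2")
        case True
        then have "emeasure N {t - y<..} \<le> emeasure N {t / 2<..}"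
          by (intro emeasure_mono) (auto simp: sets_N)
        then show ?thesis
          using True t by (intro add_increasing2) (auto simp: mult.commute intro!: mult_left_mono)
      next
        case False
        then have "ennreal (potential_fun y) \<le> ennreal (potential_fun (t / 2))"
          using t by (intro ennreal_leI potential_fun_antimono) auto
        then show ?thesis
          using \<open>0 < y \<and> y < t\<close> by (intro add_increasing) (auto intro!: mult_right_mono)
      qed
    qed (auto simp: potential_fun_def indicator_def)
  qed
  also have "\<dots> = emeasure N {t / 2<..} * (\<integral>\<^sup>+y. ennreal (potential_fun y) * indicator {..<t} y \<partial>lborel)
      + ennreal (potential_fun (t / 2)) * (\<integral>\<^sup>+y. emeasure N {t - y<..} * indicator {0<..<t} (t - y) \<partial>lborel)"
    by (subst nn_integral_add) (auto simp: nn_integral_cmult)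
  also have "(\<integral>\<^sup>+y. emeasure N {t - y<..} * indicator {0<..<t} (t - y) \<partial>lborel)
      = (\<integral>\<^sup>+z. emeasure N {z<..} * indicator {0<..<t} z \<partial>lborel)"
    by (subst (2) nn_integral_real_affine[where c = "-1" and t = t]) auto
  also have "emeasure N {t / 2<..} * (\<integral>\<^sup>+y. ennreal (potential_fun y) * indicator {..<t} y \<partial>lborel)
      + ennreal (potential_fun (t / 2)) * (\<integral>\<^sup>+z. emeasure N {z<..} * indicator {0<..<t} z \<partial>lborel) < \<infinity>"
    using N_tail[of "t / 2"] potential_integrable[of t] tail_integrable[of t] t
    by (simp add: ennreal_mult_less_top)
  finally show ?thesis .
qed

text \<open>The substitution y = t z fixes the domain of integration, so that t enters through the
  integrand alone and dominated convergence can give continuity in t.\<close>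

lemma renewal_conv_scaled:
  assumes t: "0 < t"
  shows "renewal_conv a t = (\<integral>\<^sup>+z. ennreal (t * (exp (- (a * (t * z))) * potential_fun (t * z) * measure N {t * (1 - z)<..})) * indicator {0<..<1} z \<partial>lborel)"
proof -
  have "renewal_conv a t = ennreal t * (\<integral>\<^sup>+z. ennreal (exp (- (a * (t * z)))) * ennreal (potential_fun (t * z))
      * emeasure N {t - t * z<..} * indicator {..<t} (t * z) \<partial>lborel)"
    unfolding renewal_conv_def using t by (subst nn_integral_real_affine[where c = t and t = 0]) auto
  also have "\<dots> = (\<integral>\<^sup>+z. ennreal t * (ennreal (exp (- (a * (t * z)))) * ennreal (potential_fun (t * z))
      * emeasure N {t - t * z<..} * indicator {..<t} (t * z)) \<partial>lborel)"
    by (rule nn_integral_cmult[symmetric]) measurable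
  also have "\<dots> = (\<integral>\<^sup>+z. ennreal (t * (exp (- (a * (t * z))) * potential_fun (t * z) * measure N {t * (1 - z)<..})) * indicator {0<..<1} z \<partial>lborel)"
  proof (rule nn_integral_cong)
    fix z :: real
    show "ennreal t * (ennreal (exp (- (a * (t * z)))) * ennreal (potential_fun (t * z))
        * emeasure N {t - t * z<..} * indicator {..<t} (t * z))
      = ennreal (t * (exp (- (a * (t * z))) * potential_fun (t * z) * measure N {t * (1 - z)<..})) * indicator {0<..<1} z"
    proof (cases "0 < z \<and> z < 1")
      case True
      then have "0 < t * (1 - z)" "t - t * z = t * (1 - z)" using t by (auto simp: algebra_simps)
      then show ?thesis
        using True t tail_eq_ennreal[of "t * (1 - z)"]
        by (simp add: ennreal_mult' potential_fun_nonneg mult.assoc)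
    next
      case False
      then have "potential_fun (t * z) = 0 \<or> \<not> t * z < t"
        using t by (auto simp: potential_fun_def zero_less_mult_iff)
      with False show ?thesis by (auto simp: indicator_def)
    qed
  qed
  finally show ?thesis .
qed

text \<open>p and T are monotone, so the rescaled integrand converges for almost every z. It is
  dominated through the integrand at t/2 with a = 0; the factor 4 comes from s n \<le> 2 t = 4
  (t/2).\<close>

lemma renewal_conv_tendsto:
  assumes t: "0 < t" and s: "\<And>n. t / 2 \<le> s n" "\<And>n. s n \<le> 2 * t" "s \<longlonglongrightarrow> t" and a: "0 \<le> a"
  shows "(\<lambda>n. renewal_conv a (s n)) \<longlonglongrightarrow> renewal_conv a t"
proof -
  have s0: "0 < s n" for n using s(1)[of n] t by linarith
  define f where "f t z = t * (exp (- (a * (t * z))) * potential_fun (t * z) * measure N {t * (1 - z)<..})" for t z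
  have tail_meas [measurable]: "(\<lambda>z. measure N {c * (1 - z)<..}) \<in> borel_measurable borel" for c :: real
    unfolding measure_def by measurable
  have f_meas [measurable]: "f c \<in> borel_measurable borel" for c
    unfolding f_def by measurable
  have tail_mono: "measure N {y<..} \<le> measure N {x<..}" if "0 < x" "x \<le> y" for x y
    using N_tail[OF that(1)] that by (intro measure_mono_fmeasurable) (auto simp: fmeasurable_def sets_N)
  have c1: "AE z in lborel. 0 < 0 + t * z \<longrightarrow> isCont potential_fun (0 + t * z)"
    by (rule AE_isCont_antimono) (use t in \<open>auto intro: potential_fun_antimono\<close>)
  have c2: "AE z in lborel. 0 < t + - t * z \<longrightarrow> isCont (\<lambda>z. measure N {z<..}) (t + - t * z)"
    by (rule AE_isCont_antimono) (use t in \<open>auto intro: tail_mono\<close>)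
  have "(\<lambda>n. \<integral>\<^sup>+z. ennreal (f (s n) z) * indicator {0<..<1} z \<partial>lborel) \<longlonglongrightarrow> (\<integral>\<^sup>+z. ennreal (f t z) * indicator {0<..<1} z \<partial>lborel)"
  proof (rule nn_integral_dominated_convergence)
    define g where "g z = t / 2 * (exp (- (0 * (t / 2 * z))) * potential_fun (t / 2 * z) * measure N {t / 2 * (1 - z)<..})" for z
    let ?w = "\<lambda>z. ennreal 4 * (ennreal (g z) * indicator {0<..<1} z)"
    have g_meas [measurable]: "g \<in> borel_measurable borel"
      unfolding g_def by measurable
    show "?w \<in> borel_measurable lborel" by measurable
    have "(\<integral>\<^sup>+z. ?w z \<partial>lborel) = ennreal 4 * (\<integral>\<^sup>+z. ennreal (g z) * indicator {0<..<1} z \<partial>lborel)"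
      by (rule nn_integral_cmult) measurable
    also have "(\<integral>\<^sup>+z. ennreal (g z) * indicator {0<..<1} z \<partial>lborel) = renewal_conv 0 (t / 2)"
      unfolding g_def using t by (subst renewal_conv_scaled) auto
    finally show "(\<integral>\<^sup>+z. ?w z \<partial>lborel) < \<infinity>"
      using renewal_conv_0_finite[of "t / 2"] t by (simp add: ennreal_mult_less_top)
    show "AE z in lborel. ennreal (f (s n) z) * indicator {0<..<1} z \<le> ?w z" for n
    proof (rule AE_I2)
      fix z :: real
      show "ennreal (f (s n) z) * indicator {0<..<1} z \<le> ?w z"
      proof (cases "0 < z \<and> z < 1")
        case True
        have "potential_fun (s n * z) \<le> potential_fun (t / 2 * z)"
          using True t s(1)[of n] by (intro potential_fun_antimono mult_right_mono) auto
        moreover have "measure N {s n * (1 - z)<..} \<le> measure N {t / 2 * (1 - z)<..}"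
          using True t s(1)[of n] by (intro tail_mono mult_right_mono) auto
        moreover have "exp (- (a * (s n * z))) \<le> 1" using True a s0[of n] by simp
        ultimately have "f (s n) z \<le> (2 * t) * (1 * potential_fun (t / 2 * z) * measure N {t / 2 * (1 - z)<..})"
          unfolding f_def using s(2)[of n] t s0[of n]
          by (intro mult_mono mult_nonneg_nonneg) (auto simp: potential_fun_nonneg)
        also have "\<dots> = 4 * g z" by (simp add: g_def)
        finally have "ennreal (f (s n) z) \<le> ennreal (4 * g z)" by (rule ennreal_leI)
        also have "\<dots> = ennreal 4 * ennreal (g z)" by (rule ennreal_mult') simp
        finally show ?thesis using True by simp
      qed auto
    qed
    show "AE z in lborel. (\<lambda>n. ennreal (f (s n) z) * indicator {0<..<1} z) \<longlonglongrightarrow> ennreal (f t z) * indicator {0<..<1} z"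
      using c1 c2
    proof eventually_elim
      case (elim z)
      show ?case
      proof (cases "0 < z \<and> z < 1")
        case True
        have "isCont potential_fun (t * z)" using elim(1) True t by simp
        then have 1: "(\<lambda>n. potential_fun (s n * z)) \<longlonglongrightarrow> potential_fun (t * z)"
          by (rule isCont_tendsto_compose) (intro tendsto_intros s)
        have "t + - t * z = t * (1 - z)" by (simp add: algebra_simps)
        moreover have "0 < t * (1 - z)" using True t by simp
        ultimately have "isCont (\<lambda>z. measure N {z<..}) (t * (1 - z))"
          using elim(2) t by (metis less_irrefl neg_equal_0_iff_equal)
        then have 2: "(\<lambda>n. measure N {s n * (1 - z)<..}) \<longlonglongrightarrow> measure N {t * (1 - z)<..}"
          by (rule isCont_tendsto_compose) (intro tendsto_intros s)
        have "(\<lambda>n. f (s n) z) \<longlonglongrightarrow> f t z"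
          unfolding f_def by (intro tendsto_intros s 1 2)
        then show ?thesis using True by (simp add: tendsto_ennrealI)
      qed auto
    qed
  qed measurable
  then show ?thesis
    using t s0 by (simp add: renewal_conv_scaled f_def)
qed

text \<open>Equal transforms give equality for almost every t. At an arbitrary t, points of equality
  are chosen on either side: \<open>laplace_H\<close> is antitone and \<open>renewal_conv\<close>
  continuous, so the limits from the left and from the right give the two inequalities.\<close>

lemma laplace_H_eq:
  assumes a: "0 \<le> a" and t: "0 < t"
  shows "laplace_H a t = renewal_conv a t"
proof -
  \<comment> \<open>The factor exp(-t) makes the densities integrable; their exponential moments of
    order k are the Laplace transforms at k + 1 > 0.\<close>
  define F where "F t = exp_weight 1 t * laplace_H a t" for t
  define G where "G t = exp_weight 1 t * renewal_conv a t" for t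
  have F_meas [measurable]: "F \<in> borel_measurable borel"
    unfolding F_def using laplace_H_measurable[OF a, of 1] by simp
  have G_meas [measurable]: "G \<in> borel_measurable borel"
    unfolding G_def by measurable
  have shift: "exp_weight 1 t * c * ennreal (exp (- (real k * t)))
      = exp_weight (real (Suc k)) t * c" for k c and t :: real
  proof -
    have "ennreal (exp (- (1 * t))) * ennreal (exp (- (real k * t))) = ennreal (exp (- (real (Suc k) * t)))"
      by (simp add: ennreal_mult'[symmetric] exp_add[symmetric] algebra_simps)
    moreover have "exp_weight 1 t * c * ennreal (exp (- (real k * t)))
        = (ennreal (exp (- (1 * t))) * ennreal (exp (- (real k * t)))) * indicator {0<..} t * c"
      by (simp only: mult_ac)
    ultimately show ?thesis by simp
  qed
  have F: "(\<integral>\<^sup>+t. F t * ennreal (exp (- (real k * t))) \<partial>lborel) = ennreal (\<phi> (Suc k) / (real (Suc k) * \<phi> (real (Suc k) + a)))" for k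
    unfolding F_def shift by (rule nn_integral_laplace_H) (use a in auto)
  have G: "(\<integral>\<^sup>+t. G t * ennreal (exp (- (real k * t))) \<partial>lborel) = ennreal (\<phi> (Suc k) / (real (Suc k) * \<phi> (real (Suc k) + a)))" for k
    unfolding G_def shift by (rule laplace_renewal_conv) (use a in auto)
  have fin: "finite_measure (density lborel K)" "AE x in density lborel K. 0 \<le> x"
    if K [measurable]: "K \<in> borel_measurable borel" and "(\<integral>\<^sup>+t. K t * ennreal (exp (- (real 0 * t))) \<partial>lborel) < \<infinity>" "\<And>t. t \<le> 0 \<Longrightarrow> K t = 0"
    for K :: "real \<Rightarrow> ennreal"
  proof -
    show "finite_measure (density lborel K)"
      using that by (intro finite_measureI) (simp add: emeasure_density)
    show "AE x in density lborel K. 0 \<le> x"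
    proof (subst AE_density)
      show "AE x in lborel. 0 < K x \<longrightarrow> 0 \<le> x"
        using that(3) by (intro AE_I2) (metis less_irrefl linear)
    qed measurable
  qed
  have "density lborel F = density lborel G"
  proof (rule finite_measure_eqI_exp)
    show "finite_measure (density lborel F)" "AE x in density lborel F. 0 \<le> x"
      using F[of 0] by (intro fin, simp_all add: F_def)+
    show "finite_measure (density lborel G)" "AE x in density lborel G. 0 \<le> x"
      using G[of 0] by (intro fin, simp_all add: G_def)+
    have "(\<integral>x. exp (- (real k * x)) \<partial>density lborel K) = enn2real (\<integral>\<^sup>+t. K t * ennreal (exp (- (real k * t))) \<partial>lborel)"
      if [measurable]: "K \<in> borel_measurable borel" for K and k :: nat
      by (subst integral_eq_nn_integral) (auto simp: nn_integral_density)
    then show "(\<integral>x. exp (- (real k * x)) \<partial>density lborel F) = (\<integral>x. exp (- (real k * x)) \<partial>density lborel G)" for k :: nat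
      by (simp add: F G del: of_nat_Suc)
  qed simp_all
  then have AE: "AE t in lborel. F t = G t"
    by (subst (asm) sigma_finite_measure.density_unique_iff[OF lborel.sigma_finite_measure_axioms]) auto
  have dense: "\<exists>r\<in>{b<..<c}. laplace_H a r = renewal_conv a r" if bc: "0 \<le> b" "b < c" for b c
  proof -
    obtain r where "r \<in> {b<..<c}" "F r = G r" using AE_lborel_dense[OF AE bc(2)] by blast
    then show ?thesis
      using bc by (intro bexI[of _ r]) (auto simp: F_def G_def ennreal_mult_cancel_left)
  qed
  \<comment> \<open>The offsets t/(n+2) are at most t/2, which keeps the approximating times inside
    [t/2, 2t].\<close>
  have conv: "(\<lambda>n. t + c / real (n + 2)) \<longlonglongrightarrow> t" for c by real_asymp
  have bound: "0 \<le> t / real (n + 2)" "t / real (n + 2) \<le> t / 2" for n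
  proof -
    show "t / real (n + 2) \<le> t / 2" by (rule frac_le) (use t in simp_all)
  qed (use t in simp)
  show ?thesis
  proof (rule antisym)
    have "\<exists>s. t - t / real (n + 2) < s \<and> s < t \<and> laplace_H a s = renewal_conv a s" for n
    proof -
      have "0 \<le> t - t / real (n + 2)" using bound(2)[of n] t by linarith
      moreover have "t - t / real (n + 2) < t" using t by simp
      ultimately obtain r where "r \<in> {t - t / real (n + 2)<..<t}" "laplace_H a r = renewal_conv a r"
        using dense by blast
      then show ?thesis by (intro exI[of _ r]) simp
    qed
    then obtain s where s: "\<And>n. t - t / real (n + 2) < s n" "\<And>n. s n < t" "\<And>n. laplace_H a (s n) = renewal_conv a (s n)"
      by metis
    have "s \<longlonglongrightarrow> t"
    proof (rule tendsto_sandwich[OF _ _ conv[of "- t"] tendsto_const])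
      show "\<forall>\<^sub>F n in sequentially. t + - t / real (n + 2) \<le> s n"
        using less_imp_le[OF s(1)] by (intro always_eventually allI) simp
      show "\<forall>\<^sub>F n in sequentially. s n \<le> t"
        using less_imp_le[OF s(2)] by (intro always_eventually allI)
    qed
    moreover have "t / 2 \<le> s n" for n using s(1)[of n] bound(2)[of n] by linarith
    moreover have "s n \<le> 2 * t" for n using s(2)[of n] t by linarith
    ultimately have lim: "(\<lambda>n. renewal_conv a (s n)) \<longlonglongrightarrow> renewal_conv a t"
      using t a by (intro renewal_conv_tendsto)
    show "laplace_H a t \<le> renewal_conv a t"
    proof (rule LIMSEQ_le_const[OF lim], intro exI allI impI)
      fix n
      have "0 < s n" using \<open>t / 2 \<le> s n\<close> t by linarith
      then show "laplace_H a t \<le> renewal_conv a (s n)"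
        using s(2)[of n] a by (subst s(3)[symmetric]) (intro laplace_H_antimono, auto)
    qed
  next
    have "\<exists>s. t < s \<and> s < t + t / real (n + 2) \<and> laplace_H a s = renewal_conv a s" for n
    proof -
      have "t < t + t / real (n + 2)" using t by simp
      with less_imp_le[OF t] obtain r where "r \<in> {t<..<t + t / real (n + 2)}" "laplace_H a r = renewal_conv a r"
        using dense by blast
      then show ?thesis by (intro exI[of _ r]) simp
    qed
    then obtain s where s: "\<And>n. t < s n" "\<And>n. s n < t + t / real (n + 2)" "\<And>n. laplace_H a (s n) = renewal_conv a (s n)"
      by metis
    have "s \<longlonglongrightarrow> t"
    proof (rule tendsto_sandwich[OF _ _ tendsto_const conv[of t]])
      show "\<forall>\<^sub>F n in sequentially. t \<le> s n"
        using less_imp_le[OF s(1)] by (intro always_eventually allI)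
      show "\<forall>\<^sub>F n in sequentially. s n \<le> t + t / real (n + 2)"
        using less_imp_le[OF s(2)] by (intro always_eventually allI)
    qed
    moreover have "t / 2 \<le> s n" for n using s(1)[of n] t by linarith
    moreover have "s n \<le> 2 * t" for n using s(2)[of n] bound(2)[of n] t by linarith
    ultimately have lim: "(\<lambda>n. renewal_conv a (s n)) \<longlonglongrightarrow> renewal_conv a t"
      using t a by (intro renewal_conv_tendsto)
    show "renewal_conv a t \<le> laplace_H a t"
    proof (rule LIMSEQ_le_const2[OF lim], intro exI allI impI)
      fix n
      show "renewal_conv a (s n) \<le> laplace_H a t"
        using s(1)[of n] a t by (subst s(3)[symmetric]) (intro laplace_H_antimono, auto)
    qed
  qed
qed

sublocale renewal_pair N potential_fun
proof
  show "(\<integral>\<^sup>+y. ennreal (potential_fun y) * indicator {..<t} y \<partial>lborel) < \<infinity>" for t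
    by (rule potential_integrable)
  fix t :: real assume "0 < t"
  \<comment> \<open>For a = 0 the transform of H(t) is a total probability, so p * T = 1 is a
    special case of the identification.\<close>
  then have "renewal_conv 0 t = 1"
    using laplace_H_eq[of 0 t] by (simp add: laplace_H_def emeasure_space_1)
  then show "(\<integral>\<^sup>+y. ennreal (potential_fun y) * emeasure N {t - y<..} * indicator {..<t} y \<partial>lborel) = 1"
    by (simp add: renewal_conv_def)
qed (auto simp: potential_fun_pos potential_fun_antimono, simp add: potential_fun_def)

lemma distr_H:
  assumes t: "0 < t"
  shows "distr Q borel (H t) = undershoot t"
proof (rule finite_measure_eqI_exp)
  interpret D: prob_space "distr Q borel (H t)" by (rule prob_space_distr) simp
  interpret U: prob_space "undershoot t" by (rule prob_space_undershoot[OF t])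
  show "finite_measure (distr Q borel (H t))" "finite_measure (undershoot t)"
    by (rule D.finite_measure_axioms U.finite_measure_axioms)+
  show "AE x in distr Q borel (H t). 0 \<le> x"
    by (subst AE_distr_iff) (auto simp: H_nonneg intro!: AE_I2)
  show "AE x in undershoot t. 0 \<le> x"
    by (rule AE_undershootI) simp
  show "(\<integral>x. exp (- (real k * x)) \<partial>distr Q borel (H t)) = (\<integral>x. exp (- (real k * x)) \<partial>undershoot t)" for k :: nat
  proof -
    have "(\<integral>x. exp (- (real k * x)) \<partial>distr Q borel (H t)) = enn2real (laplace_H k t)"
      by (subst integral_distr) (auto simp: integral_eq_nn_integral laplace_H_def)
    also have "\<dots> = enn2real (renewal_conv k t)" using t by (simp add: laplace_H_eq)
    also have "renewal_conv k t = (\<integral>\<^sup>+x. ennreal (exp (- (real k * x))) \<partial>undershoot t)"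
      unfolding undershoot_def renewal_conv_def
      by (subst nn_integral_density) (auto intro!: nn_integral_cong simp: mult_ac)
    also have "enn2real \<dots> = (\<integral>x. exp (- (real k * x)) \<partial>undershoot t)"
      by (subst integral_eq_nn_integral) auto
    finally show ?thesis .
  qed
qed simp_all

end

section \<open>Feller semigroups\<close>

lemma C0_D: "u \<in> C0 \<Longrightarrow> 0 < e \<Longrightarrow> \<exists>K. compact K \<and> (\<forall>x. x \<notin> K \<longrightarrow> \<bar>u x\<bar> < e)"
  and C0_continuous: "u \<in> C0 \<Longrightarrow> continuous_on UNIV u"
  by (auto simp: C0_def)

lemma C0_bounded:
  assumes "u \<in> C0"
  obtains B where "0 \<le> B" "\<And>x. \<bar>u x\<bar> \<le> B"
proof -
  obtain K where K: "compact K" "\<And>x. x \<notin> K \<Longrightarrow> \<bar>u x\<bar> < 1"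
    using C0_D[OF assms, of 1] by auto
  have "bounded (u ` K)"
    using K(1) C0_continuous[OF assms]
    by (intro compact_imp_bounded compact_continuous_image) (auto intro: continuous_on_subset)
  then obtain B where B: "\<forall>x\<in>K. \<bar>u x\<bar> \<le> B"
    by (auto simp: bounded_iff)
  have "\<bar>u x\<bar> \<le> max 1 B" for x
    using K(2)[of x] B by (cases "x \<in> K") force+
  then show thesis by (intro that[of "max 1 B"]) auto
qed

text \<open>One closure principle for linear combinations and positive parts; the linear bound
  transfers the decay at infinity.\<close>

lemma C0_comp:
  assumes u: "u \<in> C0" and w: "w \<in> C0"
    and cont: "continuous_on UNIV (\<lambda>x. f (u x) (w x))"
    and bound: "\<And>x. \<bar>f (u x) (w x)\<bar> \<le> c * (\<bar>u x\<bar> + \<bar>w x\<bar>)"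
  shows "(\<lambda>x. f (u x) (w x)) \<in> C0"
  unfolding C0_def
proof (intro CollectI conjI allI impI cont)
  fix e :: real assume e: "0 < e"
  define k where "k = \<bar>c\<bar> + 1"
  have k: "0 < k" by (simp add: k_def)
  define d where "d = e / (2 * k)"
  have d: "0 < d" using e k by (simp add: d_def)
  obtain K1 where K1: "compact K1" "\<And>x. x \<notin> K1 \<Longrightarrow> \<bar>u x\<bar> < d" using C0_D[OF u d] by auto
  obtain K2 where K2: "compact K2" "\<And>x. x \<notin> K2 \<Longrightarrow> \<bar>w x\<bar> < d" using C0_D[OF w d] by auto
  have "\<bar>f (u x) (w x)\<bar> < e" if "x \<notin> K1 \<union> K2" for x
  proof -
    have "\<bar>f (u x) (w x)\<bar> \<le> k * (\<bar>u x\<bar> + \<bar>w x\<bar>)"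
      by (rule order_trans[OF bound]) (simp add: k_def mult_right_mono)
    also have "\<dots> < k * (d + d)"
      using K1(2)[of x] K2(2)[of x] that k by (intro mult_strict_left_mono add_strict_mono) auto
    also have "\<dots> = e" using k by (simp add: d_def field_simps)
    finally show ?thesis .
  qed
  with K1(1) K2(1) show "\<exists>K. compact K \<and> (\<forall>x. x \<notin> K \<longrightarrow> \<bar>f (u x) (w x)\<bar> < e)"
    by (intro exI[of _ "K1 \<union> K2"]) auto
qed

lemma C0_lincomb:
  assumes "u \<in> C0" "w \<in> C0"
  shows "(\<lambda>x. a * u x + b * w x) \<in> C0"
proof (rule C0_comp[OF assms, where c = "\<bar>a\<bar> + \<bar>b\<bar>"])
  show "continuous_on UNIV (\<lambda>x. a * u x + b * w x)"
    using assms by (intro continuous_intros) (auto simp: C0_def)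
  fix x
  have "\<bar>a * u x + b * w x\<bar> \<le> \<bar>a\<bar> * \<bar>u x\<bar> + \<bar>b\<bar> * \<bar>w x\<bar>"
    by (metis abs_mult abs_triangle_ineq)
  also have "\<dots> \<le> (\<bar>a\<bar> + \<bar>b\<bar>) * (\<bar>u x\<bar> + \<bar>w x\<bar>)"
    by (simp add: algebra_simps)
  finally show "\<bar>a * u x + b * w x\<bar> \<le> (\<bar>a\<bar> + \<bar>b\<bar>) * (\<bar>u x\<bar> + \<bar>w x\<bar>)" .
qed

lemma C0_diff: "u \<in> C0 \<Longrightarrow> w \<in> C0 \<Longrightarrow> (\<lambda>x. u x - w x) \<in> C0"
  using C0_lincomb[of u w 1 "-1"] by simp

lemma C0_zero: "(\<lambda>x. 0) \<in> C0"
  by (auto simp: C0_def)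

lemma C0_cmult: "u \<in> C0 \<Longrightarrow> (\<lambda>x. a * u x) \<in> C0"
  using C0_lincomb[of u u a 0] by simp

lemma C0_sum: "(\<And>i. i \<in> I \<Longrightarrow> w i \<in> C0) \<Longrightarrow> (\<lambda>x. \<Sum>i\<in>I. c i * w i x) \<in> C0"
proof (induction I rule: infinite_finite_induct)
  case (insert i I)
  then show ?case
    using C0_lincomb[of "w i" "\<lambda>x. \<Sum>i\<in>I. c i * w i x" "c i" 1] by simp
qed (simp_all add: C0_zero)

lemma C0_max: "u \<in> C0 \<Longrightarrow> (\<lambda>x. max 0 (u x)) \<in> C0"
  by (rule C0_comp[where w = u and c = 1 and f = "\<lambda>a b. max 0 a"])
     (auto intro!: continuous_intros simp: C0_continuous)

lemma C0_uniform_limit: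
  assumes "\<And>e. 0 < e \<Longrightarrow> \<exists>w\<in>C0. \<forall>x. \<bar>u x - w x\<bar> \<le> e"
  shows "u \<in> C0"
  unfolding C0_def
proof (intro CollectI conjI allI impI)
  have "\<forall>n. \<exists>w. w \<in> C0 \<and> (\<forall>x. \<bar>u x - w x\<bar> \<le> 1 / real (Suc n))"
    using assms by (metis of_nat_0_less_iff zero_less_Suc zero_less_divide_1_iff)
  then obtain w where w: "\<And>n. w n \<in> C0" "\<And>n x. \<bar>u x - w n x\<bar> \<le> 1 / real (Suc n)"
    by metis
  have "uniform_limit UNIV w u sequentially"
    unfolding uniform_limit_iff
  proof (intro allI impI)
    fix e :: real assume "0 < e"
    have "(\<lambda>n. 1 / real (Suc n)) \<longlonglongrightarrow> 0" by real_asymp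
    from order_tendstoD(2)[OF this \<open>0 < e\<close>]
    show "\<forall>\<^sub>F n in sequentially. \<forall>x\<in>UNIV. dist (w n x) (u x) < e"
      by eventually_elim (metis dist_commute dist_real_def le_less_trans w(2))
  qed
  then show "continuous_on UNIV u"
    by (intro uniform_limit_theorem[where f = w]) (auto simp: C0_continuous w)
  fix e :: real assume "0 < e"
  then obtain w where w: "w \<in> C0" "\<And>x. \<bar>u x - w x\<bar> \<le> e / 2" using assms[of "e / 2"] by auto
  obtain K where K: "compact K" "\<And>x. x \<notin> K \<Longrightarrow> \<bar>w x\<bar> < e / 2" using C0_D[OF w(1), of "e / 2"] \<open>0 < e\<close> by auto
  show "\<exists>K. compact K \<and> (\<forall>x. x \<notin> K \<longrightarrow> \<bar>u x\<bar> < e)"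
  proof (intro exI[of _ K] conjI allI impI K)
    fix x assume "x \<notin> K"
    then show "\<bar>u x\<bar> < e" using K(2)[of x] w(2)[of x] by linarith
  qed
qed

section \<open>Contractivity, strong continuity and orbits of the semigroup\<close>

locale feller =
  fixes P :: "real \<Rightarrow> ('e::t2_space \<Rightarrow> real) \<Rightarrow> 'e \<Rightarrow> real"
  assumes feller: "feller_semigroup P"
begin

lemma P_C0: "0 \<le> t \<Longrightarrow> u \<in> C0 \<Longrightarrow> P t u \<in> C0"
  using feller[unfolded feller_semigroup_def, THEN conjunct1] by blast

lemma P_lincomb:
  "0 \<le> t \<Longrightarrow> u \<in> C0 \<Longrightarrow> w \<in> C0 \<Longrightarrow> P t (\<lambda>y. a * u y + b * w y) x = a * P t u x + b * P t w x"
  using feller[unfolded feller_semigroup_def, THEN conjunct2, THEN conjunct1] by blast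

lemma P_unit:
  "0 \<le> t \<Longrightarrow> u \<in> C0 \<Longrightarrow> (\<And>x. 0 \<le> u x \<and> u x \<le> 1) \<Longrightarrow> 0 \<le> P t u x \<and> P t u x \<le> 1"
  using feller[unfolded feller_semigroup_def, THEN conjunct2, THEN conjunct2, THEN conjunct1] by blast

lemma P_0: "u \<in> C0 \<Longrightarrow> P 0 u = u"
  using feller[unfolded feller_semigroup_def, THEN conjunct2, THEN conjunct2, THEN conjunct2, THEN conjunct1] by blast

lemma P_add: "0 \<le> s \<Longrightarrow> 0 \<le> t \<Longrightarrow> u \<in> C0 \<Longrightarrow> P (s + t) u = P s (P t u)"
  using feller[unfolded feller_semigroup_def, THEN conjunct2, THEN conjunct2, THEN conjunct2, THEN conjunct2, THEN conjunct1] by blast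

lemma P_limit: "u \<in> C0 \<Longrightarrow> uniform_limit UNIV (\<lambda>t. P t u) u (at_right 0)"
  using feller unfolding feller_semigroup_def by simp

lemma P_diff: "0 \<le> t \<Longrightarrow> u \<in> C0 \<Longrightarrow> w \<in> C0 \<Longrightarrow> P t (\<lambda>y. u y - w y) x = P t u x - P t w x"
  using P_lincomb[of t u w 1 "-1" x] by simp

lemma P_cmult: "0 \<le> t \<Longrightarrow> u \<in> C0 \<Longrightarrow> P t (\<lambda>y. a * u y) x = a * P t u x"
  using P_lincomb[of t u u a 0 x] by simp

lemma P_sum:
  assumes "0 \<le> t" "\<And>i. i \<in> I \<Longrightarrow> w i \<in> C0"
  shows "P t (\<lambda>y. \<Sum>i\<in>I. c i * w i y) x = (\<Sum>i\<in>I. c i * P t (w i) x)"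
  using assms(2)
proof (induction I rule: infinite_finite_induct)
  case (insert i I)
  then show ?case
    using P_lincomb[OF assms(1), of "w i" "\<lambda>x. \<Sum>i\<in>I. c i * w i x" "c i" 1 x] by (simp add: C0_sum)
qed (use P_cmult[OF assms(1) C0_zero, of 0 x] in simp_all)

lemma P_bounds:
  assumes "0 \<le> t" "u \<in> C0" "0 < m" "\<And>x. 0 \<le> u x \<and> u x \<le> m"
  shows "0 \<le> P t u x \<and> P t u x \<le> m"
proof -
  have "0 \<le> P t (\<lambda>y. (1 / m) * u y) x \<and> P t (\<lambda>y. (1 / m) * u y) x \<le> 1"
    using assms by (intro P_unit C0_cmult) auto
  then show ?thesis
    using assms by (subst (asm) (1 2) P_cmult) (auto simp: field_simps)
qed

text \<open>Constants need not lie in \<open>C0\<close>, so positivity cannot be applied to m - u.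
  Instead u is split into its parts: the image of the positive part is at most m, and that of the
  negative part is nonnegative.\<close>

lemma P_le:
  assumes t: "0 \<le> t" and u: "u \<in> C0" and m: "0 < m" "\<And>x. u x \<le> m"
  shows "P t u x \<le> m"
proof -
  have n: "(\<lambda>x. - 1 * u x) \<in> C0" by (rule C0_cmult[OF u])
  obtain B where B: "0 \<le> B" "\<And>x. \<bar>u x\<bar> \<le> B" by (rule C0_bounded[OF u]) auto
  have "0 \<le> P t (\<lambda>x. max 0 (u x)) x \<and> P t (\<lambda>x. max 0 (u x)) x \<le> m"
    using m by (intro P_bounds t C0_max u) (auto simp: less_imp_le)
  \<comment> \<open>\<open>P_bounds\<close> asks for a strictly positive bound, hence B + 1.\<close>
  moreover have "0 \<le> P t (\<lambda>x. max 0 (- 1 * u x)) x \<and> P t (\<lambda>x. max 0 (- 1 * u x)) x \<le> B + 1"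
    using B(1) abs_le_D2[OF B(2)] by (intro P_bounds t C0_max n) (auto simp: add_increasing2)
  moreover have "u = (\<lambda>x. max 0 (u x) - max 0 (- 1 * u x))"
    by (auto simp: fun_eq_iff max_def)
  then have "P t u x = P t (\<lambda>x. max 0 (u x)) x - P t (\<lambda>x. max 0 (- 1 * u x)) x"
    using P_diff[OF t C0_max[OF u] C0_max[OF n]] by metis
  ultimately show ?thesis by linarith
qed

lemma P_abs_le:
  assumes t: "0 \<le> t" and u: "u \<in> C0" and B: "\<And>x. \<bar>u x\<bar> \<le> B"
  shows "\<bar>P t u x\<bar> \<le> B"
proof (rule field_le_epsilon)
  fix e :: real assume e: "0 < e"
  have "0 \<le> B" using B[of x] by linarith
  then have m: "0 < B + e" using e by simp
  have "P t u x \<le> B + e"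
    using e by (intro P_le t u m) (smt (verit) B)
  moreover have "P t (\<lambda>x. - 1 * u x) x \<le> B + e"
    using e by (intro P_le t C0_cmult u m) (smt (verit) B)
  ultimately show "\<bar>P t u x\<bar> \<le> B + e"
    using P_cmult[OF t u, of "- 1" x] by linarith
qed

lemma P_abs_diff_le:
  assumes t: "0 \<le> t" and u: "u \<in> C0" "w \<in> C0" and B: "\<And>x. \<bar>u x - w x\<bar> \<le> B"
  shows "\<bar>P t u x - P t w x\<bar> \<le> B"
  using P_abs_le[OF t C0_diff[OF u] B] P_diff[OF t u] by simp

text \<open>Strong continuity at time 0 is transported to later times by the semigroup law and
  contractivity, so d depends neither on the times nor on x.\<close>

lemma P_uniformly_continuous:
  assumes u: "u \<in> C0" and e: "0 < e"
  obtains d where "0 < d" "\<And>a b x. 0 \<le> a \<Longrightarrow> 0 \<le> b \<Longrightarrow> \<bar>a - b\<bar> < d \<Longrightarrow> \<bar>P a u x - P b u x\<bar> \<le> e"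
proof -
  have "\<forall>\<^sub>F t in at_right 0. \<forall>x\<in>UNIV. dist (P t u x) (u x) < e"
    using P_limit[OF u] e by (auto simp: uniform_limit_iff)
  then obtain d where d: "0 < d" "\<And>t x. 0 < t \<Longrightarrow> t < d \<Longrightarrow> \<bar>P t u x - u x\<bar> < e"
    by (auto simp: eventually_at_right_field dist_real_def)
  have "\<bar>P b u x - P a u x\<bar> \<le> e" if "0 \<le> a" "a < b" "b - a < d" for a b x
  proof -
    have "P b u = P a (P (b - a) u)" using P_add[of a "b - a" u] that u by simp
    moreover have "\<bar>P a (P (b - a) u) x - P a u x\<bar> \<le> e"
      using that u d(2)[of "b - a"] by (intro P_abs_diff_le P_C0) (auto intro: less_imp_le)
    ultimately show ?thesis by simp
  qed
  note * = this
  have "\<bar>P a u x - P b u x\<bar> \<le> e" if "0 \<le> a" "0 \<le> b" "\<bar>a - b\<bar> < d" for a b x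
    using *[of a b x] *[of b a x] that e by (cases a b rule: linorder_cases) auto
  with d(1) show thesis by (rule that)
qed

text \<open>\<open>max 0 y\<close> extends the orbit constantly to negative times, where P is
  unspecified, because the layer-cake formula asks for functions continuous on the whole
  line.\<close>

lemma P_continuous:
  assumes u: "u \<in> C0"
  shows "continuous_on UNIV (\<lambda>y. P (max 0 y) u x)"
  unfolding continuous_on_iff
proof (intro ballI allI impI)
  fix y e :: real assume "0 < e"
  then obtain d where d: "0 < d" "\<And>a b x. 0 \<le> a \<Longrightarrow> 0 \<le> b \<Longrightarrow> \<bar>a - b\<bar> < d \<Longrightarrow> \<bar>P a u x - P b u x\<bar> \<le> e / 2"
    using P_uniformly_continuous[OF u, of "e / 2"] by auto
  have "dist (P (max 0 z) u x) (P (max 0 y) u x) < e" if "dist z y < d" for z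
  proof -
    have "\<bar>max 0 z - max 0 y\<bar> < d" using that by (auto simp: dist_real_def max_def)
    from d(2)[OF _ _ this, of x] \<open>0 < e\<close> show ?thesis by (simp add: dist_real_def)
  qed
  with d(1) show "\<exists>d>0. \<forall>z\<in>UNIV. dist z y < d \<longrightarrow> dist (P (max 0 z) u x) (P (max 0 y) u x) < e"
    by blast
qed

text \<open>A difference quotient over an interval is the image, under P at its left end, of the
  quotient at time 0. For increments to the left of y that end is z and not y; strong continuity on
  g bridges the two.\<close>

lemma P_derivative:
  assumes gen: "generates P u g" and y: "0 \<le> y"
  shows "((\<lambda>y. P (max 0 y) u x) has_real_derivative P (max 0 y) g x) (at y within {0..})"
  unfolding has_field_derivative_iff Lim_within
proof (intro allI impI)
  have u: "u \<in> C0" and g: "g \<in> C0" using gen unfolding generates_def by blast+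
  fix e :: real assume e: "0 < e"
  have "\<forall>\<^sub>F t in at_right 0. \<forall>x\<in>UNIV. dist ((P t u x - u x) / t) (g x) < e / 3"
    using gen e unfolding generates_def uniform_limit_iff by (elim conjE allE[of _ "e / 3"]) simp
  then obtain d1 where d1: "0 < d1" "\<And>t x. 0 < t \<Longrightarrow> t < d1 \<Longrightarrow> \<bar>(P t u x - u x) / t - g x\<bar> < e / 3"
    by (auto simp: eventually_at_right_field dist_real_def)
  obtain d2 where d2: "0 < d2" "\<And>a b x. 0 \<le> a \<Longrightarrow> 0 \<le> b \<Longrightarrow> \<bar>a - b\<bar> < d2 \<Longrightarrow> \<bar>P a g x - P b g x\<bar> \<le> e / 3"
    using P_uniformly_continuous[OF g, of "e / 3"] e by auto
  have *: "\<bar>(P (a + h) u x - P a u x) / h - P a g x\<bar> \<le> e / 3" if "0 \<le> a" "0 < h" "h < d1" for a h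
  proof -
    have quot: "(\<lambda>x. (1 / h) * P h u x + (- 1 / h) * u x) \<in> C0"
      using that u by (intro C0_lincomb P_C0) auto
    have "\<bar>P a (\<lambda>x. (1 / h) * P h u x + (- 1 / h) * u x) x - P a g x\<bar> \<le> e / 3"
      using that d1(2)[of h] by (intro P_abs_diff_le quot g)
        (auto intro!: less_imp_le simp: diff_divide_distrib)
    moreover have "P a (\<lambda>x. (1 / h) * P h u x + (- 1 / h) * u x) x = (1 / h) * P a (P h u) x + (- 1 / h) * P a u x"
      using that u by (intro P_lincomb P_C0) auto
    moreover have "P a (P h u) = P (a + h) u" using P_add[of a h u] that u by simp
    ultimately show ?thesis by (simp add: diff_divide_distrib)
  qed
  have "dist ((P (max 0 z) u x - P (max 0 y) u x) / (z - y)) (P (max 0 y) g x) < e"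
    if z: "0 \<le> z" "0 < dist z y" "dist z y < min d1 d2" for z
  proof (cases "y < z")
    case True
    then show ?thesis using *[of y "z - y"] z y e by (simp add: dist_real_def max_def)
  next
    case False
    then have "z < y" using z by (simp add: dist_real_def)
    define Q where "Q = (P z u x - P y u x) / (z - y)"
    have "Q = (P y u x - P z u x) / (y - z)"
      unfolding Q_def by (metis minus_diff_eq minus_divide_divide)
    then have "\<bar>Q - P z g x\<bar> \<le> e / 3"
      using *[of z "y - z"] \<open>z < y\<close> z by (simp add: dist_real_def)
    moreover have "\<bar>P z g x - P y g x\<bar> \<le> e / 3"
      using z y by (intro d2(2)) (auto simp: dist_real_def)
    ultimately have "\<bar>Q - P y g x\<bar> < e" using e by linarith
    then show ?thesis using z y by (simp add: dist_real_def Q_def)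
  qed
  then show "\<exists>d>0. \<forall>z\<in>{0..}. 0 < dist z y \<and> dist z y < d \<longrightarrow>
      dist ((P (max 0 z) u x - P (max 0 y) u x) / (z - y)) (P (max 0 y) g x) < e"
    using d1(1) d2(1) by (intro exI[of _ "min d1 d2"]) auto
qed

lemma P_lipschitz:
  assumes gen: "generates P u g" and C: "\<And>x. \<bar>g x\<bar> \<le> C" and y: "0 \<le> a" "0 \<le> b"
  shows "\<bar>P a u x - P b u x\<bar> \<le> C * \<bar>a - b\<bar>"
proof -
  have g: "g \<in> C0" using gen unfolding generates_def by blast+
  have "norm (P (max 0 a) u x - P (max 0 b) u x) \<le> C * norm (a - b)"
  proof (rule field_differentiable_bound[where S = "{0..}" and f' = "\<lambda>y. P (max 0 y) g x"])
    show "norm (P (max 0 z) g x) \<le> C" if "z \<in> {0..}" for z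
      using C g by (auto intro!: P_abs_le)
  qed (use y P_derivative[OF gen] in auto)
  then show ?thesis using y by (simp add: max_def)
qed

text \<open>P s is given only as a linear map on \<open>C0\<close>, not by a kernel, so it cannot be
  moved under an integral directly. Finite sums approximate the mixture uniformly in s and x, with
  the same weights and nodes for all shifts s.\<close>

lemma integral_P_approx:
  assumes K: "prob_space K" "sets K = sets borel" "AE y in K. 0 \<le> y \<and> y \<le> T"
    and u: "u \<in> C0" and e: "0 < e"
  obtains n :: nat and c y :: "nat \<Rightarrow> real"
  where "\<And>i. 0 \<le> y i"
    "\<And>s x. 0 \<le> s \<Longrightarrow> \<bar>(\<integral>z. P (max 0 (s + z)) u x \<partial>K) - (\<Sum>i\<le>n. c i * P (s + y i) u x)\<bar> \<le> e"
proof -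
  interpret K: prob_space K by fact
  note [measurable_cong] = K(2)
  obtain d where d: "0 < d" "\<And>a b x. 0 \<le> a \<Longrightarrow> 0 \<le> b \<Longrightarrow> \<bar>a - b\<bar> < d \<Longrightarrow> \<bar>P a u x - P b u x\<bar> \<le> e"
    using P_uniformly_continuous[OF u e] by blast
  define h where "h = d / 2"
  have h: "0 < h" "h < d" using d(1) by (auto simp: h_def)
  define n where "n = nat \<lfloor>T / h\<rfloor>"
  define A where "A i = {z. \<lfloor>z / h\<rfloor> = int i}" for i :: nat
  have A [measurable]: "A i \<in> sets borel" for i
    unfolding A_def by measurable
  define y where "y i = real i * h" for i :: nat
  have y: "0 \<le> y i" for i using h by (simp add: y_def)
  have "\<bar>(\<integral>z. P (max 0 (s + z)) u x \<partial>K) - (\<Sum>i\<le>n. measure K (A i) * P (s + y i) u x)\<bar> \<le> e"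
    if s: "0 \<le> s" for s x
  proof -
    obtain B where B: "0 \<le> B" "\<And>x. \<bar>u x\<bar> \<le> B" by (rule C0_bounded[OF u]) auto
    have F: "continuous_on UNIV (\<lambda>z. P (max 0 (s + z)) u x)"
      by (rule continuous_on_compose2[OF P_continuous[OF u]]) (auto intro!: continuous_intros)
    have [measurable]: "(\<lambda>z. P (max 0 (s + z)) u x) \<in> borel_measurable borel"
      using F by (rule borel_measurable_continuous_onI)
    have int1: "integrable K (\<lambda>z. P (max 0 (s + z)) u x)"
      using B u by (intro K.integrable_const_bound[where B = B]) (auto intro!: P_abs_le AE_I2)
    have int2: "integrable K (\<lambda>z. \<Sum>i\<le>n. indicator (A i) z * P (s + y i) u x)"
      by (intro Bochner_Integration.integrable_sum integrable_mult_left integrable_real_indicator)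
         (auto simp: K K.emeasure_eq_measure)
    have "(\<integral>z. (\<Sum>i\<le>n. indicator (A i) z * P (s + y i) u x) \<partial>K)
        = (\<Sum>i\<le>n. measure K (A i) * P (s + y i) u x)"
      using K by (subst Bochner_Integration.integral_sum)
           (auto simp: sets_eq_imp_space_eq K.emeasure_eq_measure intro!: integrable_real_indicator)
    then have "\<bar>(\<integral>z. P (max 0 (s + z)) u x \<partial>K) - (\<Sum>i\<le>n. measure K (A i) * P (s + y i) u x)\<bar>
        = \<bar>\<integral>z. P (max 0 (s + z)) u x - (\<Sum>i\<le>n. indicator (A i) z * P (s + y i) u x) \<partial>K\<bar>"
      using int1 int2 by (subst Bochner_Integration.integral_diff) auto
    also have "\<dots> \<le> (\<integral>z. \<bar>P (max 0 (s + z)) u x - (\<Sum>i\<le>n. indicator (A i) z * P (s + y i) u x)\<bar> \<partial>K)"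
      by (rule integral_abs_bound)
    also have "\<dots> \<le> (\<integral>z. e \<partial>K)"
    proof (rule integral_mono_AE)
      show "AE z in K. \<bar>P (max 0 (s + z)) u x - (\<Sum>i\<le>n. indicator (A i) z * P (s + y i) u x)\<bar> \<le> e"
        using K(3)
      proof eventually_elim
        case (elim z)
        define k where "k = nat \<lfloor>z / h\<rfloor>"
        have k: "z \<in> A i \<longleftrightarrow> i = k" for i
          using elim h by (auto simp: A_def k_def)
        have "k \<le> n"
          using elim h by (auto simp: k_def n_def intro!: nat_mono floor_mono divide_right_mono)
        then have "(\<Sum>i\<le>n. indicator (A i) z * P (s + y i) u x) = P (s + y k) u x"
          by (subst sum.mono_neutral_right[of _ "{k}"]) (auto simp: k)
        moreover have "\<bar>P (s + z) u x - P (s + y k) u x\<bar> \<le> e"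
        proof (rule d(2))
          have "real k = of_int \<lfloor>z / h\<rfloor>" using elim h by (simp add: k_def)
          then have "real k \<le> z / h" "z / h < real k + 1"
            using floor_correct[of "z / h"] by simp_all
          then have "real k * h \<le> z" "z < real k * h + h"
            using h by (simp_all add: pos_le_divide_eq pos_divide_less_eq distrib_right)
          then show "\<bar>s + z - (s + y k)\<bar> < d" using h by (simp add: y_def)
        qed (use elim s y[of k] in auto)
        ultimately show ?case using elim s by simp
      qed
    qed (use int1 int2 in \<open>auto intro!: Bochner_Integration.integrable_diff integrable_abs\<close>)
    finally show ?thesis by (simp add: K.prob_space)
  qed
  with y show thesis by (rule that)
qed

lemma integral_P_C0:
  assumes K: "prob_space K" "sets K = sets borel" "AE y in K. 0 \<le> y \<and> y \<le> T" and u: "u \<in> C0"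
  shows "(\<lambda>x. \<integral>z. P (max 0 z) u x \<partial>K) \<in> C0"
proof (rule C0_uniform_limit)
  fix e :: real assume e: "0 < e"
  obtain n :: nat and c y :: "nat \<Rightarrow> real" where y: "\<And>i. 0 \<le> y i"
    and approx: "\<And>s x. 0 \<le> s \<Longrightarrow> \<bar>(\<integral>z. P (max 0 (s + z)) u x \<partial>K) - (\<Sum>i\<le>n. c i * P (s + y i) u x)\<bar> \<le> e"
    by (rule integral_P_approx[OF K u e]) (rule that)
  show "\<exists>w\<in>C0. \<forall>x. \<bar>(\<integral>z. P (max 0 z) u x \<partial>K) - w x\<bar> \<le> e"
    using approx[of 0] y u by (intro bexI[of _ "\<lambda>x. \<Sum>i\<le>n. c i * P (y i) u x"]) (auto intro!: C0_sum P_C0)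
qed

text \<open>On the approximating sums the identity is linearity plus the semigroup law;
  contractivity controls the error once P s is applied.\<close>

lemma P_integral_P:
  assumes K: "prob_space K" "sets K = sets borel" "AE y in K. 0 \<le> y \<and> y \<le> T" and u: "u \<in> C0" and s: "0 \<le> s"
  shows "P s (\<lambda>x. \<integral>z. P (max 0 z) u x \<partial>K) x = (\<integral>z. P (max 0 (s + z)) u x \<partial>K)"
proof -
  have "\<bar>P s (\<lambda>x. \<integral>z. P (max 0 z) u x \<partial>K) x - (\<integral>z. P (max 0 (s + z)) u x \<partial>K)\<bar> \<le> 0 + e" if e: "0 < e" for e
  proof -
    obtain n :: nat and c y :: "nat \<Rightarrow> real" where y: "\<And>i. 0 \<le> y i"
      and approx: "\<And>s x. 0 \<le> s \<Longrightarrow> \<bar>(\<integral>z. P (max 0 (s + z)) u x \<partial>K) - (\<Sum>i\<le>n. c i * P (s + y i) u x)\<bar> \<le> e / 2"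
      by (rule integral_P_approx[OF K u half_gt_zero[OF e]]) (rule that)
    define w where "w x = (\<Sum>i\<le>n. c i * P (y i) u x)" for x
    have w: "w \<in> C0" unfolding w_def using y u by (intro C0_sum P_C0)
    have "P s w x = (\<Sum>i\<le>n. c i * P s (P (y i) u) x)"
      unfolding w_def using y u s by (intro P_sum P_C0)
    also have "\<dots> = (\<Sum>i\<le>n. c i * P (s + y i) u x)"
      using P_add[OF s y u] by simp
    finally have "\<bar>(\<integral>z. P (max 0 (s + z)) u x \<partial>K) - P s w x\<bar> \<le> e / 2"
      using approx[OF s, of x] by simp
    moreover have "\<bar>P s (\<lambda>x. \<integral>z. P (max 0 z) u x \<partial>K) x - P s w x\<bar> \<le> e / 2"
      using approx[of 0] by (intro P_abs_diff_le s w integral_P_C0[OF K u]) (simp add: w_def)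
    ultimately show ?thesis by linarith
  qed
  then have "\<bar>P s (\<lambda>x. \<integral>z. P (max 0 z) u x \<partial>K) x - (\<integral>z. P (max 0 (s + z)) u x \<partial>K)\<bar> \<le> 0"
    by (rule field_le_epsilon)
  then show ?thesis by simp
qed

text \<open>At the earliest time of a positive maximum m, all values at earlier times are strictly
  below m, so the integrand is strictly negative for every s > 0. As \<nu> is not null, this
  contradicts the sign of the operator.\<close>

lemma maximum_principle:
  fixes d :: "real \<Rightarrow> 'e \<Rightarrow> real"
  assumes \<nu>: "space \<nu> = {0<..}" "emeasure \<nu> {0<..} \<noteq> 0"
    and C0: "\<And>t. 0 \<le> t \<Longrightarrow> d t \<in> C0"
    and cont: "continuous_on ({0..} \<times> UNIV) (\<lambda>(t, x). d t x)"
    and vanish: "vanishes_locally_uniformly d"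
    and init: "\<And>x. d 0 x \<le> 0"
    and eq: "\<And>t x. 0 < t \<Longrightarrow> phi_well_defined \<nu> P d t x" "\<And>t x. 0 < t \<Longrightarrow> phi_op \<nu> P d t x \<le> 0"
    and T: "0 \<le> T"
  shows "d T x \<le> 0"
proof (rule ccontr)
  assume "\<not> d T x \<le> 0"
  define b where "b = d T x"
  have b: "0 < b" using \<open>\<not> d T x \<le> 0\<close> by (simp add: b_def)
  have "0 < T" using init[of x] b T by (cases "T = 0") (auto simp: b_def)
  \<comment> \<open>Off K the values are below b/2, while b itself is attained; the maximum can be
    sought on the compact set [0, T] x K.\<close>
  then obtain K where K: "compact K" "\<And>t y. t \<in> {0..T} \<Longrightarrow> y \<notin> K \<Longrightarrow> \<bar>d t y\<bar> < b / 2"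
    using vanish b unfolding vanishes_locally_uniformly_def by (metis half_gt_zero)
  have "x \<in> K" using K(2)[of T x] T b by (force simp: b_def)
  define Z where "Z = {0..T} \<times> K"
  have Z: "compact Z" "(T, x) \<in> Z" using K(1) \<open>x \<in> K\<close> T by (auto simp: Z_def compact_Times)
  have contZ: "continuous_on Z (\<lambda>(t, x). d t x)"
    using cont by (rule continuous_on_subset) (auto simp: Z_def)
  have "Z \<noteq> {}" using Z(2) by blast
  obtain z where z: "z \<in> Z" "\<And>w. w \<in> Z \<Longrightarrow> (case w of (t, x) \<Rightarrow> d t x) \<le> (case z of (t, x) \<Rightarrow> d t x)"
    using continuous_attains_sup[OF Z(1) \<open>Z \<noteq> {}\<close> contZ] by blast
  define m where "m = (case z of (t, x) \<Rightarrow> d t x)"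
  have m: "b \<le> m" using z(2)[OF Z(2)] by (simp add: m_def b_def)
  have le_m: "d t y \<le> m" if "t \<in> {0..T}" for t y
    using z(2)[of "(t, y)"] K(2)[of t y] that m b by (cases "y \<in> K") (auto simp: Z_def m_def)
  define A where "A = {w \<in> Z. (case w of (t, x) \<Rightarrow> d t x) = m}"
  have "closedin (top_of_set Z) A"
    unfolding A_def using continuous_closedin_preimage[OF contZ closed_singleton[of m]]
    by (simp add: vimage_def Int_def conj_commute)
  then have "compact A" using Z(1) by (rule closedin_compact[rotated])
  moreover have "z \<in> A" by (simp add: A_def z m_def)
  ultimately obtain w where w: "w \<in> A" "\<And>v. v \<in> A \<Longrightarrow> fst w \<le> fst v"
    using continuous_attains_inf[of A fst] continuous_on_fst[OF continuous_on_id, of A] by blast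
  obtain t0 x0 where w_eq: "w = (t0, x0)" by (cases w)
  have t0: "t0 \<in> {0..T}" "d t0 x0 = m" "x0 \<in> K" using w(1) by (auto simp: A_def Z_def w_eq)
  have "0 < t0" using t0 init[of x0] m b by (cases "t0 = 0") auto
  have neg: "phi_integrand P d t0 x0 s < 0" if s: "0 < s" for s
  proof (cases "s \<le> t0")
    case True
    then have ts: "0 \<le> t0 - s" "t0 - s < t0" "t0 - s \<in> {0..T}" using s t0 by auto
    obtain y where y: "y \<in> K" "\<And>v. v \<in> K \<Longrightarrow> d (t0 - s) v \<le> d (t0 - s) y"
      using continuous_attains_sup[OF K(1), of "d (t0 - s)"] t0(3) C0_continuous[OF C0[OF ts(1)]]
      by (auto intro: continuous_on_subset)
    \<comment> \<open>The maximum over K is below m since t0 is the earliest time, and b/2 bounds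
      the values off K. Including b/2 also makes the bound positive, as \<open>P_le\<close>
      requires.\<close>
    define m' where "m' = max (d (t0 - s) y) (b / 2)"
    have "d (t0 - s) y \<noteq> m"
      using w(2)[of "(t0 - s, y)"] ts y(1) by (auto simp: A_def Z_def w_eq)
    then have "m' < m" using le_m[OF ts(3), of y] b m by (auto simp: m'_def)
    moreover have "P s (d (t0 - s)) x0 \<le> m'"
    proof (rule P_le)
      show "d (t0 - s) v \<le> m'" for v
        using y(2)[of v] K(2)[OF ts(3), of v] by (cases "v \<in> K") (auto simp: m'_def le_max_iff_disj)
    qed (use s b C0[OF ts(1)] in \<open>auto simp: m'_def\<close>)
    ultimately show ?thesis using True s t0 by (simp add: phi_integrand_def)
  qed (use t0 m b in \<open>simp add: phi_integrand_def\<close>)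
  have int: "integrable \<nu> (\<lambda>s. - phi_integrand P d t0 x0 s)"
    using eq(1)[OF \<open>0 < t0\<close>] by (simp add: phi_well_defined_def)
  have nonneg: "AE s in \<nu>. 0 \<le> - phi_integrand P d t0 x0 s"
    using neg \<nu>(1) by (intro AE_I2) (auto intro!: less_imp_le)
  have "(\<integral>s. - phi_integrand P d t0 x0 s \<partial>\<nu>) \<le> 0"
    using eq(2)[OF \<open>0 < t0\<close>, of x0] by (simp add: phi_op_def)
  then have "(\<integral>s. - phi_integrand P d t0 x0 s \<partial>\<nu>) = 0"
    using integral_nonneg_AE[OF nonneg] by (rule antisym)
  then have "AE s in \<nu>. - phi_integrand P d t0 x0 s = 0"
    using integral_nonneg_eq_0_iff_AE[OF int nonneg] by blast
  then have "AE s in \<nu>. False"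
    using AE_space by eventually_elim (use neg \<nu>(1) in force)
  then show False
    using \<nu> AE_iff_measurable[OF sets.top, of \<nu> "\<lambda>_. False"] by (simp add: greaterThan_def)
qed

end

section \<open>Independent time change\<close>

lemma space_path_algebra [simp]: "space (path_algebra Q T X) = space Q"
  unfolding path_algebra_def by (rule space_measure_of) auto

lemma sets_path_algebra:
  "sets (path_algebra Q T X) = sigma_sets (space Q) {X r -` B \<inter> space Q | r B. r \<in> T \<and> B \<in> sets borel}"
  unfolding path_algebra_def by (rule sets_measure_of) auto

lemma path_algebra_measurable: "r \<in> T \<Longrightarrow> X r \<in> borel_measurable (path_algebra Q T X)"
  by (rule measurableI) (auto simp: sets_path_algebra intro!: sigma_sets.Basic)

lemma path_algebra_subset:
  assumes "\<And>r. r \<in> T \<Longrightarrow> X r \<in> borel_measurable Q"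
  shows "sets (path_algebra Q T X) \<subseteq> sets Q"
  unfolding sets_path_algebra using assms by (intro sets.sigma_sets_subset) (auto intro: measurable_sets)

lemma (in prob_space) expectation_mult_independent_processes:
  fixes f g :: "'a \<Rightarrow> real"
  assumes indep: "independent_processes M X Y"
    and f: "f \<in> borel_measurable (path_algebra M {0..} X)" "integrable M f"
    and g: "g \<in> borel_measurable (path_algebra M {0..} Y)" "integrable M g"
  shows "(\<integral>\<omega>. f \<omega> * g \<omega> \<partial>M) = (\<integral>\<omega>. f \<omega> \<partial>M) * (\<integral>\<omega>. g \<omega> \<partial>M)"
proof (rule indep_var_lebesgue_integral[OF _ f(2) g(2)])
  have sub: "sigma_sets (space M) {h -` A \<inter> space M | A. A \<in> sets borel} \<subseteq> sets R"
    if "h \<in> borel_measurable R" "space R = space M" for h :: "'a \<Rightarrow> real" and R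
    using sets.sigma_sets_subset[of "{h -` A \<inter> space M | A. A \<in> sets borel}" R] measurable_sets[OF that(1)] that(2)
    by auto
  have "indep_set (sigma_sets (space M) {f -` A \<inter> space M | A. A \<in> sets borel})
      (sigma_sets (space M) {g -` A \<inter> space M | A. A \<in> sets borel})"
    using indep unfolding independent_processes_def indep_set_def
    by (rule indep_sets_mono_sets) (use sub[OF f(1)] sub[OF g(1)] in \<open>auto split: bool.split\<close>)
  then show "indep_var borel f borel g"
    unfolding indep_var_eq using f(2) g(2) by (auto dest: borel_measurable_integrable)
qed

section \<open>Expectations of a Feller process at an independent random time\<close>

locale feller_process = feller P + prob_space Q
  for P :: "real \<Rightarrow> ('e::t2_space \<Rightarrow> real) \<Rightarrow> 'e \<Rightarrow> real" and Q :: "'w measure" +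
  fixes M :: "real \<Rightarrow> 'w \<Rightarrow> 'e" and x :: 'e
  assumes process: "feller_process_from Q P M x"
begin

lemma M_measurable [measurable]: "0 \<le> t \<Longrightarrow> M t \<in> borel_measurable Q"
  and M_cadlag: "\<omega> \<in> space Q \<Longrightarrow> cadlag (\<lambda>t. M t \<omega>)"
  and M_0: "AE \<omega> in Q. M 0 \<omega> = x"
  and M_Markov: "0 \<le> s \<Longrightarrow> 0 \<le> t \<Longrightarrow> u \<in> C0 \<Longrightarrow>
      AE \<omega> in Q. real_cond_exp Q (path_algebra Q {0..s} M) (\<lambda>\<omega>. u (M (s + t) \<omega>)) \<omega> = P t u (M s \<omega>)"
  using process by (simp_all add: feller_process_from_def)

lemma C0_M_measurable: "u \<in> C0 \<Longrightarrow> 0 \<le> t \<Longrightarrow> (\<lambda>\<omega>. u (M t \<omega>)) \<in> borel_measurable Q"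
  by (rule measurable_compose[OF M_measurable borel_measurable_continuous_onI[OF C0_continuous]])

lemma C0_M_integrable:
  assumes "u \<in> C0" "0 \<le> t"
  shows "integrable Q (\<lambda>\<omega>. u (M t \<omega>))"
proof -
  obtain B where "\<And>x. \<bar>u x\<bar> \<le> B" by (rule C0_bounded[OF assms(1)]) auto
  then show ?thesis
    using C0_M_measurable[OF assms] by (intro integrable_const_bound[where B = B]) auto
qed

text \<open>The Markov property at time 0, integrated: conditional expectation preserves the mean,
  and M 0 = x almost surely.\<close>

lemma expectation_M:
  assumes u: "u \<in> C0" and t: "0 \<le> t"
  shows "(\<integral>\<omega>. u (M t \<omega>) \<partial>Q) = P t u x"
proof -
  let ?G = "path_algebra Q {0..0} M"
  have sub: "subalgebra Q ?G"
    unfolding subalgebra_def using path_algebra_subset[of "{0..0}" M Q] by auto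
  interpret G: finite_measure_subalgebra Q ?G
    by unfold_locales (rule sub)
  have "(\<integral>\<omega>. u (M t \<omega>) \<partial>Q) = (\<integral>\<omega>. real_cond_exp Q ?G (\<lambda>\<omega>. u (M (0 + t) \<omega>)) \<omega> \<partial>Q)"
    using G.real_cond_exp_int(2)[OF C0_M_integrable[OF u t]] by simp
  also have "\<dots> = (\<integral>\<omega>. P t u (M 0 \<omega>) \<partial>Q)"
    using M_Markov[of 0 t u] u t C0_M_measurable[OF P_C0[OF t u], of 0] by (intro integral_cong_AE) auto
  also have "\<dots> = (\<integral>\<omega>. P t u x \<partial>Q)"
    using M_0 C0_M_measurable[OF P_C0[OF t u], of 0] by (intro integral_cong_AE) (auto elim!: eventually_mono)
  finally show ?thesis by (simp add: prob_space)
qed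

text \<open>\<tau> is replaced by grid times \<sigma> n above it. The event that a given grid time
  is selected belongs to the algebra of Y, so independence separates it from M; right-continuity of
  M then removes the grid.\<close>

lemma expectation_independent_time:
  assumes u: "u \<in> C0" and indep: "independent_processes Q M Y"
    and \<tau>: "\<tau> \<in> borel_measurable (path_algebra Q {0..} Y)" and Y: "\<And>r. 0 \<le> r \<Longrightarrow> Y r \<in> borel_measurable Q"
    and nonneg: "\<And>\<omega>. \<omega> \<in> space Q \<Longrightarrow> 0 \<le> \<tau> \<omega>" and le: "AE \<omega> in Q. \<tau> \<omega> \<le> T"
  shows "(\<integral>\<omega>. u (M (\<tau> \<omega>) \<omega>) \<partial>Q) = (\<integral>\<omega>. P (max 0 (\<tau> \<omega>)) u x \<partial>Q)"
proof -
  have subY: "sets (path_algebra Q {0..} Y) \<subseteq> sets Q"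
    using Y by (intro path_algebra_subset) auto
  have \<tau>_meas [measurable]: "\<tau> \<in> borel_measurable Q"
    by (rule measurable_mono[THEN subsetD, OF _ _ _ _ \<tau>]) (use subY in auto)
  obtain B where B: "0 \<le> B" "\<And>x. \<bar>u x\<bar> \<le> B" by (rule C0_bounded[OF u]) auto
  define k where "k n \<omega> = nat \<lfloor>\<tau> \<omega> * real (Suc n)\<rfloor>" for n \<omega>
  \<comment> \<open>The successor keeps \<sigma> n strictly above \<tau>, so that the right limit of
    the path applies.\<close>
  define \<sigma> where "\<sigma> n \<omega> = real (Suc (k n \<omega>)) / real (Suc n)" for n \<omega>
  have k_meas: "k n \<in> measurable Q (count_space UNIV)" for n
    unfolding k_def by measurable
  have k_measY: "k n \<in> measurable (path_algebra Q {0..} Y) (count_space UNIV)" for n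
    unfolding k_def using \<tau> by measurable
  have k_bounds: "real (k n \<omega>) \<le> \<tau> \<omega> * real (Suc n)" "\<tau> \<omega> * real (Suc n) < real (Suc (k n \<omega>))" if "\<omega> \<in> space Q" for n \<omega>
  proof -
    have "0 \<le> \<lfloor>\<tau> \<omega> * real (Suc n)\<rfloor>" using nonneg[OF that] by simp
    then have "real (k n \<omega>) = of_int \<lfloor>\<tau> \<omega> * real (Suc n)\<rfloor>" by (simp add: k_def)
    then show "real (k n \<omega>) \<le> \<tau> \<omega> * real (Suc n)" "\<tau> \<omega> * real (Suc n) < real (Suc (k n \<omega>))"
      using floor_correct[of "\<tau> \<omega> * real (Suc n)"] unfolding of_nat_Suc by linarith+
  qed
  have \<sigma>_bounds: "\<tau> \<omega> < \<sigma> n \<omega>" "\<sigma> n \<omega> \<le> \<tau> \<omega> + 1 / real (Suc n)" if "\<omega> \<in> space Q" for n \<omega>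
    using k_bounds[OF that, of n]
    by (simp_all add: \<sigma>_def pos_less_divide_eq pos_divide_le_eq distrib_right del: of_nat_Suc)
  have \<sigma>_lim: "filterlim (\<lambda>n. \<sigma> n \<omega>) (at_right (\<tau> \<omega>)) sequentially" if \<omega>: "\<omega> \<in> space Q" for \<omega>
  proof (rule tendsto_imp_filterlim_at_right)
    have lim: "(\<lambda>n. \<tau> \<omega> + 1 / real (Suc n)) \<longlonglongrightarrow> \<tau> \<omega>" by real_asymp
    show "(\<lambda>n. \<sigma> n \<omega>) \<longlonglongrightarrow> \<tau> \<omega>"
      by (rule tendsto_sandwich[OF _ _ tendsto_const lim]) (use \<sigma>_bounds[OF \<omega>] in \<open>auto intro!: always_eventually less_imp_le simp del: of_nat_Suc\<close>)
  qed (use \<sigma>_bounds[OF \<omega>] in \<open>auto intro!: always_eventually\<close>)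
  have uM_meas [measurable]: "(\<lambda>\<omega>. u (M (\<sigma> n \<omega>) \<omega>)) \<in> borel_measurable Q" for n
    unfolding \<sigma>_def by (rule measurable_compose_countable[OF _ k_meas]) (simp add: C0_M_measurable u)
  have uM_lim: "(\<lambda>n. u (M (\<sigma> n \<omega>) \<omega>)) \<longlonglongrightarrow> u (M (\<tau> \<omega>) \<omega>)" if \<omega>: "\<omega> \<in> space Q" for \<omega>
  proof (rule isCont_tendsto_compose[where g = u])
    show "isCont u (M (\<tau> \<omega>) \<omega>)"
      using C0_continuous[OF u] by (simp add: continuous_on_eq_continuous_at)
    show "(\<lambda>n. M (\<sigma> n \<omega>) \<omega>) \<longlonglongrightarrow> M (\<tau> \<omega>) \<omega>"
      by (rule filterlim_compose[OF cadlag_right[OF M_cadlag[OF \<omega>] nonneg[OF \<omega>]] \<sigma>_lim[OF \<omega>]])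
  qed
  have F_cont: "continuous_on UNIV (\<lambda>y. P (max 0 y) u x)" by (rule P_continuous[OF u])
  have F_meas [measurable]: "(\<lambda>y. P (max 0 y) u x) \<in> borel_measurable borel"
    using F_cont by (rule borel_measurable_continuous_onI)
  have \<sigma>_meas [measurable]: "\<sigma> n \<in> borel_measurable Q" for n
    unfolding \<sigma>_def by (rule measurable_compose_countable[OF _ k_meas]) simp
  have step: "(\<integral>\<omega>. u (M (\<sigma> n \<omega>) \<omega>) \<partial>Q) = (\<integral>\<omega>. P (max 0 (\<sigma> n \<omega>)) u x \<partial>Q)" for n
  proof -
    \<comment> \<open>The almost sure bound T on \<tau> leaves finitely many grid times, so only
      finite sums are exchanged with integrals.\<close>
    define m where "m = nat \<lfloor>T * real (Suc n)\<rfloor>"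
    define A where "A i = {\<omega> \<in> space Q. k n \<omega> = i}" for i
    have A: "A i \<in> sets (path_algebra Q {0..} Y)" for i
      using measurable_sets[OF k_measY, of "{i}"] by (simp add: A_def vimage_def Int_def conj_commute)
    then have A' [measurable]: "A i \<in> sets Q" for i using subY by blast
    have AE: "AE \<omega> in Q. (\<Sum>i\<le>m. indicator (A i) \<omega> * h i \<omega>) = h (k n \<omega>) \<omega>" for h :: "nat \<Rightarrow> 'w \<Rightarrow> real"
      using le AE_space
    proof eventually_elim
      case (elim \<omega>)
      then have "k n \<omega> \<le> m" unfolding k_def m_def by (intro nat_mono floor_mono mult_right_mono) auto
      then show ?case
        using elim by (subst sum.mono_neutral_right[of _ "{k n \<omega>}"]) (auto simp: A_def)
    qed
    have "(\<integral>\<omega>. u (M (\<sigma> n \<omega>) \<omega>) \<partial>Q) = (\<integral>\<omega>. (\<Sum>i\<le>m. indicator (A i) \<omega> * u (M (real (Suc i) / Suc n) \<omega>)) \<partial>Q)"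
    proof (rule integral_cong_AE)
      show "AE \<omega> in Q. u (M (\<sigma> n \<omega>) \<omega>) = (\<Sum>i\<le>m. indicator (A i) \<omega> * u (M (real (Suc i) / Suc n) \<omega>))"
        using AE[of "\<lambda>i \<omega>. u (M (real (Suc i) / Suc n) \<omega>)"] by eventually_elim (simp only: \<sigma>_def)
      show "(\<lambda>\<omega>. \<Sum>i\<le>m. indicator (A i) \<omega> * u (M (real (Suc i) / Suc n) \<omega>)) \<in> borel_measurable Q"
        by (intro borel_measurable_sum borel_measurable_times borel_measurable_indicator A' C0_M_measurable u) simp
    qed measurable
    also have "\<dots> = (\<Sum>i\<le>m. \<integral>\<omega>. indicator (A i) \<omega> * u (M (real (Suc i) / Suc n) \<omega>) \<partial>Q)"
      by (rule Bochner_Integration.integral_sum)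
         (auto intro!: integrable_real_mult_indicator C0_M_integrable u simp: mult.commute[of "indicator _ _"] simp del: of_nat_Suc)
    also have "\<dots> = (\<Sum>i\<le>m. \<integral>\<omega>. indicator (A i) \<omega> * P (real (Suc i) / Suc n) u x \<partial>Q)"
    proof (rule sum.cong[OF refl])
      fix i
      have "(\<integral>\<omega>. u (M (real (Suc i) / Suc n) \<omega>) * indicator (A i) \<omega> \<partial>Q)
          = (\<integral>\<omega>. u (M (real (Suc i) / Suc n) \<omega>) \<partial>Q) * (\<integral>\<omega>. indicator (A i) \<omega> \<partial>Q)"
      proof (rule expectation_mult_independent_processes[OF indep])
        show "(\<lambda>\<omega>. u (M (real (Suc i) / Suc n) \<omega>)) \<in> borel_measurable (path_algebra Q {0..} M)"
          using borel_measurable_continuous_onI[OF C0_continuous[OF u]]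
          by (rule measurable_compose[OF path_algebra_measurable, rotated]) simp
        show "(indicator (A i) :: 'w \<Rightarrow> real) \<in> borel_measurable (path_algebra Q {0..} Y)"
          using A by (rule borel_measurable_indicator)
      qed (auto intro!: C0_M_integrable u integrable_real_indicator simp: emeasure_eq_measure)
      also have "(\<integral>\<omega>. u (M (real (Suc i) / Suc n) \<omega>) \<partial>Q) = P (real (Suc i) / Suc n) u x"
        by (rule expectation_M[OF u]) simp
      finally show "(\<integral>\<omega>. indicator (A i) \<omega> * u (M (real (Suc i) / Suc n) \<omega>) \<partial>Q)
          = (\<integral>\<omega>. indicator (A i) \<omega> * P (real (Suc i) / Suc n) u x \<partial>Q)"
        by (simp add: mult.commute del: of_nat_Suc)
    qed
    also have "\<dots> = (\<integral>\<omega>. (\<Sum>i\<le>m. indicator (A i) \<omega> * P (real (Suc i) / Suc n) u x) \<partial>Q)"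
      by (rule Bochner_Integration.integral_sum[symmetric])
         (auto intro!: integrable_real_indicator simp: emeasure_eq_measure simp del: of_nat_Suc)
    also have "\<dots> = (\<integral>\<omega>. P (max 0 (\<sigma> n \<omega>)) u x \<partial>Q)"
    proof (rule integral_cong_AE)
      have "max 0 (\<sigma> n \<omega>) = \<sigma> n \<omega>" for \<omega> by (simp add: \<sigma>_def)
      then show "AE \<omega> in Q. (\<Sum>i\<le>m. indicator (A i) \<omega> * P (real (Suc i) / Suc n) u x) = P (max 0 (\<sigma> n \<omega>)) u x"
        using AE[of "\<lambda>i \<omega>. P (real (Suc i) / Suc n) u x"] by (simp add: \<sigma>_def)
    qed measurable
    finally show ?thesis .
  qed
  have "(\<lambda>n. \<integral>\<omega>. u (M (\<sigma> n \<omega>) \<omega>) \<partial>Q) \<longlonglongrightarrow> (\<integral>\<omega>. u (M (\<tau> \<omega>) \<omega>) \<partial>Q)"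
  proof (rule integral_dominated_convergence[where w = "\<lambda>_. B"])
    show "(\<lambda>\<omega>. u (M (\<tau> \<omega>) \<omega>)) \<in> borel_measurable Q"
      by (rule borel_measurable_LIMSEQ_real[OF uM_lim]) auto
  qed (use B uM_lim in \<open>auto intro!: AE_I2\<close>)
  moreover have "(\<lambda>n. \<integral>\<omega>. P (max 0 (\<sigma> n \<omega>)) u x \<partial>Q) \<longlonglongrightarrow> (\<integral>\<omega>. P (max 0 (\<tau> \<omega>)) u x \<partial>Q)"
  proof (rule integral_dominated_convergence[where w = "\<lambda>_. B"])
    show "AE \<omega> in Q. (\<lambda>n. P (max 0 (\<sigma> n \<omega>)) u x) \<longlonglongrightarrow> P (max 0 (\<tau> \<omega>)) u x"
    proof (rule AE_I2)
      fix \<omega> assume \<omega>: "\<omega> \<in> space Q"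
      have "(\<lambda>n. \<sigma> n \<omega>) \<longlonglongrightarrow> \<tau> \<omega>"
        using \<sigma>_lim[OF \<omega>] by (simp add: filterlim_at)
      then show "(\<lambda>n. P (max 0 (\<sigma> n \<omega>)) u x) \<longlonglongrightarrow> P (max 0 (\<tau> \<omega>)) u x"
        using F_cont by (intro isCont_tendsto_compose[where g = "\<lambda>y. P (max 0 y) u x"]) (auto simp: continuous_on_eq_continuous_at)
    qed
  qed (use B u in \<open>auto intro!: AE_I2 P_abs_le\<close>)
  ultimately show ?thesis
    unfolding step by (rule LIMSEQ_unique)
qed

end

section \<open>The evolution problem\<close>

text \<open>The right-hand side of the equation involves only the common initial value, so it
  cancels in q1 - q2 and the maximum principle applies. Uniqueness follows by exchanging the
  roles.\<close>

lemma (in feller) solution_le: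
  assumes \<nu>: "space \<nu> = {0<..}" "emeasure \<nu> {0<..} = \<infinity>"
    and q1: "is_solution \<nu> P u q1" "vanishes_locally_uniformly q1"
    and q2: "is_solution \<nu> P u q2" "vanishes_locally_uniformly q2"
    and t: "0 \<le> t"
  shows "q1 t x \<le> q2 t x"
proof -
  have C0: "q1 r \<in> C0" "q2 r \<in> C0" if "0 \<le> r" for r
    using q1 q2 that by (auto simp: is_solution_def operand_def)
  have eq: "phi_well_defined \<nu> P q r y \<and> phi_op \<nu> P q r y = levy_tail \<nu> r * q 0 y"
    if "is_solution \<nu> P u q" "0 < r" for q r y
    using that by (auto simp: is_solution_def)
  have init: "q1 0 y = u y" "q2 0 y = u y" for y
    using q1 q2 by (auto simp: is_solution_def)
  define d where "d r y = q1 r y - q2 r y" for r y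
  have d_C0: "d r \<in> C0" if "0 \<le> r" for r
    using C0_diff[OF C0[OF that]] by (simp add: d_def[abs_def])
  have d_cont: "continuous_on ({0..} \<times> UNIV) (\<lambda>(r, y). d r y)"
  proof -
    have "continuous_on ({0..} \<times> UNIV) (\<lambda>z. (case z of (r, y) \<Rightarrow> q1 r y) - (case z of (r, y) \<Rightarrow> q2 r y))"
      using q1 q2 by (intro continuous_on_diff) (auto simp: is_solution_def)
    then show ?thesis by (simp add: d_def split_beta')
  qed
  have d_vanish: "vanishes_locally_uniformly d"
    unfolding vanishes_locally_uniformly_def
  proof (intro allI impI)
    fix T e :: real assume "0 < T" "0 < e"
    then obtain K1 K2 where K: "compact K1" "compact K2"
      "\<And>r y. r \<in> {0..T} \<Longrightarrow> y \<notin> K1 \<Longrightarrow> \<bar>q1 r y\<bar> < e / 2" "\<And>r y. r \<in> {0..T} \<Longrightarrow> y \<notin> K2 \<Longrightarrow> \<bar>q2 r y\<bar> < e / 2"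
      using q1(2) q2(2) unfolding vanishes_locally_uniformly_def by (metis half_gt_zero)
    show "\<exists>K. compact K \<and> (\<forall>r\<in>{0..T}. \<forall>y. y \<notin> K \<longrightarrow> \<bar>d r y\<bar> < e)"
    proof (intro exI[of _ "K1 \<union> K2"] conjI ballI allI impI)
      fix r y assume "r \<in> {0..T}" "y \<notin> K1 \<union> K2"
      then show "\<bar>d r y\<bar> < e" using K(3)[of r y] K(4)[of r y] by (simp add: d_def)
    qed (use K in auto)
  qed
  have integrand: "phi_integrand P d r y s = phi_integrand P q1 r y s - phi_integrand P q2 r y s" if "0 < s" for r y s
  proof (cases "s \<le> r")
    case True
    have "P s (d (r - s)) y = P s (q1 (r - s)) y - P s (q2 (r - s)) y"
      using P_diff[of s "q1 (r - s)" "q2 (r - s)" y] C0[of "r - s"] True that by (simp add: d_def[abs_def])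
    with True that show ?thesis by (simp add: phi_integrand_def d_def)
  qed (simp add: phi_integrand_def d_def)
  have int: "integrable \<nu> (phi_integrand P q r y)" if "is_solution \<nu> P u q" "0 < r" for q r y
    using eq[OF that] by (simp add: phi_well_defined_def)
  have sol: "phi_well_defined \<nu> P d r y \<and> phi_op \<nu> P d r y = 0" if r: "0 < r" for r y
  proof
    have "integrable \<nu> (\<lambda>s. phi_integrand P q1 r y s - phi_integrand P q2 r y s)"
      by (intro Bochner_Integration.integrable_diff int q1 q2 r)
    then show "phi_well_defined \<nu> P d r y"
      unfolding phi_well_defined_def
      by (rule Bochner_Integration.integrable_cong[THEN iffD1, rotated 2]) (simp_all add: integrand \<nu>)
    have "(\<integral>s. phi_integrand P d r y s \<partial>\<nu>) = (\<integral>s. phi_integrand P q1 r y s - phi_integrand P q2 r y s \<partial>\<nu>)"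
      by (rule Bochner_Integration.integral_cong) (simp_all add: integrand \<nu>)
    also have "\<dots> = (\<integral>s. phi_integrand P q1 r y s \<partial>\<nu>) - (\<integral>s. phi_integrand P q2 r y s \<partial>\<nu>)"
      by (intro Bochner_Integration.integral_diff int q1 q2 r)
    finally show "phi_op \<nu> P d r y = 0"
      using eq[OF q1(1) r, of y] eq[OF q2(1) r, of y] by (simp add: phi_op_def init)
  qed
  have "d t x \<le> 0"
  proof (rule maximum_principle[OF \<nu>(1) _ d_C0 d_cont d_vanish])
    show "emeasure \<nu> {0<..} \<noteq> 0" by (simp add: \<nu>(2))
    show "d 0 y \<le> 0" for y by (simp add: d_def init)
    show "phi_well_defined \<nu> P d r y" "phi_op \<nu> P d r y \<le> 0" if "0 < r" for r y
      using sol[OF that, of y] by auto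
  qed (simp_all only: t)
  then show ?thesis by (simp add: d_def)
qed

text \<open>All that the analytic argument takes from probability: q as a mixture of the semigroup,
  and its Lipschitz bound in time with the constant C that bounds g.\<close>

locale feller_renewal = feller P + renewal_pair N p
  for P :: "real \<Rightarrow> ('e::t2_space \<Rightarrow> real) \<Rightarrow> 'e \<Rightarrow> real" and N p +
  fixes u g :: "'e \<Rightarrow> real" and C :: real and q :: "real \<Rightarrow> 'e \<Rightarrow> real"
  assumes generates: "generates P u g"
    and g_bound: "\<bar>g x\<bar> \<le> C"
    and q_0: "q 0 x = u x"
    and q_pos: "0 < t \<Longrightarrow> q t x = (\<integral>y. P (max 0 y) u x \<partial>undershoot t)"
    and q_lipschitz: "0 \<le> s \<Longrightarrow> 0 \<le> t \<Longrightarrow> \<bar>q s x - q t x\<bar> \<le> C * \<bar>s - t\<bar>"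
begin

lemma u: "u \<in> C0" and g: "g \<in> C0"
  using generates unfolding generates_def by blast+

lemma C_nonneg: "0 \<le> C"
  using g_bound[of undefined] by linarith

lemma undershoot_prob:
  assumes "0 < t"
  shows "prob_space (undershoot t)" "sets (undershoot t) = sets borel" "AE y in undershoot t. 0 \<le> y \<and> y \<le> t"
  by (rule prob_space_undershoot[OF assms]) (simp, rule AE_undershootI, simp)

lemma q_C0: "0 \<le> t \<Longrightarrow> q t \<in> C0"
proof (cases "t = 0")
  case True
  then show ?thesis using u q_0 by (metis ext)
next
  case False
  assume "0 \<le> t"
  with False have "0 < t" by simp
  then have "q t = (\<lambda>x. \<integral>y. P (max 0 y) u x \<partial>undershoot t)" by (simp add: q_pos fun_eq_iff)
  then show ?thesis
    using integral_P_C0[OF undershoot_prob[OF \<open>0 < t\<close>] u] by simp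
qed

text \<open>Continuity in x at a fixed time combines with a Lipschitz bound in time that is uniform
  in x.\<close>

lemma q_continuous: "continuous_on ({0..} \<times> UNIV) (\<lambda>(t, x). q t x)"
  unfolding continuous_on_def
proof (intro ballI)
  fix z :: "real \<times> 'e" assume z: "z \<in> {0..} \<times> UNIV"
  obtain t x where tx: "z = (t, x)" "0 \<le> t" using z by (cases z) auto
  let ?F = "at z within ({0..} \<times> UNIV)"
  have "isCont (q t) x"
    using C0_continuous[OF q_C0[OF tx(2)]] by (simp add: continuous_on_eq_continuous_at)
  moreover have "(snd \<longlongrightarrow> x) ?F"
    using tendsto_snd[OF tendsto_ident_at, of z "{0..} \<times> UNIV"] tx by simp
  ultimately have 1: "((\<lambda>w. q t (snd w)) \<longlongrightarrow> q t x) ?F"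
    by (rule isCont_tendsto_compose)
  have 2: "((\<lambda>w. q (fst w) (snd w) - q t (snd w)) \<longlongrightarrow> 0) ?F"
  proof (rule Lim_null_comparison)
    show "\<forall>\<^sub>F w in ?F. norm (q (fst w) (snd w) - q t (snd w)) \<le> C * \<bar>fst w - t\<bar>"
      using q_lipschitz tx(2) by (auto simp: eventually_at_filter intro!: always_eventually)
    have "(fst \<longlongrightarrow> t) ?F"
      using tendsto_fst[OF tendsto_ident_at, of z "{0..} \<times> UNIV"] tx by simp
    then have "((\<lambda>w. C * \<bar>fst w - t\<bar>) \<longlongrightarrow> C * \<bar>t - t\<bar>) ?F"
      by (intro tendsto_intros)
    then show "((\<lambda>w. C * \<bar>fst w - t\<bar>) \<longlongrightarrow> 0) ?F" by simp
  qed
  from tendsto_add[OF 1 2] show "((\<lambda>(t, x). q t x) \<longlongrightarrow> (case z of (t, x) \<Rightarrow> q t x)) ?F"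
    by (simp add: tx split_beta')
qed

text \<open>The Lipschitz bound reduces [0, T] to finitely many times i h, and the union of the
  compact sets for these times serves every t.\<close>

lemma q_vanishes: "vanishes_locally_uniformly q"
  unfolding vanishes_locally_uniformly_def
proof (intro allI impI)
  fix T e :: real assume T: "0 < T" and e: "0 < e"
  \<comment> \<open>C may be 0; dividing by C + 1 instead keeps h well-defined and C h at most
    e/2.\<close>
  define k where "k = C + 1"
  have k: "0 < k" using C_nonneg by (simp add: k_def)
  define h where "h = e / (2 * k)"
  have h: "0 < h" using e k by (simp add: h_def)
  have Ch: "C * h \<le> e / 2"
  proof -
    have "C * h \<le> k * h" using h by (simp add: k_def mult_right_mono)
    also have "\<dots> = e / 2" using k by (simp add: h_def)
    finally show ?thesis .
  qed
  have "\<exists>K. compact K \<and> (\<forall>x. x \<notin> K \<longrightarrow> \<bar>q (real i * h) x\<bar> < e / 2)" for i :: nat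
    using h e by (intro C0_D q_C0) auto
  then obtain K where K: "\<And>i. compact (K i)" "\<And>i x. x \<notin> K i \<Longrightarrow> \<bar>q (real i * h) x\<bar> < e / 2"
    by metis
  show "\<exists>K. compact K \<and> (\<forall>t\<in>{0..T}. \<forall>x. x \<notin> K \<longrightarrow> \<bar>q t x\<bar> < e)"
  proof (intro exI[of _ "\<Union>i\<le>nat \<lfloor>T / h\<rfloor>. K i"] conjI ballI allI impI)
    show "compact (\<Union>i\<le>nat \<lfloor>T / h\<rfloor>. K i)" using K(1) by (intro compact_UN) auto
    fix t x assume t: "t \<in> {0..T}" and x: "x \<notin> (\<Union>i\<le>nat \<lfloor>T / h\<rfloor>. K i)"
    define i where "i = nat \<lfloor>t / h\<rfloor>"
    have i: "i \<le> nat \<lfloor>T / h\<rfloor>"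
      unfolding i_def using t h by (intro nat_mono floor_mono divide_right_mono) auto
    have "0 \<le> \<lfloor>t / h\<rfloor>" using t h by simp
    then have "real i = of_int \<lfloor>t / h\<rfloor>" by (simp add: i_def)
    then have "real i \<le> t / h" "t / h < real i + 1"
      using floor_correct[of "t / h"] by simp_all
    then have "real i * h \<le> t" "t < real i * h + h"
      using h by (simp_all add: pos_le_divide_eq pos_divide_less_eq distrib_right)
    then have "\<bar>t - real i * h\<bar> \<le> h" by simp
    then have "C * \<bar>t - real i * h\<bar> \<le> C * h" using C_nonneg by (rule mult_left_mono)
    moreover have "\<bar>q t x - q (real i * h) x\<bar> \<le> C * \<bar>t - real i * h\<bar>"
      using t h by (intro q_lipschitz) auto
    moreover have "\<bar>q (real i * h) x\<bar> < e / 2" using x i by (intro K(2)) auto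
    ultimately show "\<bar>q t x\<bar> < e" using Ch by linarith
  qed
qed

text \<open>The operator splits at s = t. On (0, t) the semigroup shifts the law of H(t - s), and
  the contribution is T(t) (q(t, x) - u(x)); beyond t the integrand is -q(t, x) and contributes
  -T(t) q(t, x). The sum is -T(t) u(x).\<close>

lemma q_solution:
  assumes \<nu>: "space \<nu> = {0<..}" "(\<lambda>x. x) \<in> measurable \<nu> borel" "N = distr \<nu> borel (\<lambda>x. x)"
  shows "is_solution \<nu> P u q"
proof -
  have "phi_well_defined \<nu> P q t x \<and> phi_op \<nu> P q t x = measure N {t<..} * u x" if t: "0 < t" for t x
  proof -
    define F where "F y = P (max 0 y) u x" for y
    define D where "D s = ((\<integral>y. F (s + y) \<partial>undershoot (t - s)) - (\<integral>y. F y \<partial>undershoot t)) * indicator {0<..<t} s" for s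
    have gen: "integrable N D" "(\<integral>s. D s \<partial>N) = measure N {t<..} * ((\<integral>y. F y \<partial>undershoot t) - F 0)"
    proof -
      have bound: "\<bar>P (max 0 y) g x\<bar> \<le> C" for y
        by (intro P_abs_le g g_bound) simp
      note gen = undershoot_generator[OF t P_continuous[OF u] P_continuous[OF g] P_derivative[OF generates] bound]
      show "integrable N D" unfolding D_def F_def by (rule gen(1))
      show "(\<integral>s. D s \<partial>N) = measure N {t<..} * ((\<integral>y. F y \<partial>undershoot t) - F 0)"
        unfolding D_def F_def by (rule gen(2))
    qed
    have F0: "F 0 = u x" by (simp add: F_def P_0[OF u])
    have qt: "q t x = (\<integral>y. F y \<partial>undershoot t)" using t by (simp add: q_pos F_def)
    define E where "E s = D s - q t x * indicator {t<..} s" for s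
    have fin: "emeasure N {t<..} < \<infinity>" by (rule N_tail[OF t])
    have E_int: "integrable N E"
      unfolding E_def using gen(1) fin
      by (intro Bochner_Integration.integrable_diff integrable_mult_right integrable_real_indicator) (auto simp: sets_N)
    have E_val: "(\<integral>s. E s \<partial>N) = - (measure N {t<..} * u x)"
      unfolding E_def using gen fin
      by (subst Bochner_Integration.integral_diff)
         (auto simp: sets_N qt[symmetric] F0 algebra_simps intro!: integrable_mult_right integrable_real_indicator)
    \<comment> \<open>At s = t the integrand involves q at time 0, where \<open>undershoot\<close>
      does not describe it; this single point is null because N has no atoms.\<close>
    define G where "G s = (if s = t then phi_integrand P q t x t else E s)" for s
    have E_meas [measurable]: "E \<in> borel_measurable borel"
      using borel_measurable_integrable[OF E_int] by (simp add: measurable_cong_sets[OF sets_N refl])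
    have G_meas [measurable]: "G \<in> borel_measurable borel"
      unfolding G_def by measurable
    have AE: "AE s in N. E s = G s"
      by (rule AE_I[where N = "{t}"]) (auto simp: G_def sets_N no_atom[OF t])
    have G_int: "integrable N G"
      using AE E_int by (rule integrable_cong_AE_imp[rotated 2]) (simp add: measurable_cong_sets[OF sets_N refl])
    have G_val: "(\<integral>s. G s \<partial>N) = - (measure N {t<..} * u x)"
      using AE E_val by (subst integral_cong_AE[where g = E]) (auto elim!: eventually_mono simp: measurable_cong_sets[OF sets_N refl])
    have integrand: "phi_integrand P q t x s = G s" if s: "0 < s" for s
    proof -
      consider "s < t" | "s = t" | "t < s" by linarith
      then show ?thesis
      proof cases
        case 1
        have "q (t - s) = (\<lambda>x. \<integral>y. P (max 0 y) u x \<partial>undershoot (t - s))"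
          using 1 by (simp add: q_pos fun_eq_iff)
        then have "P s (q (t - s)) x = (\<integral>y. F (s + y) \<partial>undershoot (t - s))"
          using P_integral_P[OF undershoot_prob[of "t - s"] u, of s x] 1 s by (simp add: F_def)
        then show ?thesis
          using 1 s by (simp add: phi_integrand_def G_def E_def D_def qt)
      qed (use s in \<open>auto simp: G_def E_def D_def phi_integrand_def\<close>)
    qed
    have "integrable \<nu> G"
      using G_int unfolding \<nu>(3) by (subst (asm) integrable_distr_eq) (auto simp: \<nu>(2))
    then have "integrable \<nu> (phi_integrand P q t x)"
      by (rule Bochner_Integration.integrable_cong[THEN iffD1, rotated 2]) (simp_all add: integrand \<nu>(1))
    moreover have "(\<integral>s. phi_integrand P q t x s \<partial>\<nu>) = (\<integral>s. G s \<partial>\<nu>)"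
      by (rule Bochner_Integration.integral_cong) (simp_all add: integrand \<nu>(1))
    moreover have "(\<integral>s. G s \<partial>\<nu>) = (\<integral>s. G s \<partial>N)"
      unfolding \<nu>(3) by (subst integral_distr) (auto simp: \<nu>(2))
    ultimately show ?thesis
      using G_val by (simp add: phi_well_defined_def phi_op_def)
  qed
  note eq = this
  have tail: "measure N {t<..} = levy_tail \<nu> t" if "0 < t" for t
  proof -
    have "(\<lambda>x. x) -` {t<..} \<inter> space \<nu> = {t<..}"
      unfolding \<nu>(1) using that by (auto intro: less_trans)
    moreover have "measure N {t<..} = measure \<nu> ((\<lambda>x. x) -` {t<..} \<inter> space \<nu>)"
      unfolding \<nu>(3) by (rule measure_distr[OF \<nu>(2)]) simp
    ultimately show ?thesis by (simp only: levy_tail_def)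
  qed
  show ?thesis
    unfolding is_solution_def operand_def
  proof (intro conjI allI impI)
    show "(\<lambda>(t, x). q t x) \<in> borel_measurable (restrict_space borel ({0..} \<times> UNIV))"
      by (rule borel_measurable_continuous_on_restrict[OF q_continuous])
    show "continuous_on ({0..} \<times> UNIV) (\<lambda>(t, x). q t x)"
      by (rule q_continuous)
    show "q t \<in> C0" if "0 \<le> t" for t
      by (rule q_C0[OF that])
    show "phi_well_defined \<nu> P q t x" if "0 < t" for t x
      using eq[OF that] by blast
    show "phi_op \<nu> P q t x = levy_tail \<nu> t * q 0 x" if "0 < t" for t x
      using conjunct2[OF eq[OF that, of x]] unfolding tail[OF that] q_0 .
    show "q 0 x = u x" for x by (rule q_0)
  qed
qed

end

section \<open>The time-changed process\<close>

locale time_changed_feller =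
  feller_process P Q M x + special_subordinator Q S \<phi> \<nu> p
  for P :: "real \<Rightarrow> ('e::t2_space \<Rightarrow> real) \<Rightarrow> 'e \<Rightarrow> real" and Q :: "'w measure" and M x S \<phi> \<nu> p +
  assumes indep: "independent_processes Q M S"
begin

lemma AE_H_le: "0 \<le> t \<Longrightarrow> AE \<omega> in Q. H t \<omega> \<le> t"
  using AE_H AE_H_0 by eventually_elim (cases "t = 0"; simp)

lemma AE_H_mono: "0 \<le> s \<Longrightarrow> s \<le> t \<Longrightarrow> AE \<omega> in Q. H s \<omega> \<le> H t \<omega>"
  using AE_H AE_H_0 AE_space by eventually_elim (cases "s = 0"; simp add: H_nonneg)

lemma H_integrable: "0 \<le> t \<Longrightarrow> integrable Q (H t)"
  using AE_H_le[of t] by (intro integrable_const_bound[where B = t]) (auto simp: H_nonneg)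

lemma expectation_time_changed:
  assumes u: "u \<in> C0" and t: "0 \<le> t"
  shows "(\<integral>\<omega>. u (time_changed M S t \<omega>) \<partial>Q) = (\<integral>\<omega>. P (max 0 (H t \<omega>)) u x \<partial>Q)"
proof -
  have "undershooting S t \<in> borel_measurable (path_algebra Q {0..} S)"
    by (rule undershooting_measurable) (auto intro: path_algebra_measurable S_cadlag S_strict_mono)
  then have "H t \<in> borel_measurable (path_algebra Q {0..} S)"
    by (simp add: H_def)
  from expectation_independent_time[OF u indep this S_measurable H_nonneg AE_H_le[OF t]]
  show ?thesis by (simp add: time_changed_def H_def)
qed

lemma expectation_time_changed_0:
  assumes u: "u \<in> C0"
  shows "(\<integral>\<omega>. u (time_changed M S 0 \<omega>) \<partial>Q) = u x"
proof -
  have [measurable]: "(\<lambda>y. P (max 0 y) u x) \<in> borel_measurable borel"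
    using P_continuous[OF u] by (rule borel_measurable_continuous_onI)
  have "(\<integral>\<omega>. P (max 0 (H 0 \<omega>)) u x \<partial>Q) = (\<integral>\<omega>. u x \<partial>Q)"
    using AE_H_0 by (intro integral_cong_AE) (auto elim!: eventually_mono simp: P_0[OF u])
  then show ?thesis by (simp add: expectation_time_changed[OF u] prob_space)
qed

lemma expectation_time_changed_pos:
  assumes u: "u \<in> C0" and t: "0 < t"
  shows "(\<integral>\<omega>. u (time_changed M S t \<omega>) \<partial>Q) = (\<integral>y. P (max 0 y) u x \<partial>undershoot t)"
proof -
  have [measurable]: "(\<lambda>y. P (max 0 y) u x) \<in> borel_measurable borel"
    using P_continuous[OF u] by (rule borel_measurable_continuous_onI)
  show ?thesis
    using t by (simp add: expectation_time_changed[OF u] distr_H[symmetric] integral_distr)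
qed

lemma expectation_H_diff:
  assumes "0 \<le> s" "s \<le> t"
  shows "(\<integral>\<omega>. H t \<omega> \<partial>Q) - (\<integral>\<omega>. H s \<omega> \<partial>Q) \<le> t - s"
proof -
  have E: "(\<integral>\<omega>. H r \<omega> \<partial>Q) = (\<integral>y. y \<partial>undershoot r)" if "0 < r" for r
    using that by (simp add: distr_H[symmetric] integral_distr)
  \<comment> \<open>\<open>undershoot\<close> describes H at positive times only; from s = 0 the
    bound H(t) \<le> t is used directly.\<close>
  consider "s = t" | "s = 0" "0 < t" | "0 < s" "s < t" using assms by linarith
  then show ?thesis
  proof cases
    case 2
    have "(\<integral>\<omega>. H t \<omega> \<partial>Q) \<le> (\<integral>\<omega>. t \<partial>Q)"
      using 2 by (intro integral_mono_AE H_integrable AE_H_le) auto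
    moreover have "0 \<le> (\<integral>\<omega>. H s \<omega> \<partial>Q)"
      by (intro Bochner_Integration.integral_nonneg) (simp add: H_nonneg)
    ultimately show ?thesis using 2 by (simp add: prob_space)
  next
    case 3
    then show ?thesis using mean_undershoot_diff[of "t - s" t] by (simp add: E)
  qed simp
qed

text \<open>The orbit of u is C-Lipschitz. As H is nondecreasing in t, the mean distance between its
  values at two times is the difference of the means, which is at most the elapsed time.\<close>

lemma expectation_time_changed_lipschitz:
  assumes gen: "generates P u g" and C: "\<And>x. \<bar>g x\<bar> \<le> C" and st: "0 \<le> s" "0 \<le> t"
  shows "\<bar>(\<integral>\<omega>. u (time_changed M S s \<omega>) \<partial>Q) - (\<integral>\<omega>. u (time_changed M S t \<omega>) \<partial>Q)\<bar> \<le> C * \<bar>s - t\<bar>"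
proof -
  have u: "u \<in> C0" using gen unfolding generates_def by blast
  have C0: "0 \<le> C" using C[of undefined] by linarith
  obtain B where B: "0 \<le> B" "\<And>x. \<bar>u x\<bar> \<le> B" by (rule C0_bounded[OF u]) auto
  have [measurable]: "(\<lambda>y. P (max 0 y) u x) \<in> borel_measurable borel"
    using P_continuous[OF u] by (rule borel_measurable_continuous_onI)
  have int: "integrable Q (\<lambda>\<omega>. P (max 0 (H r \<omega>)) u x)" for r
    using B u by (intro integrable_const_bound[where B = B]) (auto intro!: AE_I2 P_abs_le)
  have "\<bar>(\<integral>\<omega>. u (time_changed M S a \<omega>) \<partial>Q) - (\<integral>\<omega>. u (time_changed M S b \<omega>) \<partial>Q)\<bar> \<le> C * (b - a)"
    if ab: "0 \<le> a" "a \<le> b" for a b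
  proof -
    have "\<bar>(\<integral>\<omega>. u (time_changed M S a \<omega>) \<partial>Q) - (\<integral>\<omega>. u (time_changed M S b \<omega>) \<partial>Q)\<bar>
        = \<bar>\<integral>\<omega>. P (max 0 (H a \<omega>)) u x - P (max 0 (H b \<omega>)) u x \<partial>Q\<bar>"
      using ab int by (simp add: expectation_time_changed[OF u])
    also have "\<dots> \<le> (\<integral>\<omega>. \<bar>P (max 0 (H a \<omega>)) u x - P (max 0 (H b \<omega>)) u x\<bar> \<partial>Q)"
      by (rule integral_abs_bound)
    also have "\<dots> \<le> (\<integral>\<omega>. C * (H b \<omega> - H a \<omega>) \<partial>Q)"
    proof (rule integral_mono_AE)
      show "AE \<omega> in Q. \<bar>P (max 0 (H a \<omega>)) u x - P (max 0 (H b \<omega>)) u x\<bar> \<le> C * (H b \<omega> - H a \<omega>)"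
        using AE_H_mono[OF ab]
      proof eventually_elim
        case (elim \<omega>)
        have "\<bar>P (max 0 (H a \<omega>)) u x - P (max 0 (H b \<omega>)) u x\<bar> \<le> C * \<bar>max 0 (H a \<omega>) - max 0 (H b \<omega>)\<bar>"
          by (rule P_lipschitz[OF gen C]) auto
        also have "\<dots> \<le> C * (H b \<omega> - H a \<omega>)"
          using elim C0 by (intro mult_left_mono) auto
        finally show ?case .
      qed
    qed (use ab int H_integrable in auto)
    also have "\<dots> = C * ((\<integral>\<omega>. H b \<omega> \<partial>Q) - (\<integral>\<omega>. H a \<omega> \<partial>Q))"
      using ab H_integrable by simp
    also have "\<dots> \<le> C * (b - a)"
      by (intro mult_left_mono expectation_H_diff ab C0)
    finally show ?thesis .
  qed
  from this[of s t] this[of t s] st show ?thesis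
    by (cases "s \<le> t") (auto simp: abs_minus_commute)
qed

end

theorem theorem5p2:
  fixes \<phi> :: "real \<Rightarrow> real" and \<nu> :: "real measure" and p :: "real \<Rightarrow> real"
    and P :: "real \<Rightarrow> ('e::t2_space \<Rightarrow> real) \<Rightarrow> 'e \<Rightarrow> real"
    and Pr :: "'e \<Rightarrow> real \<Rightarrow> 'w measure" and \<Omega> :: "'w measure"
    and M :: "real \<Rightarrow> 'w \<Rightarrow> 'e" and S :: "real \<Rightarrow> 'w \<Rightarrow> real"
    and u :: "'e \<Rightarrow> real" and q :: "real \<Rightarrow> 'e \<Rightarrow> real"
  assumes E: "locally_compact_space (euclidean :: 'e topology)"
             "separable_space (euclidean :: 'e topology)"
    and phi: "\<phi> \<in> SB0" "levy_measure_of \<phi> \<nu>"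
    and prob: "\<And>x v. prob_space (Pr x v)" "\<And>x v. sets (Pr x v) = sets \<Omega>"
    and semigroup: "feller_semigroup P"
    and M: "\<And>x v. feller_process_from (Pr x v) P M x"
    and S: "\<And>x v. increasing_levy_from (Pr x v) S v"
    and indep: "\<And>x v. independent_processes (Pr x v) M S"
    and exponent: "\<And>x l. l > 0 \<Longrightarrow> \<phi> l = - ln (\<integral>\<omega>. exp (- l * from_zero S 1 \<omega>) \<partial>Pr x 0)"
    and potential: "\<And>x. potential_density (Pr x 0) S p"
    and log_integrable: "(\<integral>\<^sup>+ t\<in>{0<..1}. ennreal (\<bar>ln t\<bar> * p t) \<partial>lborel) < \<infinity>"
    and density: "\<And>x t. t > 0 \<Longrightarrow> \<exists>g. distributed (Pr x 0) lborel (from_zero S t) g"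
    and u: "u \<in> generator_dom P"
    and q: "\<And>t x. t \<ge> 0 \<Longrightarrow> q t x = (\<integral>\<omega>. u (time_changed M S t \<omega>) \<partial>Pr x 0)"
  shows "is_solution \<nu> P u q \<and> vanishes_locally_uniformly q \<and>
         (\<forall>q'. is_solution \<nu> P u q' \<and> vanishes_locally_uniformly q' \<longrightarrow>
               (\<forall>t\<ge>0. \<forall>x. q' t x = q t x))"
proof -
  interpret feller P by unfold_locales (rule semigroup)
  obtain g where gen: "generates P u g" using u unfolding generator_dom_def by blast
  then have u0: "u \<in> C0" and g0: "g \<in> C0" unfolding generates_def by blast+
  obtain C where C: "\<And>x. \<bar>g x\<bar> \<le> C" by (rule C0_bounded[OF g0]) auto
  have tc: "time_changed_feller P (Pr x 0) M x S \<phi> \<nu> p" for x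
  proof -
    interpret prob_space "Pr x 0" by (rule prob)
    show ?thesis
      by unfold_locales (rule M S exponent phi(2) potential indep, assumption?)+
  qed
  \<comment> \<open>\<open>T.N\<close>, \<open>T.potential_fun\<close> and
    \<open>T.undershoot\<close> depend on \<open>\<nu>\<close> and \<open>p\<close> but not on the
    starting point, so an arbitrary one can anchor the interpretation for all x.\<close>
  interpret T: time_changed_feller P "Pr undefined 0" M undefined S \<phi> \<nu> p by (rule tc)
  interpret R: feller_renewal P T.N T.potential_fun u g C q
  proof
    show "q 0 x = u x" for x
      using time_changed_feller.expectation_time_changed_0[OF tc u0, of x] by (simp add: q)
    show "q t x = (\<integral>y. P (max 0 y) u x \<partial>T.undershoot t)" if "0 < t" for t x
      using time_changed_feller.expectation_time_changed_pos[OF tc u0 that, of x] that by (simp add: q)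
    show "\<bar>q s x - q t x\<bar> \<le> C * \<bar>s - t\<bar>" if "0 \<le> s" "0 \<le> t" for s t x
      using time_changed_feller.expectation_time_changed_lipschitz[OF tc gen C that, of x] that by (simp add: q)
  qed (rule gen C)+
  have sol: "is_solution \<nu> P u q"
    by (rule R.q_solution[OF T.space_levy T.measurable_levy T.N_def])
  have "q' t x = q t x"
    if "is_solution \<nu> P u q'" "vanishes_locally_uniformly q'" "0 \<le> t" for q' t x
    using solution_le[OF T.space_levy T.levy_infinite that(1,2) sol R.q_vanishes that(3)]
      solution_le[OF T.space_levy T.levy_infinite sol R.q_vanishes that]
    by (rule antisym)
  with sol R.q_vanishes show ?thesis by blast
qed

end
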